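(* Let $n\ge 3$, let $\mathcal{H}$ be a Hilbert space and let $T=(T_1,\ldots,T_n)\in\mathfrak{B}^n_{1,n}(\mathcal{H})$. Then $T$ has an isometric dilation $W=(W_1,\ldots,W_n)$ such that $\hat{W}_1=(W_2,\ldots,W_n)$ and $\hat{W}_n=(W_1,\ldots,W_{n-1})$ are $*$-regular isometric dilations of $\hat{T}_1=(T_2,\ldots,T_n)$ and $\hat{T}_n=(T_1,\ldots,T_{n-1})$, respectively.
   Context: Hilbert spaces are complex. $\mathcal{T}^m(\mathcal{H})$ is the set of $m$-tuples of commuting contractions in $\mathcal{B}(\mathcal{H})$. For $T\in\mathcal{T}^m(\mathcal{H})$ and $\bm{k}=(k_1,\ldots,k_m)\in\mathbb{Z}_+^m$, $T^{\bm{k}}=T_1^{k_1}\cdots T_m^{k_m}$ and $T^{*\bm k}=(T^{\bm k})^*$. For $F=\{n_1,\ldots,n_k\}\subset\{1,\ldots,m\}$, $T_F=T_{n_1}\cdots T_{n_k}$, with $T_\emptyset=I_{\mathcal{H}}$. $T\in\mathcal{T}^m(\mathcal{H})$ satisfies Brehmer positivity if $\sum_{F\subset G}(-1)^{|F|}T_FT_F^*\ge 0$ for all $G\subset\{1,\ldots,m\}$; $\mathfrak{B}^m(\mathcal{H})$ denotes the set of all such $T$. For an $n$-tuple $T$, $\hat{T}_i$ denotes the $(n-1)$-tuple obtained by deleting $T_i$. For $1\le p<q\le n$, $\mathfrak{B}^n_{p,q}(\mathcal{H})=\{T\in\mathcal{T}^n(\mathcal{H}):\hat{T}_p,\hat{T}_q\in\mathfrak{B}^{n-1}(\mathcal{H})\}$.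 An $m$-tuple of commuting isometries $V\in\mathcal{T}^m(\mathcal{K})$, with $\mathcal{K}\supset\mathcal{H}$ a Hilbert space, is an isometric dilation of $T\in\mathcal{T}^m(\mathcal{H})$ if $T^{\bm{k}}=P_{\mathcal{H}}V^{\bm{k}}|_{\mathcal{H}}$ for all $\bm{k}\in\mathbb{Z}_+^m$. It is $*$-regular if moreover $P_{\mathcal{H}}V^{*\bm\alpha_-}V^{\bm\alpha_+}|_{\mathcal{H}}=T^{\bm\alpha_+}T^{*\bm\alpha_-}$ for all $\bm\alpha\in\mathbb{Z}^m$, where $\bm\alpha_+=(\max\{\alpha_i,0\})_i$ and $\bm\alpha_-=(\max\{-\alpha_i,0\})_i$. *)

theory Defs
  imports "HOL-Analysis.Analysis" "HOL-Library.Complex_Order"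
begin

section \<open>Complex Hilbert spaces\<close>

text \<open>
  The inner product \<open>cinner\<close> is linear in its first argument.  The real inner product underlying
  the norm and the topology is its real part, so positive definiteness of \<open>cinner\<close> is inherited
  from \<^class>\<open>real_inner\<close>.
\<close>

class chilbert_space = real_inner + complete_space +
  fixes scaleC :: "complex \<Rightarrow> 'a \<Rightarrow> 'a" (infixr "*\<^sub>C" 75)
    and cinner :: "'a \<Rightarrow> 'a \<Rightarrow> complex"
  assumes scaleC_add_right: "a *\<^sub>C (x + y) = a *\<^sub>C x + a *\<^sub>C y"
    and scaleC_add_left: "(a + b) *\<^sub>C x = a *\<^sub>C x + b *\<^sub>C x"
    and scaleC_scaleC: "a *\<^sub>C b *\<^sub>C x = (a * b) *\<^sub>C x"
    and scaleC_of_real: "complex_of_real r *\<^sub>C x = r *\<^sub>R x"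
    and cinner_add_left: "cinner (x + y) z = cinner x z + cinner y z"
    and cinner_scaleC_left: "cinner (a *\<^sub>C x) y = a * cinner x y"
    and cinner_commute: "cinner x y = cnj (cinner y x)"
    and Re_cinner: "Re (cinner x y) = x \<bullet> y"


section \<open>The Hilbert space of square-summable families\<close>

typedef 'i ell2 = "{f :: 'i \<Rightarrow> complex. (\<lambda>i. (cmod (f i))\<^sup>2) summable_on UNIV}"
  by (rule exI[of _ "\<lambda>_. 0"]) simp

setup_lifting type_definition_ell2

lemma ell2_add:
  fixes f g :: "'i \<Rightarrow> complex"
  assumes "(\<lambda>i. (cmod (f i))\<^sup>2) summable_on UNIV" and "(\<lambda>i. (cmod (g i))\<^sup>2) summable_on UNIV"
  shows "(\<lambda>i. (cmod (f i + g i))\<^sup>2) summable_on UNIV"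
proof (rule summable_on_comparison_test)
  show "(\<lambda>i. 2 * (cmod (f i))\<^sup>2 + 2 * (cmod (g i))\<^sup>2) summable_on UNIV"
    by (intro summable_on_add summable_on_cmult_right assms)
  fix i
  have "(cmod (f i + g i))\<^sup>2 \<le> (cmod (f i) + cmod (g i))\<^sup>2"
    by (simp add: norm_triangle_ineq power_mono)
  also have "\<dots> \<le> 2 * (cmod (f i))\<^sup>2 + 2 * (cmod (g i))\<^sup>2"
    using sum_squares_bound[of "cmod (f i)" "cmod (g i)"] by (simp add: power2_sum)
  finally show "(cmod (f i + g i))\<^sup>2 \<le> 2 * (cmod (f i))\<^sup>2 + 2 * (cmod (g i))\<^sup>2" .
qed simp

lemma ell2_scale:
  fixes f :: "'i \<Rightarrow> complex"
  assumes "(\<lambda>i. (cmod (f i))\<^sup>2) summable_on UNIV"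
  shows "(\<lambda>i. (cmod (a * f i))\<^sup>2) summable_on UNIV"
  using summable_on_cmult_right[OF assms, of "(cmod a)\<^sup>2"] by (simp add: norm_mult power_mult_distrib)

lemma ell2_diff:
  fixes f g :: "'i \<Rightarrow> complex"
  assumes "(\<lambda>i. (cmod (f i))\<^sup>2) summable_on UNIV" and "(\<lambda>i. (cmod (g i))\<^sup>2) summable_on UNIV"
  shows "(\<lambda>i. (cmod (f i - g i))\<^sup>2) summable_on UNIV"
  using ell2_add[OF assms(1) ell2_scale[OF assms(2), of "-1"]] by simp

lemma ell2_prod:
  fixes f g :: "'i \<Rightarrow> complex"
  assumes "(\<lambda>i. (cmod (f i))\<^sup>2) summable_on UNIV" and "(\<lambda>i. (cmod (g i))\<^sup>2) summable_on UNIV"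
  shows "(\<lambda>i. f i * cnj (g i)) summable_on UNIV"
proof -
  have "(\<lambda>i. cmod (f i * cnj (g i))) summable_on UNIV"
  proof (rule summable_on_comparison_test)
    show "(\<lambda>i. (cmod (f i))\<^sup>2 + (cmod (g i))\<^sup>2) summable_on UNIV"
      by (intro summable_on_add assms)
    fix i
    have "2 * (cmod (f i) * cmod (g i)) \<le> (cmod (f i))\<^sup>2 + (cmod (g i))\<^sup>2"
      using sum_squares_bound[of "cmod (f i)" "cmod (g i)"] by simp
    then show "cmod (f i * cnj (g i)) \<le> (cmod (f i))\<^sup>2 + (cmod (g i))\<^sup>2"
      using mult_nonneg_nonneg[OF norm_ge_zero[of "f i"] norm_ge_zero[of "g i"]]
      unfolding norm_mult complex_mod_cnj by linarith
  qed simp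
  then show ?thesis by (rule abs_summable_summable)
qed

instantiation ell2 :: (type) real_vector
begin

lift_definition zero_ell2 :: "'a ell2" is "\<lambda>_. 0" by simp
lift_definition plus_ell2 :: "'a ell2 \<Rightarrow> 'a ell2 \<Rightarrow> 'a ell2" is "\<lambda>f g i. f i + g i" by (rule ell2_add)
lift_definition minus_ell2 :: "'a ell2 \<Rightarrow> 'a ell2 \<Rightarrow> 'a ell2" is "\<lambda>f g i. f i - g i" by (rule ell2_diff)
lift_definition uminus_ell2 :: "'a ell2 \<Rightarrow> 'a ell2" is "\<lambda>f i. - f i" by simp
lift_definition scaleR_ell2 :: "real \<Rightarrow> 'a ell2 \<Rightarrow> 'a ell2" is "\<lambda>r f i. complex_of_real r * f i"
  by (rule ell2_scale)

instance
  by standard (transfer; simp add: fun_eq_iff algebra_simps)+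

end

lift_definition cinner_ell2_raw :: "'i ell2 \<Rightarrow> 'i ell2 \<Rightarrow> complex"
  is "\<lambda>f g. \<Sum>\<^sub>\<infinity>i. f i * cnj (g i)" .

lemma cinner_ell2_raw_add: "cinner_ell2_raw (x + y) z = cinner_ell2_raw x z + cinner_ell2_raw y z"
  by transfer (simp add: distrib_right infsum_add ell2_prod)

lemma cinner_ell2_raw_commute: "cinner_ell2_raw x y = cnj (cinner_ell2_raw y x)"
  by transfer (simp flip: infsum_cnj add: mult.commute)

lemma cinner_ell2_raw_self: "cinner_ell2_raw x x = complex_of_real (\<Sum>\<^sub>\<infinity>i. (cmod (Rep_ell2 x i))\<^sup>2)"
proof -
  have "(\<lambda>i. (cmod (Rep_ell2 x i))\<^sup>2) summable_on UNIV" using Rep_ell2[of x] by simp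
  then have "((\<lambda>i. complex_of_real ((cmod (Rep_ell2 x i))\<^sup>2)) has_sum
      complex_of_real (\<Sum>\<^sub>\<infinity>i. (cmod (Rep_ell2 x i))\<^sup>2)) UNIV"
    by (intro has_sum_bounded_linear[OF bounded_linear_of_real]) (rule has_sum_infsum)
  then show ?thesis
    unfolding cinner_ell2_raw.rep_eq by (simp add: infsumI complex_norm_square del: of_real_power)
qed

instantiation ell2 :: (type) real_inner
begin

definition inner_ell2 :: "'a ell2 \<Rightarrow> 'a ell2 \<Rightarrow> real" where
  "inner_ell2 x y = Re (cinner_ell2_raw x y)"
definition norm_ell2 :: "'a ell2 \<Rightarrow> real" where
  "norm_ell2 x = sqrt (inner x x)"
definition sgn_ell2 :: "'a ell2 \<Rightarrow> 'a ell2" where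
  "sgn_ell2 x = inverse (norm x) *\<^sub>R x"
definition dist_ell2 :: "'a ell2 \<Rightarrow> 'a ell2 \<Rightarrow> real" where
  "dist_ell2 x y = norm (x - y)"
definition uniformity_ell2 :: "('a ell2 \<times> 'a ell2) filter" where
  "uniformity_ell2 = (INF e\<in>{0<..}. principal {(x, y). dist x y < e})"
definition open_ell2 :: "'a ell2 set \<Rightarrow> bool" where
  "open_ell2 U \<longleftrightarrow> (\<forall>x\<in>U. eventually (\<lambda>(x', y). x' = x \<longrightarrow> y \<in> U) uniformity)"

instance
proof
  fix x y z :: "'a ell2" and r :: real
  show "inner x y = inner y x"
    by (simp add: inner_ell2_def cinner_ell2_raw_commute[of x y])
  show "inner (x + y) z = inner x z + inner y z"
    by (simp add: inner_ell2_def cinner_ell2_raw_add)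
  show "inner (r *\<^sub>R x) y = r * inner x y"
  proof -
    have "cinner_ell2_raw (r *\<^sub>R x) y = complex_of_real r * cinner_ell2_raw x y"
      by transfer (simp add: mult.assoc infsum_cmult_right')
    then show ?thesis by (simp add: inner_ell2_def)
  qed
  show "0 \<le> inner x x"
    by (simp add: inner_ell2_def cinner_ell2_raw_self infsum_nonneg)
  show "inner x x = 0 \<longleftrightarrow> x = 0"
  proof
    assume "inner x x = 0"
    then have *: "(\<Sum>\<^sub>\<infinity>i. (cmod (Rep_ell2 x i))\<^sup>2) = 0"
      by (simp add: inner_ell2_def cinner_ell2_raw_self)
    have "Rep_ell2 x i = 0" for i
      using nonneg_infsum_le_0D[of "\<lambda>i. (cmod (Rep_ell2 x i))\<^sup>2" UNIV i] * Rep_ell2[of x] by simp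
    then show "x = 0"
      by transfer (simp add: fun_eq_iff)
  next
    assume "x = 0"
    then show "inner x x = 0"
      by (simp add: inner_ell2_def cinner_ell2_raw_self zero_ell2.rep_eq)
  qed
qed (rule norm_ell2_def sgn_ell2_def dist_ell2_def uniformity_ell2_def open_ell2_def)+

end

lemma norm_ell2_sq: "(norm (x :: 'i ell2))\<^sup>2 = (\<Sum>\<^sub>\<infinity>i. (cmod (Rep_ell2 x i))\<^sup>2)"
  by (simp add: power2_norm_eq_inner inner_ell2_def cinner_ell2_raw_self)

lemma sum_le_norm_ell2_sq:
  fixes x :: "'i ell2"
  assumes "finite F"
  shows "(\<Sum>i\<in>F. (cmod (Rep_ell2 x i))\<^sup>2) \<le> (norm x)\<^sup>2"
  unfolding norm_ell2_sq using Rep_ell2[of x] assms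
  by (intro finite_sum_le_infsum) auto

lemma norm_Rep_ell2_le: "cmod (Rep_ell2 x i) \<le> norm x"
  using sum_le_norm_ell2_sq[of "{i}" x] by simp

instance ell2 :: (type) complete_space
proof
  fix X :: "nat \<Rightarrow> 'a ell2"
  assume X: "Cauchy X"
  have "Cauchy (\<lambda>n. Rep_ell2 (X n) i)" for i
  proof (rule metric_CauchyI)
    fix e :: real assume "e > 0"
    then obtain M where M: "\<And>m n. m \<ge> M \<Longrightarrow> n \<ge> M \<Longrightarrow> dist (X m) (X n) < e"
      using metric_CauchyD[OF X] by blast
    have "dist (Rep_ell2 (X m) i) (Rep_ell2 (X n) i) < e" if "m \<ge> M" "n \<ge> M" for m n
      using norm_Rep_ell2_le[of "X m - X n" i] M[OF that] by (simp add: dist_norm minus_ell2.rep_eq)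
    then show "\<exists>M. \<forall>m\<ge>M. \<forall>n\<ge>M. dist (Rep_ell2 (X m) i) (Rep_ell2 (X n) i) < e" by blast
  qed
  then have "\<exists>l. (\<lambda>n. Rep_ell2 (X n) i) \<longlonglongrightarrow> l" for i
    using Cauchy_convergent convergent_def by blast
  then obtain g where g: "\<And>i. (\<lambda>n. Rep_ell2 (X n) i) \<longlonglongrightarrow> g i" by metis
  have bound: "(\<Sum>i\<in>F. (cmod (Rep_ell2 (X m) i - g i))\<^sup>2) \<le> e\<^sup>2"
    if M: "\<And>m n. m \<ge> M \<Longrightarrow> n \<ge> M \<Longrightarrow> dist (X m) (X n) < e" and "m \<ge> M" "finite F" for e M m F
  proof (rule LIMSEQ_le_const2)
    show "(\<lambda>n. \<Sum>i\<in>F. (cmod (Rep_ell2 (X m) i - Rep_ell2 (X n) i))\<^sup>2)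
        \<longlonglongrightarrow> (\<Sum>i\<in>F. (cmod (Rep_ell2 (X m) i - g i))\<^sup>2)"
      by (intro tendsto_intros g)
    have "(\<Sum>i\<in>F. (cmod (Rep_ell2 (X m) i - Rep_ell2 (X n) i))\<^sup>2) \<le> e\<^sup>2" if "n \<ge> M" for n
    proof -
      have "(\<Sum>i\<in>F. (cmod (Rep_ell2 (X m) i - Rep_ell2 (X n) i))\<^sup>2) \<le> (norm (X m - X n))\<^sup>2"
        using sum_le_norm_ell2_sq[OF \<open>finite F\<close>, of "X m - X n"] by (simp add: minus_ell2.rep_eq)
      also have "\<dots> \<le> e\<^sup>2"
        using M[OF \<open>m \<ge> M\<close> that] by (intro power_mono) (auto simp: dist_norm)
      finally show ?thesis .
    qed
    then show "\<exists>N. \<forall>n\<ge>N. (\<Sum>i\<in>F. (cmod (Rep_ell2 (X m) i - Rep_ell2 (X n) i))\<^sup>2) \<le> e\<^sup>2" by blast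
  qed
  have diff: "(\<lambda>i. (cmod (Rep_ell2 (X m) i - g i))\<^sup>2) summable_on UNIV"
    if M: "\<And>m n. m \<ge> M \<Longrightarrow> n \<ge> M \<Longrightarrow> dist (X m) (X n) < e" and "m \<ge> M" for e M m
  proof (rule nonneg_bounded_partial_sums_imp_summable_on)
    show "eventually (\<lambda>F. (\<Sum>i\<in>F. (cmod (Rep_ell2 (X m) i - g i))\<^sup>2) \<le> e\<^sup>2) (finite_subsets_at_top UNIV)"
      using bound[OF M \<open>m \<ge> M\<close>] by (auto intro!: eventually_finite_subsets_at_top_weakI)
  qed simp
  obtain M1 where M1: "\<And>m n. m \<ge> M1 \<Longrightarrow> n \<ge> M1 \<Longrightarrow> dist (X m) (X n) < 1"
    using metric_CauchyD[OF X, of 1] by auto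
  have "(\<lambda>i. (cmod (Rep_ell2 (X M1) i - (Rep_ell2 (X M1) i - g i)))\<^sup>2) summable_on UNIV"
    by (rule ell2_diff[OF _ diff[OF M1 order_refl]]) (use Rep_ell2[of "X M1"] in simp_all)
  then have gs: "g \<in> {f. (\<lambda>i. (cmod (f i))\<^sup>2) summable_on UNIV}" by simp
  have "X \<longlonglongrightarrow> Abs_ell2 g"
  proof (rule metric_LIMSEQ_I)
    fix r :: real assume r: "r > 0"
    then obtain M where M: "\<And>m n. m \<ge> M \<Longrightarrow> n \<ge> M \<Longrightarrow> dist (X m) (X n) < r / 2"
      using metric_CauchyD[OF X, of "r / 2"] by auto
    have "dist (X m) (Abs_ell2 g) < r" if "m \<ge> M" for m
    proof -
      have "(norm (X m - Abs_ell2 g))\<^sup>2 = (\<Sum>\<^sub>\<infinity>i. (cmod (Rep_ell2 (X m) i - g i))\<^sup>2)"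
        by (simp add: norm_ell2_sq minus_ell2.rep_eq Abs_ell2_inverse[OF gs])
      also have "\<dots> \<le> (r / 2)\<^sup>2"
        using diff[OF M that] bound[OF M that] by (intro infsum_le_finite_sums) auto
      finally have "norm (X m - Abs_ell2 g) \<le> r / 2"
        using r by (meson half_gt_zero less_imp_le power2_le_imp_le)
      then show ?thesis using r by (simp add: dist_norm)
    qed
    then show "\<exists>no. \<forall>n\<ge>no. dist (X n) (Abs_ell2 g) < r" by blast
  qed
  then show "convergent X" by (auto simp: convergent_def)
qed

instantiation ell2 :: (type) chilbert_space
begin

lift_definition scaleC_ell2 :: "complex \<Rightarrow> 'a ell2 \<Rightarrow> 'a ell2" is "\<lambda>a f i. a * f i"
  by (rule ell2_scale)
definition cinner_ell2 :: "'a ell2 \<Rightarrow> 'a ell2 \<Rightarrow> complex" where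
  "cinner_ell2 = cinner_ell2_raw"

instance
proof
  fix a b :: complex and r :: real and x y z :: "'a ell2"
  show "a *\<^sub>C (x + y) = a *\<^sub>C x + a *\<^sub>C y"
    and "(a + b) *\<^sub>C x = a *\<^sub>C x + b *\<^sub>C x"
    and "a *\<^sub>C b *\<^sub>C x = (a * b) *\<^sub>C x"
    and "complex_of_real r *\<^sub>C x = r *\<^sub>R x"
    by (transfer; simp add: fun_eq_iff algebra_simps)+
  show "cinner (x + y) z = cinner x z + cinner y z"
    unfolding cinner_ell2_def by (rule cinner_ell2_raw_add)
  show "cinner (a *\<^sub>C x) y = a * cinner x y"
    unfolding cinner_ell2_def by transfer (simp add: mult.assoc infsum_cmult_right')
  show "cinner x y = cnj (cinner y x)"
    unfolding cinner_ell2_def by (rule cinner_ell2_raw_commute)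
  show "Re (cinner x y) = x \<bullet> y"
    by (simp add: cinner_ell2_def inner_ell2_def)
qed

end


section \<open>Operators\<close>

definition clinear :: "('a::chilbert_space \<Rightarrow> 'b::chilbert_space) \<Rightarrow> bool" where
  "clinear A \<longleftrightarrow> (\<forall>x y. A (x + y) = A x + A y) \<and> (\<forall>a x. A (a *\<^sub>C x) = a *\<^sub>C A x)"

definition contraction :: "('a::chilbert_space \<Rightarrow> 'b::chilbert_space) \<Rightarrow> bool" where
  "contraction A \<longleftrightarrow> clinear A \<and> (\<forall>x. norm (A x) \<le> norm x)"

definition isometry :: "('a::chilbert_space \<Rightarrow> 'b::chilbert_space) \<Rightarrow> bool" where
  "isometry A \<longleftrightarrow> clinear A \<and> (\<forall>x. norm (A x) = norm x)"

text \<open>Meaningful only for bounded \<open>A\<close>; all operators it is applied to below are contractions.\<close>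

definition cadjoint :: "('a::chilbert_space \<Rightarrow> 'b::chilbert_space) \<Rightarrow> 'b \<Rightarrow> 'a" where
  "cadjoint A = (THE B. \<forall>x y. cinner (A x) y = cinner x (B y))"

text \<open>The order on \<^typ>\<open>complex\<close> makes \<open>0 \<le> z\<close> mean that \<open>z\<close> is real and nonnegative.\<close>

definition positive_op :: "('a::chilbert_space \<Rightarrow> 'a) \<Rightarrow> bool" where
  "positive_op A \<longleftrightarrow> (\<forall>x. 0 \<le> cinner (A x) x)"


section \<open>Tuples of commuting contractions\<close>

text \<open>
  An \<open>m\<close>-tuple \<open>(T 1, \<dots>, T m)\<close> is a function on \<^typ>\<open>nat\<close>; its values outside \<open>{1..m}\<close> are
  irrelevant.  Likewise only the entries \<open>k 1, \<dots>, k m\<close> of a multi-index matter.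
\<close>

definition commuting_contractions :: "nat \<Rightarrow> (nat \<Rightarrow> 'a::chilbert_space \<Rightarrow> 'a) set" where
  "commuting_contractions m = {T. (\<forall>i\<in>{1..m}. contraction (T i)) \<and>
     (\<forall>i\<in>{1..m}. \<forall>j\<in>{1..m}. T i \<circ> T j = T j \<circ> T i)}"

definition tuple_power :: "nat \<Rightarrow> (nat \<Rightarrow> 'a \<Rightarrow> 'a) \<Rightarrow> (nat \<Rightarrow> nat) \<Rightarrow> 'a \<Rightarrow> 'a" where
  "tuple_power m T k = foldr (\<lambda>i A. (T i ^^ k i) \<circ> A) [1..<Suc m] id"

definition tuple_prod :: "(nat \<Rightarrow> 'a \<Rightarrow> 'a) \<Rightarrow> nat set \<Rightarrow> 'a \<Rightarrow> 'a" where
  "tuple_prod T F = foldr (\<lambda>i A. T i \<circ> A) (sorted_list_of_set F) id"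

definition delete_entry :: "nat \<Rightarrow> (nat \<Rightarrow> 'b) \<Rightarrow> nat \<Rightarrow> 'b" where
  "delete_entry p T = (\<lambda>i. if i < p then T i else T (Suc i))"

definition brehmer :: "nat \<Rightarrow> (nat \<Rightarrow> 'a::chilbert_space \<Rightarrow> 'a) set" where
  "brehmer m = {T \<in> commuting_contractions m. \<forall>G\<subseteq>{1..m}.
     positive_op (\<lambda>x. \<Sum>F\<in>Pow G. (-1) ^ card F *\<^sub>C tuple_prod T F (cadjoint (tuple_prod T F) x))}"

definition brehmer_pq :: "nat \<Rightarrow> nat \<Rightarrow> nat \<Rightarrow> (nat \<Rightarrow> 'a::chilbert_space \<Rightarrow> 'a) set" where
  "brehmer_pq n p q = {T \<in> commuting_contractions n.
     delete_entry p T \<in> brehmer (n - 1) \<and> delete_entry q T \<in> brehmer (n - 1)}"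


section \<open>Isometric dilations\<close>

text \<open>
  The inclusion of \<open>\<H>\<close> in \<open>\<K>\<close> is an isometry \<open>J\<close>, and \<open>\<H>\<close> is identified with its range.  The
  projection of \<open>\<K>\<close> onto \<open>\<H>\<close>, as a map into \<open>\<H>\<close>, is then the adjoint of \<open>J\<close>.
\<close>

definition isometric_dilation ::
  "nat \<Rightarrow> (nat \<Rightarrow> 'a::chilbert_space \<Rightarrow> 'a) \<Rightarrow> ('a \<Rightarrow> 'k::chilbert_space) \<Rightarrow> (nat \<Rightarrow> 'k \<Rightarrow> 'k) \<Rightarrow> bool"
where
  "isometric_dilation m T J V \<longleftrightarrow> isometry J \<and>
     V \<in> commuting_contractions m \<and> (\<forall>i\<in>{1..m}. isometry (V i)) \<and>
     (\<forall>k. tuple_power m T k = cadjoint J \<circ> tuple_power m V k \<circ> J)"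

definition pos_index :: "(nat \<Rightarrow> int) \<Rightarrow> nat \<Rightarrow> nat" where
  "pos_index \<alpha> = (\<lambda>i. nat (max (\<alpha> i) 0))"

definition neg_index :: "(nat \<Rightarrow> int) \<Rightarrow> nat \<Rightarrow> nat" where
  "neg_index \<alpha> = (\<lambda>i. nat (max (- \<alpha> i) 0))"

definition star_regular_dilation ::
  "nat \<Rightarrow> (nat \<Rightarrow> 'a::chilbert_space \<Rightarrow> 'a) \<Rightarrow> ('a \<Rightarrow> 'k::chilbert_space) \<Rightarrow> (nat \<Rightarrow> 'k \<Rightarrow> 'k) \<Rightarrow> bool"
where
  "star_regular_dilation m T J V \<longleftrightarrow> isometric_dilation m T J V \<and>
     (\<forall>\<alpha>. cadjoint J \<circ> cadjoint (tuple_power m V (neg_index \<alpha>)) \<circ> tuple_power m V (pos_index \<alpha>) \<circ> J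
          = tuple_power m T (pos_index \<alpha>) \<circ> cadjoint (tuple_power m T (neg_index \<alpha>)))"

text \<open>
  A statement cannot quantify existentially over types, so the existence of a dilation space is
  expressed with one space attached to \<open>\<H> = 'a\<close>, which is large enough to lose no generality.
  Indeed, let \<open>V\<close> be any isometric dilation of \<open>T\<close>.  It restricts to the closed span of the vectors
  \<open>V\<^bsup>k\<^esup> (J h)\<close>, and the restriction is again an isometric dilation, with the same compressions
  \<open>P V\<^sup>*\<^sup>\<alpha>\<^sup>- V\<^sup>\<alpha>\<^sup>+\<close> to \<open>\<H>\<close>.  An orthonormal basis of this span has at most as many elements as the
  index set \<open>(nat \<Rightarrow> nat) \<times> 'a\<close>, so the span is isometric to a closed subspace of the space below, and
  \<open>V\<close> may be extended by the identity on the orthogonal complement without changing these compressions.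
\<close>

type_synonym 'a dilation_space = "((nat \<Rightarrow> nat) \<times> 'a) ell2"

end

theory Submission
  imports Defs "HOL-Computational_Algebra.Formal_Power_Series"
begin

text \<open>
  If commuting isometries \<open>W i\<close> satisfy \<open>W i\<^sup>* J = J T i\<^sup>*\<close>, then they dilate the \<open>T i\<close>, and the dilation is
  \<open>*\<close>-regular as soon as different entries doubly commute: \<open>W\<^bsup>*\<alpha>-\<^esup> W\<^bsup>\<alpha>+\<^esup> = W\<^bsup>\<alpha>+\<^esup> W\<^bsup>*\<alpha>-\<^esup>\<close>, and the adjoints
  restrict to \<open>\<H>\<close> (locale \<open>tuple_coextension\<close>).  So it suffices to find such a tuple in which every pair
  except \<open>W 1\<close>, \<open>W n\<close> doubly commutes.  This is done in two stages.

  The first stage makes the middle operators \<open>T 2, \<dots>, T (n - 1)\<close> into doubly commuting isometries \<open>V i\<close>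
  and takes the outer two along (\<open>brehmer_coextension\<close>).  The inner products \<open>\<langle>V\<^sup>k h, V\<^sup>l g\<rangle>\<close> are forced to
  be \<open>\<langle>T\<^bsup>*(l-k)+\<^esup> h, T\<^bsup>*(k-l)+\<^esup> g\<rangle>\<close>, and Brehmer positivity of the middle tuple says that this kernel is
  positive (\<open>brehmer_form_sum_nonneg\<close>, an induction on the variables that works for general forms in place
  of the inner product), hence a Gram matrix (\<open>positive_kernel_factorization\<close>).  The assignment
  \<open>V\<^sup>k h \<mapsto> V\<^sup>k T 1\<^sup>* h\<close> is a contraction because the form \<open>\<langle>x, y\<rangle> - \<langle>T 1\<^sup>* x, T 1\<^sup>* y\<rangle>\<close> inherits the positivity
  from \<open>(T 1, \<dots>, T (n - 1))\<close>.  Its adjoint \<open>S\<close> is a lift of \<open>T 1\<close> that doubly commutes with all \<open>V i\<close>, and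
  \<open>(T 2, \<dots>, T n)\<close> gives in the same way a lift \<open>R\<close> of \<open>T n\<close> that commutes with \<open>S\<close>.

  The second stage applies Ando's theorem to the pair \<open>S\<close>, \<open>R\<close>, in a form that respects the \<open>V i\<close>
  (\<open>functorial_ando\<close>).  The isometric lifts of \<open>S\<close> and \<open>R\<close> are built from defect operators, which are power
  series (\<open>defect_operator\<close>), and from a unitary that is an explicit block matrix rather than an arbitrary
  extension of a partial isometry (\<open>julia_unitary\<close>).  Operators that commute with \<open>S\<close>, \<open>R\<close> and their
  adjoints therefore commute with every ingredient, and act diagonally on the dilation space.

  The second stage lives on the direct sum of a space with square-summable sequences of copies of it.  The
  dilation space is infinite-dimensional, so such a direct sum is isometrically isomorphic to the dilation
  space itself (\<open>ell2_sequence_model\<close>).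
\<close>

section \<open>Calculus in complex Hilbert spaces\<close>

instance chilbert_space \<subseteq> banach ..

lemma scaleC_one [simp]: "1 *\<^sub>C x = (x::'a::chilbert_space)"
  using scaleC_of_real[of 1 x] by simp

lemma scaleC_zero_left [simp]: "0 *\<^sub>C x = (0::'a::chilbert_space)"
  using scaleC_of_real[of 0 x] by simp

lemma scaleC_zero_right [simp]: "a *\<^sub>C 0 = (0::'a::chilbert_space)"
  using scaleC_add_right[of a 0 "0::'a"] by simp

lemma scaleC_minus_right: "a *\<^sub>C (- x) = - (a *\<^sub>C (x::'a::chilbert_space))"
  using scaleC_add_right[of a x "- x"] by (simp add: add_eq_0_iff)

lemma scaleC_diff_right: "a *\<^sub>C (x - y) = a *\<^sub>C x - a *\<^sub>C (y::'a::chilbert_space)"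
  using scaleC_add_right[of a x "- y"] by (simp add: scaleC_minus_right)

lemma scaleC_scaleR: "a *\<^sub>C (r *\<^sub>R x) = r *\<^sub>R (a *\<^sub>C (x::'a::chilbert_space))"
  by (simp flip: scaleC_of_real add: scaleC_scaleC mult.commute)

lemma cinner_add_right: "cinner x (y + z) = cinner x y + cinner x z"
  by (metis cinner_add_left cinner_commute complex_cnj_add)

lemma cinner_scaleC_right: "cinner x (a *\<^sub>C y) = cnj a * cinner x y"
  by (metis cinner_commute cinner_scaleC_left complex_cnj_mult)

lemma cinner_zero_left [simp]: "cinner 0 y = 0"
  using cinner_add_left[of 0 0 y] by simp

lemma cinner_zero_right [simp]: "cinner y 0 = 0"
  using cinner_add_right[of y 0 0] by simp

lemma cinner_minus_left: "cinner (- x) y = - cinner x y"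
  using cinner_add_left[of x "- x" y] by (simp add: add_eq_0_iff)

lemma cinner_minus_right: "cinner y (- x) = - cinner y x"
  using cinner_add_right[of y x "- x"] by (simp add: add_eq_0_iff)

lemma cinner_diff_left: "cinner (x - y) z = cinner x z - cinner y z"
  using cinner_add_left[of x "- y" z] by (simp add: cinner_minus_left)

lemma cinner_diff_right: "cinner z (x - y) = cinner z x - cinner z y"
  using cinner_add_right[of z x "- y"] by (simp add: cinner_minus_right)

lemma cinner_sum_left: "cinner (\<Sum>i\<in>I. f i) y = (\<Sum>i\<in>I. cinner (f i) y)"
  by (induction I rule: infinite_finite_induct) (simp_all add: cinner_add_left)

lemma cinner_self: "cinner x x = complex_of_real ((norm x)\<^sup>2)"
proof (rule complex_eqI)
  show "Re (cinner x x) = Re (complex_of_real ((norm x)\<^sup>2))"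
    by (simp add: Re_cinner power2_norm_eq_inner)
  have "Im (cinner x x) = - Im (cinner x x)"
    by (subst cinner_commute) simp
  then show "Im (cinner x x) = Im (complex_of_real ((norm x)\<^sup>2))" by simp
qed

lemma inner_scaleC: "(a *\<^sub>C x) \<bullet> y = Re (a * cinner x y)"
  by (simp flip: Re_cinner add: cinner_scaleC_left)

lemma norm_scaleC: "norm (a *\<^sub>C x) = cmod a * norm (x::'a::chilbert_space)"
proof (rule power2_eq_imp_eq)
  have "complex_of_real ((norm (a *\<^sub>C x))\<^sup>2) = complex_of_real ((cmod a)\<^sup>2 * (norm x)\<^sup>2)"
  proof -
    have "complex_of_real ((norm (a *\<^sub>C x))\<^sup>2) = (a * cnj a) * cinner x x"
      by (simp only: cinner_self[symmetric] cinner_scaleC_left cinner_scaleC_right mult_ac)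
    then show ?thesis
      by (simp only: cinner_self of_real_mult complex_norm_square)
  qed
  then show "(norm (a *\<^sub>C x))\<^sup>2 = (cmod a * norm x)\<^sup>2"
    unfolding of_real_eq_iff by (simp add: power_mult_distrib)
qed auto

lemma inner_polarization: "4 * (a \<bullet> b) = (norm (a + b))\<^sup>2 - (norm (a - b :: 'a::real_inner))\<^sup>2"
  by (simp add: power2_norm_eq_inner inner_add inner_diff inner_commute)

lemma cmod_cinner_le: "cmod (cinner x y) \<le> norm x * norm y"
proof -
  define a where "a = cnj (sgn (cinner x y))"
  have "cmod (cinner x y) = Re (a * cinner x y)"
  proof (cases "cinner x y = 0")
    case False
    have "a * cinner x y = complex_of_real ((cmod (cinner x y))\<^sup>2) / complex_of_real (cmod (cinner x y))"
      unfolding complex_norm_square by (simp add: a_def sgn_eq mult.commute)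
    also have "\<dots> = complex_of_real (cmod (cinner x y))"
      using False by (simp add: power2_eq_square)
    finally show ?thesis by simp
  qed simp
  also have "\<dots> = (a *\<^sub>C x) \<bullet> y" by (simp add: inner_scaleC)
  also have "\<dots> \<le> norm (a *\<^sub>C x) * norm y" by (rule norm_cauchy_schwarz)
  also have "\<dots> \<le> norm x * norm y"
    unfolding norm_scaleC a_def
    by (intro mult_right_mono) (auto simp: norm_sgn intro: mult_left_le_one_le)
  finally show ?thesis .
qed

lemma cinner_eqI: "(\<And>z. cinner z x = cinner z y) \<Longrightarrow> x = y"
proof -
  assume "\<And>z. cinner z x = cinner z y"
  then have "cinner (x - y) (x - y) = 0" by (simp add: cinner_diff_right)
  then show ?thesis by (simp add: cinner_self)
qed

lemma cinner_eqI': "(\<And>z. cinner x z = cinner y z) \<Longrightarrow> x = y"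
  by (rule cinner_eqI) (metis cinner_commute)

text \<open>
  The imaginary part of an inner product is a real inner product with a rotated vector, so that
  identities between complex inner products may be tested on the real one.
\<close>

lemma cinner_eq_from_inner:
  assumes "\<And>a. (a *\<^sub>C x) \<bullet> y = (a *\<^sub>C x') \<bullet> y'"
  shows "cinner x y = cinner x' y'"
proof (rule complex_eqI)
  show "Re (cinner x y) = Re (cinner x' y')" using assms[of 1] by (simp add: Re_cinner)
  show "Im (cinner x y) = Im (cinner x' y')" using assms[of \<i>] by (simp add: inner_scaleC)
qed

lemma bounded_linear_cinner_left: "bounded_linear (\<lambda>x. cinner x y)"
  by (rule bounded_linear_intro[where K="norm y"])
    (auto simp: cinner_add_left cmod_cinner_le cinner_scaleC_left scaleR_conv_of_real simp flip: scaleC_of_real)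

lemma bounded_linear_cinner_right: "bounded_linear (\<lambda>y. cinner x y)"
  by (rule bounded_linear_intro[where K="norm x"])
    (auto simp: cinner_add_right cmod_cinner_le cinner_scaleC_right scaleR_conv_of_real mult.commute
      simp flip: scaleC_of_real intro: order_trans[OF cmod_cinner_le])

lemma bounded_linear_scaleC: "bounded_linear (\<lambda>x::'a::chilbert_space. a *\<^sub>C x)"
  by (rule bounded_linear_intro[where K="cmod a"])
    (auto simp: scaleC_add_right scaleC_scaleR norm_scaleC mult.commute)

lemma clinearI:
  "(\<And>x y. A (x + y) = A x + A y) \<Longrightarrow> (\<And>a x. A (a *\<^sub>C x) = a *\<^sub>C A x) \<Longrightarrow> clinear A"
  by (simp add: clinear_def)

lemma clinear_add: "clinear A \<Longrightarrow> A (x + y) = A x + A y"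
  and clinear_scaleC: "clinear A \<Longrightarrow> A (a *\<^sub>C x) = a *\<^sub>C A x"
  by (simp_all add: clinear_def)

lemma clinear_scaleR: "clinear A \<Longrightarrow> A (r *\<^sub>R x) = r *\<^sub>R A x"
  by (metis clinear_scaleC scaleC_of_real)

lemma clinear_0: "clinear A \<Longrightarrow> A 0 = 0"
  using clinear_scaleC[of A 0 0] by simp

lemma clinear_minus: "clinear A \<Longrightarrow> A (- x) = - A x"
  using clinear_scaleR[of A "-1" x] by simp

lemma clinear_diff: "clinear A \<Longrightarrow> A (x - y) = A x - A y"
  using clinear_add[of A x "- y"] by (simp add: clinear_minus)

lemma clinear_compose: "clinear A \<Longrightarrow> clinear B \<Longrightarrow> clinear (A \<circ> B)"
  by (simp add: clinear_def)

lemma clinear_id: "clinear id" "clinear (\<lambda>x. x)"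
  by (simp_all add: clinear_def)

lemma contraction_clinear: "contraction A \<Longrightarrow> clinear A"
  and contraction_norm: "contraction A \<Longrightarrow> norm (A x) \<le> norm x"
  by (simp_all add: contraction_def)

lemma contraction_compose: "contraction A \<Longrightarrow> contraction B \<Longrightarrow> contraction (A \<circ> B)"
  unfolding contraction_def by (auto simp: clinear_compose intro: order_trans)

lemma contraction_id: "contraction id"
  by (simp add: contraction_def clinear_id)

lemma isometry_contraction: "isometry A \<Longrightarrow> contraction A"
  by (simp add: isometry_def contraction_def)

lemma contraction_bounded_linear: "contraction A \<Longrightarrow> bounded_linear A"
  by (rule bounded_linear_intro[where K=1])
    (auto simp: contraction_def clinear_add clinear_scaleR)

section \<open>Riesz representation and adjoints\<close>

text \<open>
  The functional is a linear relation between vectors and scalars, because the functionals below are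
  given by formulas on representatives (linear combinations), and their independence of the
  representative is itself a consequence of the bound.  The representing vector is the limit of any
  sequence in the domain that minimises \<open>\<parallel>x\<parallel>\<^sup>2 - 2 Re l\<close>: by the parallelogram law such a sequence is
  Cauchy, and the first variation vanishes at the limit.
\<close>

lemma riesz_relation:
  fixes R :: "('h::chilbert_space \<times> complex) set"
  assumes ne: "R \<noteq> {}"
    and add: "\<And>x l y m. (x, l) \<in> R \<Longrightarrow> (y, m) \<in> R \<Longrightarrow> (x + y, l + m) \<in> R"
    and scale: "\<And>a x l. (x, l) \<in> R \<Longrightarrow> (a *\<^sub>C x, a * l) \<in> R"
    and bound: "\<And>x l. (x, l) \<in> R \<Longrightarrow> cmod l \<le> C * norm x"
    and C: "C \<ge> 0"
  obtains u where "u \<in> closure (fst ` R)" "norm u \<le> C" "\<And>x l. (x, l) \<in> R \<Longrightarrow> cinner x u = l"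
proof -
  define E where "E = (\<lambda>(x::'h, l). (norm x)\<^sup>2 - 2 * Re l)"
  have E_lower: "E p \<ge> - C\<^sup>2" if "p \<in> R" for p
  proof -
    obtain x l where p: "p = (x, l)" by fastforce
    have "Re l \<le> C * norm x" using bound[of x l] that p complex_Re_le_cmod[of l] by simp
    moreover have "0 \<le> (norm x - C)\<^sup>2" by simp
    ultimately show ?thesis by (simp add: E_def p power2_diff algebra_simps)
  qed
  define d where "d = (INF p\<in>R. E p)"
  have bdd: "bdd_below (E ` R)" using E_lower by (auto intro!: bdd_belowI2)
  have d_le: "d \<le> E p" if "p \<in> R" for p
    unfolding d_def by (rule cINF_lower[OF bdd that])
  have "\<exists>p\<in>R. E p < d + 1 / real (Suc n)" for n
    using cINF_less_iff[OF ne bdd, of "d + 1 / real (Suc n)"] by (simp add: d_def)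
  then obtain p where pR: "\<And>n. p n \<in> R" and pE: "\<And>n. E (p n) < d + 1 / real (Suc n)" by metis
  define x where "x = (\<lambda>n. fst (p n))"
  define l where "l = (\<lambda>n. snd (p n))"
  have xl: "(x n, l n) \<in> R" "E (x n, l n) < d + 1 / real (Suc n)" for n
    using pR[of n] pE[of n] by (auto simp: x_def l_def)
  have close: "(norm (x n - x m))\<^sup>2 \<le> 2 * (1 / real (Suc n) + 1 / real (Suc m))" for n m
  proof -
    have "((1/2) *\<^sub>C (x n + x m), (1/2) * (l n + l m)) \<in> R"
      by (intro scale add xl)
    then have "d \<le> E ((1/2) *\<^sub>C (x n + x m), (1/2) * (l n + l m))" by (rule d_le)
    also have "\<dots> = (norm (x n + x m))\<^sup>2 / 4 - Re (l n + l m)"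
      by (simp add: E_def norm_scaleC power_mult_distrib power2_eq_square add_divide_distrib)
    finally have "4 * d \<le> (norm (x n + x m))\<^sup>2 - 4 * Re (l n) - 4 * Re (l m)" by simp
    moreover have "(norm (x n - x m))\<^sup>2 + (norm (x n + x m))\<^sup>2 = 2 * (norm (x n))\<^sup>2 + 2 * (norm (x m))\<^sup>2"
      by (simp add: power2_norm_eq_inner inner_add inner_diff inner_commute)
    ultimately show ?thesis
      using xl(2)[of n] xl(2)[of m] by (simp add: E_def)
  qed
  have inv0: "(\<lambda>n. 1 / real (Suc n)) \<longlonglongrightarrow> 0"
    using LIMSEQ_inverse_real_of_nat by (simp add: inverse_eq_divide)
  have "Cauchy x"
  proof (rule metric_CauchyI)
    fix e :: real assume e: "e > 0"
    have "eventually (\<lambda>n. 1 / real (Suc n) < e\<^sup>2 / 4) sequentially"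
      using e by (intro order_tendstoD(2)[OF inv0]) simp
    then obtain M where M: "\<And>n. n \<ge> M \<Longrightarrow> 1 / real (Suc n) < e\<^sup>2 / 4"
      by (auto simp: eventually_sequentially)
    have "dist (x m) (x n) < e" if "m \<ge> M" "n \<ge> M" for m n
    proof -
      have "(norm (x m - x n))\<^sup>2 < e\<^sup>2"
        by (rule order.strict_trans1[OF close[of m n]])
          (use add_strict_mono[OF M[OF that(1)] M[OF that(2)]] in argo)
      then show ?thesis using e by (simp add: dist_norm power_less_imp_less_base)
    qed
    then show "\<exists>M. \<forall>m\<ge>M. \<forall>n\<ge>M. dist (x m) (x n) < e" by blast
  qed
  then obtain u where u: "x \<longlonglongrightarrow> u" using Cauchy_convergent convergent_def by blast
  have re: "z \<bullet> u = Re m" if zm: "(z, m) \<in> R" for z m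
  proof -
    have key: "0 \<le> 2 * t * (z \<bullet> u - Re m) + t\<^sup>2 * (norm z)\<^sup>2" for t :: real
    proof (rule LIMSEQ_le_const)
      show "(\<lambda>n. 1 / real (Suc n) + (2 * t * (z \<bullet> x n - Re m) + t\<^sup>2 * (norm z)\<^sup>2))
         \<longlonglongrightarrow> 2 * t * (z \<bullet> u - Re m) + t\<^sup>2 * (norm z)\<^sup>2"
        by (rule tendsto_eq_intros inv0 u refl | simp)+
      have "0 \<le> 1 / real (Suc n) + (2 * t * (z \<bullet> x n - Re m) + t\<^sup>2 * (norm z)\<^sup>2)" for n
      proof -
        have "(x n + complex_of_real t *\<^sub>C z, l n + complex_of_real t * m) \<in> R"
          by (intro add scale xl zm)
        from d_le[OF this]
        have "d \<le> (norm (x n + t *\<^sub>R z))\<^sup>2 - 2 * Re (l n) - 2 * t * Re m"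
          by (simp add: E_def scaleC_of_real)
        also have "(norm (x n + t *\<^sub>R z))\<^sup>2 = (norm (x n))\<^sup>2 + 2 * t * (z \<bullet> x n) + t\<^sup>2 * (norm z)\<^sup>2"
          by (simp add: power2_norm_eq_inner inner_add inner_commute)
            (simp add: power2_eq_square algebra_simps)
        finally show ?thesis using xl(2)[of n] by (simp add: E_def algebra_simps)
      qed
      then show "\<exists>N. \<forall>n\<ge>N. 0 \<le> 1 / real (Suc n) + (2 * t * (z \<bullet> x n - Re m) + t\<^sup>2 * (norm z)\<^sup>2)"
        by blast
    qed
    \<comment> \<open>The value \<open>t = - b / (c + 1)\<close> makes the quadratic polynomial in \<open>t\<close> negative unless \<open>b = 0\<close>.\<close>
    define b where "b = z \<bullet> u - Re m"
    define c where "c = (norm z)\<^sup>2"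
    have c: "c \<ge> 0" by (simp add: c_def)
    have "0 \<le> 2 * (- b / (c + 1)) * b + (- b / (c + 1))\<^sup>2 * c"
      using key[of "- b / (c + 1)"] unfolding b_def c_def .
    also have "\<dots> = - (b\<^sup>2 * (c + 2)) / (c + 1)\<^sup>2"
      using c by (simp add: power2_eq_square divide_simps) (simp add: algebra_simps)
    finally have "b\<^sup>2 * (c + 2) \<le> 0"
      using c by (simp add: zero_le_divide_iff divide_le_0_iff)
    then have "b = 0" using c by (simp add: mult_le_0_iff)
    then show ?thesis by (simp add: b_def)
  qed
  have rep: "cinner z u = m" if zm: "(z, m) \<in> R" for z m
  proof (rule complex_eqI)
    show "Re (cinner z u) = Re m" using re[OF zm] by (simp add: Re_cinner)
    show "Im (cinner z u) = Im m" using re[OF scale[OF zm, of \<i>]] by (simp add: inner_scaleC)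
  qed
  have "(\<lambda>n. cinner (x n) u) \<longlonglongrightarrow> cinner u u"
    by (rule bounded_linear.tendsto[OF bounded_linear_cinner_left u])
  then have "(\<lambda>n. cmod (l n)) \<longlonglongrightarrow> cmod (cinner u u)"
    using rep[OF xl(1)] by (auto intro!: tendsto_norm)
  moreover have "(\<lambda>n. C * norm (x n)) \<longlonglongrightarrow> C * norm u"
    by (intro tendsto_intros u)
  ultimately have "cmod (cinner u u) \<le> C * norm u"
    by (rule LIMSEQ_le) (use bound[OF xl(1)] in blast)
  then have "norm u * norm u \<le> C * norm u"
    by (simp add: cinner_self norm_mult power2_eq_square)
  then have "norm u \<le> C" using C by (cases "norm u = 0") auto
  moreover have "u \<in> closure (fst ` R)"
    unfolding closure_sequential using u xl(1) by (force intro!: exI[of _ x])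
  ultimately show ?thesis using rep that by blast
qed

text \<open>
  A relational form of the adjoint.  It can be composed, inverted and compared without first knowing
  that \<^const>\<open>cadjoint\<close>, a definite description, denotes.
\<close>

definition adj :: "('a::chilbert_space \<Rightarrow> 'b::chilbert_space) \<Rightarrow> ('b \<Rightarrow> 'a) \<Rightarrow> bool" where
  "adj A B \<longleftrightarrow> (\<forall>x y. cinner (A x) y = cinner x (B y))"

lemma adjD: "adj A B \<Longrightarrow> cinner (A x) y = cinner x (B y)"
  by (simp add: adj_def)

lemma adj_sym: "adj A B \<Longrightarrow> adj B A"
  unfolding adj_def by (metis cinner_commute)

lemma adj_unique: "adj A B \<Longrightarrow> adj A B' \<Longrightarrow> B = B'"
  unfolding adj_def by (intro ext cinner_eqI) metis

lemma adj_compose: "adj A A' \<Longrightarrow> adj B B' \<Longrightarrow> adj (A \<circ> B) (B' \<circ> A')"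
  by (simp add: adj_def)

lemma adj_cadjoint: "adj A B \<Longrightarrow> cadjoint A = B"
  unfolding cadjoint_def using adj_unique[of A] unfolding adj_def
  by (intro the_equality) (auto intro: ext)

lemma adj_clinear: "adj A B \<Longrightarrow> clinear B"
  by (intro clinearI cinner_eqI)
    (simp_all add: cinner_add_right cinner_scaleC_right flip: adjD[of A B])

lemma adj_contraction:
  assumes "adj A B" and A: "\<And>x. norm (A x) \<le> norm x"
  shows "contraction B"
  unfolding contraction_def
proof (intro conjI allI)
  fix y
  have "(norm (B y))\<^sup>2 = cmod (cinner (B y) (B y))" by (simp add: cinner_self norm_power)
  also have "\<dots> = cmod (cinner (A (B y)) y)" using adjD[OF assms(1)] by simp
  also have "\<dots> \<le> norm (A (B y)) * norm y" by (rule cmod_cinner_le)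
  also have "\<dots> \<le> norm (B y) * norm y" by (intro mult_right_mono A) simp
  finally show "norm (B y) \<le> norm y"
    by (cases "norm (B y) = 0") (auto simp: power2_eq_square)
qed (rule adj_clinear[OF assms(1)])

text \<open>
  The families \<open>a\<close> and \<open>b\<close> describe the graph of an operator \<open>a x \<mapsto> b x\<close> on a subspace.  The vector
  \<open>u\<close> is the value at \<open>y\<close> of the adjoint of its extension; it is the vector representing the functional
  \<open>a x \<mapsto> \<langle>b x, y\<rangle>\<close>.  Taking \<open>b = a\<close> gives the orthogonal projection onto the closure of the subspace.
\<close>

lemma contraction_extension_adjoint:
  fixes a :: "'x \<Rightarrow> 'h::chilbert_space" and b :: "'x \<Rightarrow> 'k::chilbert_space"
  assumes add: "\<And>x y. \<exists>z. a z = a x + a y \<and> b z = b x + b y"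
    and scale: "\<And>c x. \<exists>z. a z = c *\<^sub>C a x \<and> b z = c *\<^sub>C b x"
    and le: "\<And>x. norm (b x) \<le> norm (a x)"
  shows "\<exists>u\<in>closure (range a). norm u \<le> norm y \<and> (\<forall>x. cinner (a x) u = cinner (b x) y)"
proof -
  let ?R = "range (\<lambda>x. (a x, cinner (b x) y))"
  have bound: "\<And>x l. (x, l) \<in> ?R \<Longrightarrow> cmod l \<le> norm y * norm x"
    using le by (auto intro!: order_trans[OF cmod_cinner_le] mult_left_mono simp: mult.commute)
  have "(a x + a z, cinner (b x) y + cinner (b z) y) \<in> ?R" for x z
    using add[of x z] by (metis (no_types, lifting) cinner_add_left rangeI)
  then have sum: "\<And>x l z m. (x, l) \<in> ?R \<Longrightarrow> (z, m) \<in> ?R \<Longrightarrow> (x + z, l + m) \<in> ?R"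
    by blast
  have "(c *\<^sub>C a x, c * cinner (b x) y) \<in> ?R" for c x
    using scale[of c x] by (metis (no_types, lifting) cinner_scaleC_left rangeI)
  then have mult: "\<And>c x l. (x, l) \<in> ?R \<Longrightarrow> (c *\<^sub>C x, c * l) \<in> ?R"
    by blast
  obtain u where "u \<in> closure (fst ` ?R)" "norm u \<le> norm y"
      "\<And>x l. (x, l) \<in> ?R \<Longrightarrow> cinner x u = l"
    by (rule riesz_relation[OF _ sum mult bound]) auto
  then show ?thesis by (auto simp: image_image)
qed

lemma contraction_adj_exists:
  fixes A :: "'a::chilbert_space \<Rightarrow> 'b::chilbert_space"
  assumes "contraction A"
  shows "adj A (cadjoint A)"
proof -
  have "\<exists>u. \<forall>x. cinner x u = cinner (A x) y" for y
    using contraction_extension_adjoint[of "\<lambda>x. x" A y] assms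
    by (metis clinear_add clinear_scaleC contraction_clinear contraction_norm)
  then obtain B where "\<And>x y. cinner x (B y) = cinner (A x) y" by metis
  then have "adj A B" by (simp add: adj_def)
  then show ?thesis using adj_cadjoint by blast
qed

lemma contraction_cadjoint: "contraction A \<Longrightarrow> contraction (cadjoint A)"
  using adj_contraction contraction_adj_exists contraction_norm by blast

section \<open>Extension of partially defined contractions\<close>

lemma cinner_closure_zero:
  assumes "z \<in> closure A" and "\<And>x. x \<in> A \<Longrightarrow> cinner x d = 0"
  shows "cinner z d = 0"
proof -
  obtain f where f: "\<And>n. f n \<in> A" "f \<longlonglongrightarrow> z" using assms(1) by (auto simp: closure_sequential)
  have "(\<lambda>n. cinner (f n) d) \<longlonglongrightarrow> cinner z d"
    by (rule bounded_linear.tendsto[OF bounded_linear_cinner_left f(2)])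
  then show ?thesis using f(1) assms(2) by (simp add: LIMSEQ_const_iff)
qed

text \<open>
  The extension is the adjoint of the operator \<open>y \<mapsto> u\<close> just described.  It vanishes off the given
  subspace because all the vectors \<open>u\<close> lie in the closure of that subspace, and no extension by
  continuity is needed.
\<close>

lemma contraction_extension:
  fixes a :: "'x \<Rightarrow> 'h::chilbert_space" and b :: "'x \<Rightarrow> 'k::chilbert_space"
  assumes add: "\<And>x y. \<exists>z. a z = a x + a y \<and> b z = b x + b y"
    and scale: "\<And>c x. \<exists>z. a z = c *\<^sub>C a x \<and> b z = c *\<^sub>C b x"
    and le: "\<And>x. norm (b x) \<le> norm (a x)"
  obtains C where "contraction C" "\<And>x. C (a x) = b x"
    "\<And>m. (\<And>x. cinner (a x) m = 0) \<Longrightarrow> C m = 0"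
proof -
  obtain B where B: "\<And>y. B y \<in> closure (range a)" "\<And>y. norm (B y) \<le> norm y"
      "\<And>x y. cinner (a x) (B y) = cinner (b x) y"
    using contraction_extension_adjoint[of a b, OF add scale le] by metis
  have orth: "cinner (B y) d = 0" if "\<And>x. cinner (a x) d = 0" for y d
    using B(1) by (rule cinner_closure_zero) (use that in auto)
  have "clinear B"
  proof (rule clinearI)
    fix y z :: 'k and c :: complex
    have "cinner (a x) (B (y + z) - (B y + B z)) = 0" for x
      by (simp add: B(3) cinner_diff_right cinner_add_right)
    note orth[OF this]
    then have "cinner (B (y + z) - (B y + B z)) (B (y + z) - (B y + B z)) = 0"
      by (simp add: cinner_diff_left cinner_add_left)
    then show "B (y + z) = B y + B z" by (simp add: cinner_self)
    have "cinner (a x) (B (c *\<^sub>C y) - c *\<^sub>C B y) = 0" for x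
      by (simp add: B(3) cinner_diff_right cinner_scaleC_right)
    note orth[OF this]
    then have "cinner (B (c *\<^sub>C y) - c *\<^sub>C B y) (B (c *\<^sub>C y) - c *\<^sub>C B y) = 0"
      by (simp add: cinner_diff_left cinner_scaleC_left)
    then show "B (c *\<^sub>C y) = c *\<^sub>C B y" by (simp add: cinner_self)
  qed
  then have "contraction B" using B(2) by (simp add: contraction_def)
  then have adj: "adj B (cadjoint B)" and "contraction (cadjoint B)"
    by (rule contraction_adj_exists contraction_cadjoint)+
  moreover have "cadjoint B (a x) = b x" for x
    by (rule cinner_eqI) (metis B(3) adjD[OF adj] cinner_commute)
  moreover have "cadjoint B m = 0" if "\<And>x. cinner (a x) m = 0" for m
    by (rule cinner_eqI) (simp add: orth[OF that] flip: adjD[OF adj])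
  ultimately show ?thesis using that by blast
qed

text \<open>
  The space is the sum of the closure of a subspace and its orthogonal complement, so two bounded
  operators are equal when they agree on both.
\<close>

lemma contractions_eqI:
  fixes a :: "'x \<Rightarrow> 'h::chilbert_space"
  assumes add: "\<And>x y. \<exists>z. a z = a x + a y"
    and scale: "\<And>c x. \<exists>z. a z = c *\<^sub>C a x"
    and A: "bounded_linear A" and B: "bounded_linear B"
    and eq: "\<And>x. A (a x) = B (a x)"
    and eq0: "\<And>m. (\<And>x. cinner (a x) m = 0) \<Longrightarrow> A m = B m"
  shows "A = B"
proof
  fix z
  obtain u where u: "u \<in> closure (range a)" "\<And>x. cinner (a x) u = cinner (a x) z"
    using contraction_extension_adjoint[of a a z] add scale by (metis order_refl)
  obtain f where f: "\<And>n. f n \<in> range a" "f \<longlonglongrightarrow> u" using u(1) by (auto simp: closure_sequential)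
  have AB: "A (f n) = B (f n)" for n using f(1)[of n] eq by auto
  have "(\<lambda>n. A (f n)) \<longlonglongrightarrow> A u" "(\<lambda>n. A (f n)) \<longlonglongrightarrow> B u"
    using bounded_linear.tendsto[OF A f(2)] bounded_linear.tendsto[OF B f(2)] by (simp_all add: AB)
  then have "A u = B u" by (rule LIMSEQ_unique)
  moreover have "A (z - u) = B (z - u)"
    by (rule eq0) (simp add: cinner_diff_right u(2))
  moreover have "A z = A u + A (z - u)" "B z = B u + B (z - u)"
    using linear_add[OF bounded_linear.linear[OF A], of u "z - u"]
      linear_add[OF bounded_linear.linear[OF B], of u "z - u"] by simp_all
  ultimately show "A z = B z" by simp
qed

section \<open>Positive kernels\<close>

text \<open>
  Finite linear combinations are indexed by lists of coefficients and labels, with repetitions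
  allowed: sums of combinations are then concatenations, and the families \<open>comb v\<close> and \<open>comb w\<close> have
  the closure properties that the extension lemmas ask for.
\<close>

definition comb :: "('x \<Rightarrow> 'h::chilbert_space) \<Rightarrow> (complex \<times> 'x) list \<Rightarrow> 'h" where
  "comb v xs = (\<Sum>(c, x)\<leftarrow>xs. c *\<^sub>C v x)"

definition kform :: "('x \<Rightarrow> 'y \<Rightarrow> complex) \<Rightarrow> (complex \<times> 'x) list \<Rightarrow> (complex \<times> 'y) list \<Rightarrow> complex" where
  "kform K xs ys = (\<Sum>(c, x)\<leftarrow>xs. \<Sum>(d, y)\<leftarrow>ys. c * cnj d * K x y)"

definition positive_kernel :: "('x \<Rightarrow> 'x \<Rightarrow> complex) \<Rightarrow> bool" where
  "positive_kernel K \<longleftrightarrow> (\<forall>x y. K y x = cnj (K x y)) \<and> (\<forall>xs. 0 \<le> kform K xs xs)"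

lemma comb_simps [simp]:
  "comb v [] = 0" "comb v ((c, x) # xs) = c *\<^sub>C v x + comb v xs"
  "comb v (xs @ ys) = comb v xs + comb v ys"
  by (simp_all add: comb_def)

lemma comb_scale: "comb v (map (\<lambda>(d, x). (c * d, x)) xs) = c *\<^sub>C comb v xs"
  by (induction xs) (auto simp: scaleC_add_right scaleC_scaleC)

lemma comb_orth: "(\<And>x. cinner (v x) m = 0) \<Longrightarrow> cinner (comb v xs) m = 0"
  by (induction xs) (auto simp: cinner_add_left cinner_scaleC_left)

lemma comb_span:
  "\<exists>zs. comb v zs = comb v xs + comb v ys \<and> comb w zs = comb w xs + comb w ys"
  "\<exists>zs. comb v zs = c *\<^sub>C comb v xs \<and> comb w zs = c *\<^sub>C comb w xs"
  by (metis comb_simps(3)) (metis comb_scale)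

lemma kform_simps [simp]:
  "kform K [] ys = 0" "kform K xs [] = 0"
  "kform K (xs @ xs') ys = kform K xs ys + kform K xs' ys"
  "kform K xs (ys @ ys') = kform K xs ys + kform K xs ys'"
  by (auto simp: kform_def case_prod_unfold sum_list_addf)

lemma kform_cinner: "kform (\<lambda>x y. cinner (v x) (w y)) xs ys = cinner (comb v xs) (comb w ys)"
proof -
  have "(\<Sum>(d, y)\<leftarrow>ys. c * cnj d * cinner (v x) (w y)) = c * cinner (v x) (comb w ys)" for c x
    by (induction ys) (auto simp: cinner_add_right cinner_scaleC_right algebra_simps)
  then show ?thesis unfolding kform_def
    by (induction xs) (auto simp: cinner_add_left cinner_scaleC_left)
qed

lemma kform_cong:
  "(\<And>c x d y. (c, x) \<in> set xs \<Longrightarrow> (d, y) \<in> set ys \<Longrightarrow> K x y = L x y) \<Longrightarrow> kform K xs ys = kform L xs ys"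
  unfolding kform_def by (intro arg_cong[of _ _ sum_list] map_cong) (auto intro!: arg_cong[of _ _ sum_list])

lemma kform_commute:
  assumes "\<And>x y. K y x = cnj (K x y)"
  shows "kform K ys xs = cnj (kform K xs ys)"
proof (induction xs)
  case (Cons a xs)
  have "kform K ys [a] = cnj (kform K [a] ys)"
    by (induction ys) (auto simp: kform_def case_prod_unfold mult_ac assms[of _ "snd a"])
  then show ?case
    using Cons kform_simps(3)[of K "[a]" xs ys] kform_simps(4)[of K ys "[a]" xs] by simp
qed simp

text \<open>
  Cauchy-Schwarz for the semi-inner product of a positive kernel: the form is nonnegative at the
  combination \<open>xs\<close> with a further entry \<open>x\<close>, whose coefficient is a real multiple of
  \<open>- kform K xs [(1, x)]\<close>.
\<close>

lemma kform_cauchy_schwarz: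
  assumes K: "positive_kernel K"
  shows "(cmod (kform K xs [(1, x)]))\<^sup>2 \<le> Re (K x x) * Re (kform K xs xs)"
proof -
  have herm: "\<And>x y. K y x = cnj (K x y)" and pos: "\<And>xs. 0 \<le> kform K xs xs"
    using K unfolding positive_kernel_def by blast+
  define b where "b = kform K xs [(1, x)]"
  define g where "g = Re (K x x)"
  define n where "n = Re (kform K xs xs)"
  have "0 \<le> kform K [(1, x)] [(1, x)]" by (rule pos)
  then have g: "K x x = complex_of_real g" "g \<ge> 0"
    by (auto simp: kform_def g_def less_eq_complex_def complex_eq_iff)
  have key: "0 \<le> n - 2 * s * (cmod b)\<^sup>2 + s\<^sup>2 * (cmod b)\<^sup>2 * g" for s :: real
  proof -
    define t where "t = - complex_of_real s * b"
    have b': "kform K xs [(t, x)] = cnj t * b"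
      unfolding b_def kform_def by (induction xs) (auto simp: algebra_simps)
    have "0 \<le> kform K (xs @ [(t, x)]) (xs @ [(t, x)])" by (rule pos)
    also have "\<dots> = kform K xs xs + cnj t * b + cnj (cnj t * b) + t * cnj t * g"
      using b' kform_commute[of K "[(t, x)]" xs, OF herm]
      by (simp add: g(1)[symmetric]) (simp add: kform_def)
    finally have "0 \<le> Re (kform K xs xs + cnj t * b + cnj (cnj t * b) + t * cnj t * g)"
      by (simp add: less_eq_complex_def)
    also have "\<dots> = n - 2 * s * (cmod b)\<^sup>2 + s\<^sup>2 * (cmod b)\<^sup>2 * g"
      unfolding cmod_power2 by (simp add: t_def n_def power2_eq_square algebra_simps)
    finally show ?thesis .
  qed
  have "(cmod b)\<^sup>2 \<le> g * n"
  proof (cases "g = 0")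
    case True
    have "(cmod b)\<^sup>2 = 0"
    proof (rule ccontr)
      assume nz: "(cmod b)\<^sup>2 \<noteq> 0"
      \<comment> \<open>This value of \<open>s\<close> gives \<open>n - (n + 1) = -1\<close>.\<close>
      show False using key[of "(n + 1) / (2 * (cmod b)\<^sup>2)"] nz by (simp add: True)
    qed
    then show ?thesis by (simp add: True)
  next
    case False
    then show ?thesis using key[of "1 / g"] g(2) by (simp add: power2_eq_square field_simps)
  qed
  then show ?thesis by (simp add: b_def g_def n_def)
qed

lift_definition ell2_unit :: "'i \<Rightarrow> 'i ell2" is "\<lambda>x i. if i = x then 1 else 0"
  by (rule finite_nonzero_values_imp_summable_on) simp

lemma cinner_ell2_unit: "cinner y (ell2_unit x) = Rep_ell2 y x"
proof -
  have "cinner y (ell2_unit x) = (\<Sum>\<^sub>\<infinity>i. Rep_ell2 y i * cnj (if i = x then 1 else 0))"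
    by (simp add: cinner_ell2_def cinner_ell2_raw.rep_eq ell2_unit.rep_eq)
  also have "\<dots> = Rep_ell2 y x"
    by (subst infsum_cong_neutral[where T="{x}" and g="Rep_ell2 y"]) auto
  finally show ?thesis .
qed

lemma Rep_ell2_closure_zero:
  assumes "u \<in> closure A" and "\<And>y. y \<in> A \<Longrightarrow> Rep_ell2 y x = 0"
  shows "Rep_ell2 u x = 0"
  using cinner_closure_zero[OF assms(1), of "ell2_unit x"] assms(2) by (simp add: cinner_ell2_unit)

lemma Rep_ell2_comb: "\<forall>(c, y)\<in>set xs. Rep_ell2 (f y) z = 0 \<Longrightarrow> Rep_ell2 (comb f xs) z = 0"
  by (induction xs) (auto simp: zero_ell2.rep_eq plus_ell2.rep_eq scaleC_ell2.rep_eq)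

text \<open>
  Every positive kernel is a Gram matrix, with the labels themselves as an orthonormal basis of the
  target space.  This is a transfinite Cholesky factorization: along a well-order of the labels,
  \<open>v x\<close> is supported on the labels up to \<open>x\<close>.  The prescribed inner products with the earlier vectors
  define a bounded functional on their span, which is represented by some \<open>u\<close> supported strictly before
  \<open>x\<close>; the coordinate at \<open>x\<close> is free to correct the norm.
\<close>

lemma positive_kernel_factorization:
  fixes K :: "'x \<Rightarrow> 'x \<Rightarrow> complex"
  assumes K: "positive_kernel K"
  obtains v :: "'x \<Rightarrow> 'x ell2" where "\<And>x y. cinner (v x) (v y) = K x y"
proof -
  have herm: "\<And>x y. K y x = cnj (K x y)" and pos: "\<And>xs. 0 \<le> kform K xs xs"
    using K unfolding positive_kernel_def by blast+
  obtain r :: "'x rel" where r: "well_order_on UNIV r" using well_order_on by blast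
  define R where "R = r - Id"
  have wf: "wf R" using r by (simp add: R_def well_order_on_def)
  have lin: "trans r" "antisym r" "total r" "refl r"
    using r by (auto simp: well_order_on_def linear_order_on_def partial_order_on_def preorder_on_def)
  define P where "P = (\<lambda>(f :: 'x \<Rightarrow> 'x ell2) x w. (\<forall>z. Rep_ell2 w z \<noteq> 0 \<longrightarrow> (z, x) \<in> r) \<and>
     cinner w w = K x x \<and> (\<forall>y. (y, x) \<in> R \<longrightarrow> cinner (f y) w = K y x))"
  have step: "\<exists>w. P f x w" if IH: "\<And>y. (y, x) \<in> R \<Longrightarrow> P f y (f y)" for x f
  proof -
    have gram: "cinner (f y) (f z) = K y z" if "(y, x) \<in> R" "(z, x) \<in> R" for y z
    proof -
      have "(y, z) \<in> R \<or> (z, y) \<in> R \<or> y = z" using lin(3) by (auto simp: R_def total_on_def)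
      then consider "y = z" | "(y, z) \<in> R" | "(z, y) \<in> R" by blast
      then show ?thesis
        using IH[OF that(1)] IH[OF that(2)] by cases (simp_all add: P_def, metis herm cinner_commute)
    qed
    have vanish: "Rep_ell2 (f y) x = 0" if "(y, x) \<in> R" for y
      using IH[OF that] that lin(2) by (auto simp: P_def R_def antisym_def)
    define L where "L = {xs :: (complex \<times> 'x) list. \<forall>(c, y)\<in>set xs. (y, x) \<in> R}"
    define S where "S = (\<lambda>xs. (comb f xs, kform K xs [(1, x)])) ` L"
    define g where "g = Re (K x x)"
    have "0 \<le> kform K [(1, x)] [(1, x)]" by (rule pos)
    then have g: "K x x = complex_of_real g" "g \<ge> 0"
      by (auto simp: kform_def g_def less_eq_complex_def complex_eq_iff)
    have "[] \<in> L" by (simp add: L_def)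
    then have ne: "S \<noteq> {}" by (auto simp: S_def)
    have sum: "(a + b, l + m) \<in> S" if "(a, l) \<in> S" "(b, m) \<in> S" for a l b m
    proof -
      obtain xs ys where "xs \<in> L" "a = comb f xs" "l = kform K xs [(1, x)]"
        "ys \<in> L" "b = comb f ys" "m = kform K ys [(1, x)]" using \<open>(a, l) \<in> S\<close> \<open>(b, m) \<in> S\<close> by (auto simp: S_def)
      then show ?thesis unfolding S_def by (intro image_eqI[of _ _ "xs @ ys"]) (auto simp: L_def)
    qed
    have mult: "(c *\<^sub>C a, c * l) \<in> S" if "(a, l) \<in> S" for c a l
    proof -
      obtain xs where xs: "xs \<in> L" "a = comb f xs" "l = kform K xs [(1, x)]"
        using \<open>(a, l) \<in> S\<close> by (auto simp: S_def)
      have "kform K (map (\<lambda>(d, x). (c * d, x)) xs) [(1, x)] = c * kform K xs [(1, x)]"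
        unfolding kform_def by (induction xs) (auto simp: algebra_simps)
      then show ?thesis using xs unfolding S_def
        by (intro image_eqI[of _ _ "map (\<lambda>(d, x). (c * d, x)) xs"]) (auto simp: L_def comb_scale)
    qed
    have bound: "cmod l \<le> sqrt g * norm a" if "(a, l) \<in> S" for a l
    proof -
      obtain xs where xs: "xs \<in> L" "a = comb f xs" "l = kform K xs [(1, x)]"
        using \<open>(a, l) \<in> S\<close> by (auto simp: S_def)
      have "kform K xs xs = kform (\<lambda>y z. cinner (f y) (f z)) xs xs"
        by (rule kform_cong, rule gram[symmetric]) (use xs(1) in \<open>auto simp: L_def\<close>)
      then have "kform K xs xs = complex_of_real ((norm a)\<^sup>2)"
        by (simp add: kform_cinner xs(2) cinner_self)
      then have "(cmod l)\<^sup>2 \<le> g * (norm a)\<^sup>2"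
        using kform_cauchy_schwarz[OF K, of xs x] by (simp add: xs(3) g_def)
      then have "(cmod l)\<^sup>2 \<le> (sqrt g * norm a)\<^sup>2"
        using g(2) by (simp add: power_mult_distrib)
      then show ?thesis by (rule power2_le_imp_le) (use g(2) in simp)
    qed
    obtain u where u: "u \<in> closure (fst ` S)" "norm u \<le> sqrt g"
        "\<And>a l. (a, l) \<in> S \<Longrightarrow> cinner a u = l"
      by (rule riesz_relation[OF ne sum mult bound]) (use g(2) in auto)
    have supp: "Rep_ell2 u z = 0" if "(z, x) \<notin> R" for z
    proof (rule Rep_ell2_closure_zero[OF u(1)])
      have 1: "Rep_ell2 (f y) z = 0" if y: "(y, x) \<in> R" for y
      proof (rule ccontr)
        assume "Rep_ell2 (f y) z \<noteq> 0"
        then have zy: "(z, y) \<in> r" using IH[OF y] by (auto simp: P_def)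
        then have "(z, x) \<in> r" using y lin(1) by (auto simp: R_def trans_def)
        moreover have "z \<noteq> x" using zy y lin(2) by (auto simp: R_def antisym_def)
        ultimately show False using \<open>(z, x) \<notin> R\<close> by (simp add: R_def)
      qed
      fix a assume "a \<in> fst ` S"
      then obtain xs where xs: "xs \<in> L" "a = comb f xs" by (auto simp: S_def)
      show "Rep_ell2 a z = 0"
        unfolding xs(2) by (rule Rep_ell2_comb) (use xs(1) 1 in \<open>auto simp: L_def\<close>)
    qed
    have ux: "Rep_ell2 u x = 0" by (rule supp) (simp add: R_def)
    have norm_u: "(norm u)\<^sup>2 \<le> g"
      using power_mono[OF u(2), of 2] g(2) by simp
    define w where "w = u + complex_of_real (sqrt (g - (norm u)\<^sup>2)) *\<^sub>C ell2_unit x"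
    have "(z, x) \<in> r" if "Rep_ell2 w z \<noteq> 0" for z
    proof (cases "z = x")
      case True
      then show ?thesis using lin(4) by (auto simp: refl_on_def)
    next
      case False
      then have "Rep_ell2 w z = Rep_ell2 u z"
        by (simp add: w_def plus_ell2.rep_eq scaleC_ell2.rep_eq ell2_unit.rep_eq)
      then show ?thesis using supp[of z] that by (auto simp: R_def)
    qed
    moreover have "cinner w w = K x x"
    proof -
      have ux': "cinner u (ell2_unit x) = 0" "cinner (ell2_unit x) u = 0"
        using ux cinner_commute[of "ell2_unit x" u] by (simp_all add: cinner_ell2_unit)
      have "cinner w w = cinner u u + complex_of_real ((sqrt (g - (norm u)\<^sup>2))\<^sup>2)"
        by (simp add: w_def cinner_add_left cinner_add_right cinner_scaleC_left cinner_scaleC_right ux'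
            cinner_ell2_unit[of "ell2_unit x"] ell2_unit.rep_eq power2_eq_square del: real_sqrt_mult_self)
      also have "\<dots> = complex_of_real ((norm u)\<^sup>2 + (g - (norm u)\<^sup>2))"
        using norm_u by (simp add: cinner_self)
      finally show ?thesis by (simp add: g(1))
    qed
    moreover have "cinner (f y) w = K y x" if y: "(y, x) \<in> R" for y
    proof -
      have "(f y, K y x) \<in> S"
        unfolding S_def using y by (intro image_eqI[of _ _ "[(1, y)]"]) (auto simp: L_def kform_def)
      then have "cinner (f y) u = K y x" by (rule u(3))
      then show ?thesis
        by (simp add: w_def cinner_add_right cinner_scaleC_right cinner_ell2_unit vanish[OF y])
    qed
    ultimately show ?thesis by (auto simp: P_def)
  qed
  have "\<exists>v. \<forall>x. P v x (v x)"
    by (rule dependent_wf_choice[OF wf _ step]) (auto simp: P_def)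
  then obtain v where v: "\<And>x. P v x (v x)" by blast
  have "cinner (v x) (v y) = K x y" for x y
  proof -
    have "(x, y) \<in> R \<or> (y, x) \<in> R \<or> x = y" using lin(3) by (auto simp: R_def total_on_def)
    then consider "x = y" | "(x, y) \<in> R" | "(y, x) \<in> R" by blast
    then show ?thesis
      using v[of x] v[of y] by cases (simp_all add: P_def, metis herm cinner_commute)
  qed
  then show ?thesis by (rule that)
qed

section \<open>Positivity of the Brehmer kernel\<close>

definition op_power :: "(nat \<Rightarrow> 'h \<Rightarrow> 'h) \<Rightarrow> nat list \<Rightarrow> (nat \<Rightarrow> nat) \<Rightarrow> 'h \<Rightarrow> 'h" where
  "op_power A is k = foldr (\<lambda>i B. (A i ^^ k i) \<circ> B) is id"

lemma op_power_simps [simp]: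
  "op_power A [] k = id" "op_power A (i # is) k = (A i ^^ k i) \<circ> op_power A is k"
  by (simp_all add: op_power_def)

text \<open>
  Brehmer positivity for an arbitrary form in place of the inner product, with \<open>A i\<close> in the role of
  \<open>T\<^sub>i\<^sup>*\<close>: unfolding the recursion gives \<open>\<Sum>F\<subseteq>G. (-1)\<^bsup>|F|\<^esup> \<phi>(A\<^sub>F h, A\<^sub>F h) \<ge> 0\<close> for all sets \<open>G\<close> of listed
  indices.  Arbitrary forms make an induction on the list possible, since the step passes from \<open>\<phi>\<close> to
  \<open>\<phi>(x, y) - \<phi>(A i x, A i y)\<close>.
\<close>

primrec brehmer_form :: "(nat \<Rightarrow> 'h \<Rightarrow> 'h) \<Rightarrow> nat list \<Rightarrow> ('h \<Rightarrow> 'h \<Rightarrow> complex) \<Rightarrow> bool" where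
  "brehmer_form A [] \<phi> \<longleftrightarrow> (\<forall>h. 0 \<le> \<phi> h h)"
| "brehmer_form A (i # is) \<phi> \<longleftrightarrow>
     brehmer_form A is \<phi> \<and> brehmer_form A is (\<lambda>x y. \<phi> x y - \<phi> (A i x) (A i y))"

lemma brehmer_form_map: "brehmer_form A (map f is) \<phi> = brehmer_form (\<lambda>i. A (f i)) is \<phi>"
  by (induction "is" arbitrary: \<phi>) auto

lemma brehmer_form_cong: "(\<And>i. i \<in> set is \<Longrightarrow> A i = B i) \<Longrightarrow> brehmer_form A is \<phi> = brehmer_form B is \<phi>"
  by (induction "is" arbitrary: \<phi>) auto

lemma commute_funpow: "(\<And>x. f (g x) = g (f x)) \<Longrightarrow> f ((g ^^ n) x) = (g ^^ n) (f x)"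
  by (induction n) auto

lemma op_power_commute:
  "(\<And>i x. i \<in> set is \<Longrightarrow> f ((A i ^^ k i) x) = (A i ^^ k i) (f x)) \<Longrightarrow> f (op_power A is k x) = op_power A is k (f x)"
  by (induction "is" arbitrary: x) auto

text \<open>
  The contribution of one variable.  If \<open>V\<close> is an isometry with \<open>V\<^sup>* h = A h\<close> on the original space, then
  \<open>\<langle>V\<^sup>a u, V\<^sup>b w\<rangle> = \<langle>A\<^bsup>b-a\<^esup> u, A\<^bsup>a-b\<^esup> w\<rangle>\<close> with truncated subtraction, because one of the exponents is zero.
  The identity writes this as a sum over the levels \<open>q\<close>; it is the polarized form of
  \<open>\<parallel>x\<parallel>\<^sup>2 = \<parallel>V\<^bsup>*N\<^esup> x\<parallel>\<^sup>2 + \<Sum>q<N. (\<parallel>V\<^bsup>*q\<^esup> x\<parallel>\<^sup>2 - \<parallel>V\<^bsup>*(q+1)\<^esup> x\<parallel>\<^sup>2)\<close>, where a summand with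
  \<open>q\<close> below one of the exponents contributes nothing.
\<close>

lemma telescoping_form:
  fixes \<phi> :: "'h \<Rightarrow> 'h \<Rightarrow> complex"
  assumes "a \<le> N" "b \<le> N"
  shows "(\<Sum>q\<in>{max a b..N}. if q = N then \<phi> ((A ^^ (q - a)) u) ((A ^^ (q - b)) w)
            else \<phi> ((A ^^ (q - a)) u) ((A ^^ (q - b)) w) - \<phi> (A ((A ^^ (q - a)) u)) (A ((A ^^ (q - b)) w)))
         = \<phi> ((A ^^ (b - a)) u) ((A ^^ (a - b)) w)"
proof -
  define F where "F q = \<phi> ((A ^^ (q - a)) u) ((A ^^ (q - b)) w)" for q
  let ?m = "max a b"
  have m: "?m \<le> N" using assms by simp
  have Suc: "\<phi> (A ((A ^^ (q - a)) u)) (A ((A ^^ (q - b)) w)) = F (Suc q)" if "?m \<le> q" for q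
    using that by (simp add: F_def Suc_diff_le)
  have "(\<Sum>q\<in>{?m..N}. if q = N then F q else F q - F (Suc q))
      = (\<Sum>q\<in>{?m..<N}. if q = N then F q else F q - F (Suc q)) + F N"
    using m by (subst sum.last_plus) (simp_all add: add.commute)
  also have "(\<Sum>q\<in>{?m..<N}. if q = N then F q else F q - F (Suc q)) = - (\<Sum>q\<in>{?m..<N}. F (Suc q) - F q)"
    unfolding sum_negf[symmetric] by (rule sum.cong) auto
  also have "(\<Sum>q\<in>{?m..<N}. F (Suc q) - F q) = F N - F ?m"
    by (rule sum_Suc_diff'[OF m])
  finally have "(\<Sum>q\<in>{?m..N}. if q = N then F q else F q - F (Suc q)) = F ?m" by simp
  moreover have "F ?m = \<phi> ((A ^^ (b - a)) u) ((A ^^ (a - b)) w)"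
    by (auto simp: F_def max_def)
  moreover have "(if q = N then \<phi> ((A ^^ (q - a)) u) ((A ^^ (q - b)) w)
      else \<phi> ((A ^^ (q - a)) u) ((A ^^ (q - b)) w) - \<phi> (A ((A ^^ (q - a)) u)) (A ((A ^^ (q - b)) w)))
      = (if q = N then F q else F q - F (Suc q))" if "q \<in> {?m..N}" for q
    using that by (subst Suc) (simp_all add: F_def)
  ultimately show ?thesis by (simp only: cong: sum.cong)
qed

text \<open>
  Induction on the variables.  Telescoping in the first variable turns the double sum into a sum over
  levels \<open>q\<close> of double sums in the remaining variables, over those labels whose exponent is at most \<open>q\<close>.
  At the top level the form is still \<open>\<phi>\<close>, below it is \<open>\<phi>(x, y) - \<phi>(A i x, A i y)\<close>; both satisfy the
  positivity hypothesis for the remaining variables.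
\<close>

lemma brehmer_form_sum_nonneg:
  fixes \<phi> :: "'h::ab_group_add \<Rightarrow> 'h \<Rightarrow> complex"
  assumes "brehmer_form A is \<phi>"
    and "\<And>x y z. \<phi> (x + y) z = \<phi> x z + \<phi> y z" "\<And>x y z. \<phi> z (x + y) = \<phi> z x + \<phi> z y"
    and "\<And>i x y. i \<in> set is \<Longrightarrow> A i (x + y) = A i x + A i y"
    and "\<And>i j x. i \<in> set is \<Longrightarrow> j \<in> set is \<Longrightarrow> A i (A j x) = A j (A i x)"
    and "finite Y"
  shows "0 \<le> (\<Sum>x\<in>Y. \<Sum>y\<in>Y. \<phi> (op_power A is (\<lambda>i. k y i - k x i) (h x)) (op_power A is (\<lambda>i. k x i - k y i) (h y)))"
  using assms
proof (induction "is" arbitrary: \<phi> Y h)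
  case Nil
  have zero: "\<phi> 0 z = 0" "\<phi> z 0 = 0" for z
    using Nil.prems(2)[of 0 0 z] Nil.prems(3)[of z 0 0] by simp_all
  have "(\<Sum>x\<in>Y. \<phi> (h x) z) = \<phi> (\<Sum>x\<in>Y. h x) z" for z
    using \<open>finite Y\<close> by (induction rule: finite_induct) (simp_all add: Nil.prems zero)
  moreover have "(\<Sum>y\<in>Y. \<phi> z (h y)) = \<phi> z (\<Sum>y\<in>Y. h y)" for z
    using \<open>finite Y\<close> by (induction rule: finite_induct) (simp_all add: Nil.prems zero)
  ultimately have "(\<Sum>x\<in>Y. \<Sum>y\<in>Y. \<phi> (h x) (h y)) = \<phi> (\<Sum>x\<in>Y. h x) (\<Sum>x\<in>Y. h x)" by simp
  then show ?case using Nil.prems(1) by simp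
next
  case (Cons i "is")
  obtain N where N: "\<And>x. x \<in> Y \<Longrightarrow> k x i \<le> N"
    using \<open>finite Y\<close> by (meson Max_ge finite_imageI imageI)
  define \<psi> where "\<psi> q x y = (if q = N then \<phi> x y else \<phi> x y - \<phi> (A i x) (A i y))" for q x y
  define P where "P x y = op_power A is (\<lambda>i. k y i - k x i)" for x y
  have comm: "(A i ^^ n) (P x y z) = P x y ((A i ^^ n) z)" for n x y z
    unfolding P_def by (intro op_power_commute commute_funpow commute_funpow[symmetric]) (use Cons.prems(5) in auto)
  have bf: "brehmer_form A is (\<psi> q)" for q
  proof (cases "q = N")
    case True
    then have "\<psi> q = \<phi>" by (simp add: \<psi>_def fun_eq_iff)
    then show ?thesis using Cons.prems(1) by simp
  next
    case False
    then have "\<psi> q = (\<lambda>x y. \<phi> x y - \<phi> (A i x) (A i y))" by (simp add: \<psi>_def fun_eq_iff)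
    then show ?thesis using Cons.prems(1) by simp
  qed
  have pair: "\<phi> (op_power A (i # is) (\<lambda>i. k y i - k x i) (h x)) (op_power A (i # is) (\<lambda>i. k x i - k y i) (h y))
      = (\<Sum>q\<le>N. if k x i \<le> q \<and> k y i \<le> q then
           \<psi> q (P x y ((A i ^^ (q - k x i)) (h x))) (P y x ((A i ^^ (q - k y i)) (h y))) else 0)"
    if "x \<in> Y" "y \<in> Y" for x y
  proof -
    have "\<phi> (op_power A (i # is) (\<lambda>i. k y i - k x i) (h x)) (op_power A (i # is) (\<lambda>i. k x i - k y i) (h y))
      = (\<Sum>q\<in>{max (k x i) (k y i)..N}. \<psi> q ((A i ^^ (q - k x i)) (P x y (h x))) ((A i ^^ (q - k y i)) (P y x (h y))))"
      using telescoping_form[OF N[OF that(1)] N[OF that(2)], of \<phi> "A i" "P x y (h x)" "P y x (h y)"]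
      unfolding P_def \<psi>_def by simp
    also have "\<dots> = (\<Sum>q\<in>{q\<in>{..N}. k x i \<le> q \<and> k y i \<le> q}.
        \<psi> q (P x y ((A i ^^ (q - k x i)) (h x))) (P y x ((A i ^^ (q - k y i)) (h y))))"
      by (rule sum.cong) (auto simp: comm)
    also have "\<dots> = (\<Sum>q\<le>N. if k x i \<le> q \<and> k y i \<le> q then
           \<psi> q (P x y ((A i ^^ (q - k x i)) (h x))) (P y x ((A i ^^ (q - k y i)) (h y))) else 0)"
      by (rule sum.inter_filter) simp
    finally show ?thesis .
  qed
  have "0 \<le> (\<Sum>x\<in>{x\<in>Y. k x i \<le> q}. \<Sum>y\<in>{x\<in>Y. k x i \<le> q}.
      \<psi> q (P x y ((A i ^^ (q - k x i)) (h x))) (P y x ((A i ^^ (q - k y i)) (h y))))" for q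
    unfolding P_def
    by (rule Cons.IH[OF bf, where h="\<lambda>x. (A i ^^ (q - k x i)) (h x)"])
      (use Cons.prems(2-) in \<open>simp_all add: \<psi>_def algebra_simps\<close>)
  also have "(\<Sum>x\<in>{x\<in>Y. k x i \<le> q}. \<Sum>y\<in>{x\<in>Y. k x i \<le> q}.
      \<psi> q (P x y ((A i ^^ (q - k x i)) (h x))) (P y x ((A i ^^ (q - k y i)) (h y)))) =
     (\<Sum>x\<in>Y. \<Sum>y\<in>Y. if k x i \<le> q \<and> k y i \<le> q then
        \<psi> q (P x y ((A i ^^ (q - k x i)) (h x))) (P y x ((A i ^^ (q - k y i)) (h y))) else 0)" for q
    unfolding sum.inter_filter[OF \<open>finite Y\<close>] by (intro sum.cong refl) auto
  finally have nonneg: "0 \<le> (\<Sum>x\<in>Y. \<Sum>y\<in>Y. if k x i \<le> q \<and> k y i \<le> q then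
        \<psi> q (P x y ((A i ^^ (q - k x i)) (h x))) (P y x ((A i ^^ (q - k y i)) (h y))) else 0)" for q .
  have "(\<Sum>x\<in>Y. \<Sum>y\<in>Y. \<phi> (op_power A (i # is) (\<lambda>i. k y i - k x i) (h x)) (op_power A (i # is) (\<lambda>i. k x i - k y i) (h y)))
     = (\<Sum>x\<in>Y. \<Sum>y\<in>Y. \<Sum>q\<le>N. if k x i \<le> q \<and> k y i \<le> q then
           \<psi> q (P x y ((A i ^^ (q - k x i)) (h x))) (P y x ((A i ^^ (q - k y i)) (h y))) else 0)"
    by (intro sum.cong refl pair)
  also have "\<dots> = (\<Sum>q\<le>N. \<Sum>x\<in>Y. \<Sum>y\<in>Y. if k x i \<le> q \<and> k y i \<le> q then
           \<psi> q (P x y ((A i ^^ (q - k x i)) (h x))) (P y x ((A i ^^ (q - k y i)) (h y))) else 0)"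
    by (subst sum.swap[of _ "{..N}" Y], intro sum.cong refl sum.swap)
  also have "\<dots> \<ge> 0" by (intro sum_nonneg nonneg)
  finally show ?case .
qed

text \<open>
  For \<open>\<phi> = cinner\<close> these are the inner products \<open>\<langle>V\<^sup>k h, V\<^sup>l g\<rangle>\<close> that commuting, doubly commuting isometries
  \<open>V i\<close> with \<open>V i\<^sup>* = A i\<close> on the original space must have: \<open>V\<^bsup>*l\<^esup> V\<^sup>k\<close> reduces to
  \<open>V\<^bsup>(k-l)\<^esup> V\<^bsup>*(l-k)\<^esup>\<close>, and both adjoints act on the original space through \<open>A\<close>.
\<close>

definition brehmer_kernel ::
  "('h \<Rightarrow> 'h \<Rightarrow> complex) \<Rightarrow> (nat \<Rightarrow> 'h \<Rightarrow> 'h) \<Rightarrow> nat list \<Rightarrow> (nat \<Rightarrow> nat) \<times> 'h \<Rightarrow> (nat \<Rightarrow> nat) \<times> 'h \<Rightarrow> complex" where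
  "brehmer_kernel \<phi> A is x y =
     \<phi> (op_power A is (\<lambda>i. fst y i - fst x i) (snd x)) (op_power A is (\<lambda>i. fst x i - fst y i) (snd y))"

lemma clinear_funpow: "clinear (A :: 'a::chilbert_space \<Rightarrow> 'a) \<Longrightarrow> clinear (A ^^ n)"
  by (induction n) (auto simp: clinear_def)

lemma clinear_op_power: "(\<And>i. i \<in> set is \<Longrightarrow> clinear (A i)) \<Longrightarrow> clinear (op_power A is k)"
  by (induction "is") (simp_all add: clinear_id clinear_compose clinear_funpow)

lemma brehmer_kernel_nonneg:
  fixes \<phi> :: "'h::chilbert_space \<Rightarrow> 'h \<Rightarrow> complex"
  assumes "brehmer_form A is \<phi>"
    and "\<And>x y z. \<phi> (x + y) z = \<phi> x z + \<phi> y z" "\<And>x y z. \<phi> z (x + y) = \<phi> z x + \<phi> z y"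
    and scale: "\<And>c x z. \<phi> (c *\<^sub>C x) z = c * \<phi> x z" "\<And>c x z. \<phi> z (c *\<^sub>C x) = cnj c * \<phi> z x"
    and lin: "\<And>i. i \<in> set is \<Longrightarrow> clinear (A i)"
    and "\<And>i j x. i \<in> set is \<Longrightarrow> j \<in> set is \<Longrightarrow> A i (A j x) = A j (A i x)"
  shows "0 \<le> kform (brehmer_kernel \<phi> A is) xs xs"
proof -
  define k where "k n = fst (snd (xs ! n))" for n
  define h where "h n = fst (xs ! n) *\<^sub>C snd (snd (xs ! n))" for n
  have cl: "clinear (op_power A is k)" for k by (rule clinear_op_power[OF lin])
  have "kform (brehmer_kernel \<phi> A is) xs xs
    = (\<Sum>m<length xs. \<Sum>n<length xs. fst (xs ! m) * cnj (fst (xs ! n)) * brehmer_kernel \<phi> A is (snd (xs ! m)) (snd (xs ! n)))"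
    by (simp add: kform_def sum_list_sum_nth case_prod_unfold atLeast0LessThan)
  also have "\<dots> = (\<Sum>m<length xs. \<Sum>n<length xs.
      \<phi> (op_power A is (\<lambda>i. k n i - k m i) (h m)) (op_power A is (\<lambda>i. k m i - k n i) (h n)))"
    unfolding k_def h_def brehmer_kernel_def by (simp add: clinear_scaleC[OF cl] scale mult_ac)
  also have "\<dots> \<ge> 0"
    by (rule brehmer_form_sum_nonneg) (use assms in \<open>auto simp: clinear_add[OF lin]\<close>)
  finally show ?thesis .
qed

section \<open>Brehmer positivity as positivity of forms\<close>

text \<open>
  The subsets of \<open>insert i G\<close> are those of \<open>G\<close> and those obtained from them by adding \<open>i\<close>; the second
  kind carry the opposite sign and one more factor \<open>A i\<close>.  Hence the alternating sum over
  \<open>insert i G\<close> for \<open>\<phi>\<close> is the alternating sum over \<open>G\<close> for \<open>\<phi>(x, y) - \<phi>(A i x, A i y)\<close>.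
\<close>

lemma brehmer_formI:
  fixes B :: "nat set \<Rightarrow> 'h \<Rightarrow> 'h"
  assumes "distinct is"
    and "\<And>F i. finite F \<Longrightarrow> i \<notin> F \<Longrightarrow> insert i F \<subseteq> set is \<Longrightarrow> B (insert i F) = A i \<circ> B F"
    and "B {} = id"
    and "\<And>G x. G \<subseteq> set is \<Longrightarrow> 0 \<le> (\<Sum>F\<in>Pow G. (-1) ^ card F * \<phi> (B F x) (B F x))"
  shows "brehmer_form A is \<phi>"
  using assms
proof (induction "is" arbitrary: \<phi>)
  case Nil
  then show ?case using Nil.prems(4)[of "{}"] by simp
next
  case (Cons i "is")
  have B: "B (insert j F) = A j \<circ> B F" if "finite F" "j \<notin> F" "insert j F \<subseteq> set is" for F j
    using that by (intro Cons.prems(2)) auto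
  have "brehmer_form A is \<phi>"
  proof (rule Cons.IH[OF _ B])
    show "0 \<le> (\<Sum>F\<in>Pow G. (-1) ^ card F * \<phi> (B F x) (B F x))" if "G \<subseteq> set is" for G x
      using that by (intro Cons.prems(4)) auto
  qed (use Cons.prems(1,3) in auto)
  moreover have "brehmer_form A is (\<lambda>x y. \<phi> x y - \<phi> (A i x) (A i y))"
  proof (rule Cons.IH[OF _ B])
    fix G x assume G: "G \<subseteq> set is"
    then have fin: "finite G" and iG: "i \<notin> G" using Cons.prems(1) by (auto intro: finite_subset)
    have disj: "Pow G \<inter> insert i ` Pow G = {}" using iG by auto
    have inj: "inj_on (insert i) (Pow G)" using iG by (auto simp: inj_on_def)
    have "0 \<le> (\<Sum>F\<in>Pow (insert i G). (-1) ^ card F * \<phi> (B F x) (B F x))"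
      using G by (intro Cons.prems(4)) auto
    also have "\<dots> = (\<Sum>F\<in>Pow G. (-1) ^ card F * \<phi> (B F x) (B F x))
        + (\<Sum>F\<in>Pow G. (-1) ^ card (insert i F) * \<phi> (B (insert i F) x) (B (insert i F) x))"
      unfolding Pow_insert using fin disj by (simp add: sum.union_disjoint sum.reindex[OF inj])
    also have "(\<Sum>F\<in>Pow G. (-1) ^ card (insert i F) * \<phi> (B (insert i F) x) (B (insert i F) x))
      = (\<Sum>F\<in>Pow G. - ((-1) ^ card F * \<phi> (A i (B F x)) (A i (B F x))))"
    proof (rule sum.cong[OF refl])
      fix F assume F: "F \<in> Pow G"
      then have "finite F" "i \<notin> F" using fin iG by (auto intro: finite_subset)
      moreover have "B (insert i F) = A i \<circ> B F"
        using calculation F G by (intro Cons.prems(2)) auto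
      ultimately show "(-1) ^ card (insert i F) * \<phi> (B (insert i F) x) (B (insert i F) x)
        = - ((-1) ^ card F * \<phi> (A i (B F x)) (A i (B F x)))" by simp
    qed
    finally show "0 \<le> (\<Sum>F\<in>Pow G. (-1) ^ card F * (\<phi> (B F x) (B F x) - \<phi> (A i (B F x)) (A i (B F x))))"
      by (simp add: right_diff_distrib sum_subtractf sum_negf)
  qed (use Cons.prems(1,3) in auto)
  ultimately show ?case by simp
qed

lemma commuting_contractionsD:
  assumes "T \<in> commuting_contractions m" "i \<in> {1..m}"
  shows "contraction (T i)" "j \<in> {1..m} \<Longrightarrow> T i (T j x) = T j (T i x)"
  using assms by (auto simp: commuting_contractions_def fun_eq_iff)

lemma tuple_prod_insert:
  assumes "finite F" "i \<notin> F" and comm: "\<And>j x. j \<in> F \<Longrightarrow> T i (T j x) = T j (T i x)"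
  shows "tuple_prod T (insert i F) = T i \<circ> tuple_prod T F"
proof -
  have "foldr (\<lambda>i A. T i \<circ> A) (insort i xs) id = T i \<circ> foldr (\<lambda>i A. T i \<circ> A) xs id"
    if "set xs \<subseteq> F" for xs
    using that
  proof (induction xs)
    case (Cons j xs)
    then have "T i (T j x) = T j (T i x)" for x using comm by auto
    then show ?case using Cons by (auto simp: fun_eq_iff)
  qed simp
  then show ?thesis using assms(1,2) by (simp add: tuple_prod_def sorted_list_of_set_insert)
qed

lemma tuple_prod_contraction:
  assumes "finite F" "\<And>i. i \<in> F \<Longrightarrow> contraction (T i)"
  shows "contraction (tuple_prod T F)"
proof -
  have "contraction (foldr (\<lambda>i A. T i \<circ> A) xs id)" if "set xs \<subseteq> F" for xs
    using that by (induction xs) (use assms(2) in \<open>auto simp: contraction_id contraction_compose\<close>)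
  then show ?thesis using assms(1) by (simp add: tuple_prod_def)
qed

lemma adj_commute:
  assumes "adj A A'" "adj B B'" "\<And>x. A (B x) = B (A x)"
  shows "A' (B' x) = B' (A' x)"
proof -
  have "A \<circ> B = B \<circ> A" using assms(3) by auto
  then have "B' \<circ> A' = A' \<circ> B'"
    using adj_compose[OF assms(1,2)] adj_compose[OF assms(2,1)] adj_unique by metis
  then show ?thesis by (metis comp_apply)
qed

lemma brehmer_imp_brehmer_form:
  assumes T: "T \<in> brehmer m" and "distinct is" "set is \<subseteq> {1..m}"
  shows "brehmer_form (\<lambda>i. cadjoint (T i)) is cinner"
proof (rule brehmer_formI[where B="\<lambda>F. cadjoint (tuple_prod T F)"])
  have T': "T \<in> commuting_contractions m" using T by (simp add: brehmer_def)
  note contr = commuting_contractionsD(1)[OF T']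
  have adjF: "adj (tuple_prod T F) (cadjoint (tuple_prod T F))" if "F \<subseteq> {1..m}" for F
    by (intro contraction_adj_exists tuple_prod_contraction)
      (use that finite_subset[OF that] in \<open>blast intro: contr\<close>)+
  show "cadjoint (tuple_prod T (insert i F)) = cadjoint (T i) \<circ> cadjoint (tuple_prod T F)"
    if "finite F" "i \<notin> F" "insert i F \<subseteq> set is" for F i
  proof -
    have sub: "insert i F \<subseteq> {1..m}" using that assms(3) by auto
    have comm: "T i (T j x) = T j (T i x)" if "j \<in> F" for j x
      using sub that by (intro commuting_contractionsD(2)[OF T']) auto
    have "T i (tuple_prod T F x) = tuple_prod T F (T i x)" for x
    proof -
      have "T i (foldr (\<lambda>i A. T i \<circ> A) xs id x) = foldr (\<lambda>i A. T i \<circ> A) xs id (T i x)"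
        if "set xs \<subseteq> F" for xs
        using that comm by (induction xs) auto
      then show ?thesis using \<open>finite F\<close> by (simp add: tuple_prod_def)
    qed
    then have "tuple_prod T (insert i F) = tuple_prod T F \<circ> T i"
      using tuple_prod_insert[of F i T] comm that by auto
    moreover have "adj (tuple_prod T F \<circ> T i) (cadjoint (T i) \<circ> cadjoint (tuple_prod T F))"
      using sub by (intro adj_compose adjF contraction_adj_exists contr) auto
    ultimately show ?thesis by (simp add: adj_cadjoint)
  qed
  show "cadjoint (tuple_prod T {}) = id"
    by (rule adj_cadjoint) (simp add: tuple_prod_def adj_def)
  show "0 \<le> (\<Sum>F\<in>Pow G. (-1) ^ card F * cinner (cadjoint (tuple_prod T F) x) (cadjoint (tuple_prod T F) x))"
    if G: "G \<subseteq> set is" for G x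
  proof -
    have sub: "G \<subseteq> {1..m}" using G assms(3) by auto
    have "0 \<le> cinner (\<Sum>F\<in>Pow G. (-1) ^ card F *\<^sub>C tuple_prod T F (cadjoint (tuple_prod T F) x)) x"
      using T sub by (auto simp: brehmer_def positive_op_def)
    also have "\<dots> = (\<Sum>F\<in>Pow G. (-1) ^ card F * cinner (cadjoint (tuple_prod T F) x) (cadjoint (tuple_prod T F) x))"
      unfolding cinner_sum_left cinner_scaleC_left
      by (intro sum.cong refl arg_cong2[of _ _ _ _ "(*)"] adjD adjF) (use sub in auto)
    finally show ?thesis .
  qed
qed (use assms in auto)

section \<open>Operators induced by index maps\<close>

text \<open>
  An operator that permutes the vectors of a family according to a map of the labels.  On the
  orthogonal complement of the family it is the identity: in this way isometries between the spanned
  subspaces stay isometries of the whole space, and composition of operators follows composition of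
  label maps.
\<close>

definition induces :: "('x \<Rightarrow> 'h::chilbert_space) \<Rightarrow> ('x \<Rightarrow> 'x) \<Rightarrow> ('h \<Rightarrow> 'h) \<Rightarrow> bool" where
  "induces v \<tau> C \<longleftrightarrow> contraction C \<and> (\<forall>x. C (v x) = v (\<tau> x)) \<and> (\<forall>m. (\<forall>x. cinner (v x) m = 0) \<longrightarrow> C m = m)"

lemma family_eqI:
  fixes v :: "'x \<Rightarrow> 'h::chilbert_space"
  assumes "bounded_linear A" "bounded_linear B"
    and eq: "\<And>c x. A (c *\<^sub>C v x) = B (c *\<^sub>C v x)"
    and eq0: "\<And>m. (\<And>x. cinner (v x) m = 0) \<Longrightarrow> A m = B m"
  shows "A = B"
proof (rule contractions_eqI[where a="comb v"])
  show "A (comb v xs) = B (comb v xs)" for xs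
  proof (induction xs)
    case Nil
    then show ?case using assms(1,2) by (simp add: linear_simps)
  next
    case (Cons cx xs)
    then show ?case using assms(1,2) eq by (cases cx) (simp add: linear_simps)
  qed
  show "A m = B m" if "\<And>xs. cinner (comb v xs) m = 0" for m
    using that[of "[(1, _)]"] by (intro eq0) simp
qed (use assms comb_span in blast)+

text \<open>
  An induced operator is determined by its label map.  Commutation relations and left inverses can
  therefore be checked on labels.
\<close>

lemma induces_unique:
  assumes "induces v \<tau> C" "induces v \<sigma> D" "\<And>x. v (\<tau> x) = v (\<sigma> x)"
  shows "C = D"
  using assms unfolding induces_def
  by (intro family_eqI[where v=v]) (auto simp: contraction_bounded_linear clinear_scaleC contraction_clinear)

lemma induces_compose:
  assumes "induces v \<tau> C" "induces v \<sigma> D"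
  shows "induces v (\<tau> \<circ> \<sigma>) (C \<circ> D)"
  using assms unfolding induces_def by (auto simp: contraction_compose)

lemma induces_commute:
  assumes "induces v \<tau> C" "induces v \<sigma> D" "\<And>x. v (\<tau> (\<sigma> x)) = v (\<sigma> (\<tau> x))"
  shows "C (D z) = D (C z)"
  using induces_unique[OF induces_compose[OF assms(1,2)] induces_compose[OF assms(2,1)]] assms(3)
  by (simp add: fun_eq_iff)

text \<open>
  The contraction on the closed span is extended by the identity.  That the result is a contraction
  rests on the orthogonality of the two parts: the extension \<open>C0\<close> by zero has its range in the closed
  span.
\<close>

lemma induces_exists:
  fixes v :: "'x \<Rightarrow> 'h::chilbert_space"
  assumes le: "\<And>xs. norm (comb (\<lambda>x. v (\<tau> x)) xs) \<le> norm (comb v xs)"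
  obtains C where "induces v \<tau> C"
proof -
  obtain C0 where C0: "contraction C0" "\<And>xs. C0 (comb v xs) = comb (\<lambda>x. v (\<tau> x)) xs"
    "\<And>m. (\<And>xs. cinner (comb v xs) m = 0) \<Longrightarrow> C0 m = 0"
    by (rule contraction_extension[OF comb_span le]) blast
  obtain P where P: "contraction P" "\<And>xs. P (comb v xs) = comb v xs"
    "\<And>m. (\<And>xs. cinner (comb v xs) m = 0) \<Longrightarrow> P m = 0"
    by (rule contraction_extension[of "comb v" "comb v"]) (use comb_span in blast)+
  have Cv: "C0 (v x) = v (\<tau> x)" and Pv: "P (v x) = v x" for x
    using C0(2)[of "[(1, x)]"] P(2)[of "[(1, x)]"] by simp_all
  note C0' = C0(3)[OF comb_orth] and P' = P(3)[OF comb_orth]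
  note lin = clinear_scaleC[OF contraction_clinear[OF C0(1)]] clinear_scaleC[OF contraction_clinear[OF P(1)]]
  note bl = contraction_bounded_linear[OF C0(1)] contraction_bounded_linear[OF P(1)]
  have C0_P: "C0 z = C0 (P z)" for z
  proof -
    have "C0 = (\<lambda>z. C0 (P z))"
      by (rule family_eqI[where v=v])
        (auto simp: bl lin Pv C0' P' clinear_0[OF contraction_clinear[OF C0(1)]] intro!: bounded_linear_compose[OF bl(1) bl(2)])
    then show ?thesis by metis
  qed
  have ranC: "cinner (C0 z) m = 0" and ranP: "cinner (P z) m = 0" if "\<And>x. cinner (v x) m = 0" for z m
  proof -
    have "(\<lambda>z. cinner (C0 z) m) = (\<lambda>z. 0)"
      by (rule family_eqI[where v=v])
        (auto simp: lin Cv C0' cinner_scaleC_left that intro!: bounded_linear_compose[OF bounded_linear_cinner_left bl(1)])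
    then show "cinner (C0 z) m = 0" by metis
    have "(\<lambda>z. cinner (P z) m) = (\<lambda>z. 0)"
      by (rule family_eqI[where v=v])
        (auto simp: lin Pv P' cinner_scaleC_left that intro!: bounded_linear_compose[OF bounded_linear_cinner_left bl(2)])
    then show "cinner (P z) m = 0" by metis
  qed
  have compl: "cinner (v x) (z - P z) = 0" for x z
  proof -
    have "(\<lambda>z. cinner (v x) (z - P z)) = (\<lambda>z. 0)"
      by (rule family_eqI[where v=v])
        (auto simp: lin Pv P' intro!: bounded_linear_compose[OF bounded_linear_cinner_right] bounded_linear_sub bl bounded_linear_ident)
    then show ?thesis by metis
  qed
  \<comment> \<open>\<open>P\<close> is the orthogonal projection onto the closed span of the family.\<close>
  define C where "C z = C0 z + (z - P z)" for z
  have "norm (C z) \<le> norm z" for z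
  proof (rule power2_le_imp_le)
    have 1: "C0 z \<bullet> (z - P z) = 0" "P z \<bullet> (z - P z) = 0"
      using ranC[OF compl] ranP[OF compl] by (metis Re_cinner zero_complex.simps(1))+
    have "(norm (C z))\<^sup>2 = (norm (C0 (P z)))\<^sup>2 + (norm (z - P z))\<^sup>2"
      using norm_add_Pythagorean[of "C0 z" "z - P z"] 1 C0_P[of z] by (simp add: C_def orthogonal_def)
    also have "\<dots> \<le> (norm (P z))\<^sup>2 + (norm (z - P z))\<^sup>2"
      using contraction_norm[OF C0(1), of "P z"] by (simp add: power_mono)
    also have "\<dots> = (norm z)\<^sup>2"
      using norm_add_Pythagorean[of "P z" "z - P z"] 1 by (simp add: orthogonal_def)
    finally show "(norm (C z))\<^sup>2 \<le> (norm z)\<^sup>2" .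
  qed simp
  moreover have "clinear C"
    using contraction_clinear[OF C0(1)] contraction_clinear[OF P(1)]
    by (intro clinearI) (simp_all add: C_def clinear_add clinear_scaleC scaleC_add_right scaleC_diff_right)
  ultimately have "induces v \<tau> C"
    by (auto simp: induces_def contraction_def C_def Cv Pv C0' P')
  then show ?thesis by (rule that)
qed

lemma induces_adjoint:
  assumes C: "induces v \<tau> C" and gram: "\<And>x y. cinner (v (\<tau> x)) (v y) = cinner (v x) (v (\<sigma> y))"
  shows "induces v \<sigma> (cadjoint C)"
proof -
  have c: "contraction C" "\<And>x. C (v x) = v (\<tau> x)" "\<And>m. (\<And>x. cinner (v x) m = 0) \<Longrightarrow> C m = m"
    using C by (auto simp: induces_def)
  note adj = adjD[OF contraction_adj_exists[OF c(1)]]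
  have zero: "d = 0" if "\<And>x. cinner (v x) d = 0" "\<And>m. (\<And>x. cinner (v x) m = 0) \<Longrightarrow> cinner m d = 0" for d
    using that(2)[OF that(1)] by (simp add: cinner_self)
  have "cadjoint C (v y) = v (\<sigma> y)" for y
  proof -
    have "cadjoint C (v y) - v (\<sigma> y) = 0"
    proof (rule zero)
      show "cinner (v x) (cadjoint C (v y) - v (\<sigma> y)) = 0" for x
        by (simp add: cinner_diff_right gram c(2) flip: adj)
      show "cinner m (cadjoint C (v y) - v (\<sigma> y)) = 0" if m: "\<And>x. cinner (v x) m = 0" for m
      proof -
        have "cinner m (v x) = 0" for x using m[of x] by (subst cinner_commute) simp
        then show ?thesis by (simp add: cinner_diff_right c(3)[OF m] flip: adj)
      qed
    qed
    then show ?thesis by simp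
  qed
  moreover have "cadjoint C m = m" if m: "\<And>x. cinner (v x) m = 0" for m
  proof -
    have "cadjoint C m - m = 0"
    proof (rule zero)
      show "cinner (v x) (cadjoint C m - m) = 0" for x
        by (simp add: cinner_diff_right c(2) m flip: adj)
      show "cinner m' (cadjoint C m - m) = 0" if "\<And>x. cinner (v x) m' = 0" for m'
        by (simp add: cinner_diff_right c(3)[OF that] flip: adj)
    qed
    then show ?thesis by simp
  qed
  ultimately show ?thesis using contraction_cadjoint[OF c(1)] by (auto simp: induces_def)
qed

lemma induces_id: "induces v (\<lambda>x. x) id"
  by (simp add: induces_def contraction_id)

lemma isometry_of_left_inverse:
  assumes "contraction C" "contraction D" "\<And>x. D (C x) = x"
  shows "isometry C"
  unfolding isometry_def
proof (intro conjI allI antisym)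
  show "norm x \<le> norm (C x)" for x
    using contraction_norm[OF assms(2), of "C x"] assms(3) by simp
qed (use assms(1) in \<open>auto simp: contraction_def\<close>)

section \<open>Doubly commuting isometric coextensions\<close>

lemma op_power_zero: "op_power A is (\<lambda>i. 0) = id"
  by (induction "is") auto

lemma op_power_cong: "(\<And>i. i \<in> set is \<Longrightarrow> k i = l i) \<Longrightarrow> op_power A is k = op_power A is l"
  by (induction "is") auto

lemma op_power_Suc:
  assumes "distinct is" "i \<in> set is" and comm: "\<And>j x. j \<in> set is \<Longrightarrow> A i (A j x) = A j (A i x)"
  shows "op_power A is (k(i := Suc (k i))) h = op_power A is k (A i h)"
  using assms
proof (induction "is")
  case (Cons j "is")
  have c: "A i (op_power A is k x) = op_power A is k (A i x)" for x
    by (intro op_power_commute commute_funpow) (use Cons.prems(3) in auto)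
  show ?case
  proof (cases "j = i")
    case True
    then have "op_power A is (k(i := Suc (k i))) = op_power A is k"
      using Cons.prems(1) by (intro op_power_cong) auto
    then show ?thesis
      unfolding True by (simp only: op_power_simps comp_apply fun_upd_same funpow_Suc_right c)
  next
    case False
    then show ?thesis using Cons by simp
  qed
qed simp

lemma kform_diff: "kform (\<lambda>x y. K x y - L x y) xs ys = kform K xs ys - kform L xs ys"
  by (simp add: kform_def case_prod_unfold right_diff_distrib sum_list_subtractf)

lemma norm_comb_le:
  assumes "0 \<le> kform (\<lambda>x y. cinner (v x) (v y) - cinner (w x) (w y)) xs xs"
  shows "norm (comb w xs) \<le> norm (comb v xs)"
  using assms unfolding kform_diff kform_cinner cinner_self
  by (auto simp: less_eq_complex_def intro: power2_le_imp_le)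

text \<open>
  The label \<open>(k, h)\<close> stands for \<open>V\<^sup>k J h\<close>.  The isometry \<open>V i\<close> raises the \<open>i\<close>th exponent; its adjoint
  \<open>B i\<close> lowers the exponent, or applies \<open>A i\<close> to \<open>h\<close> when the exponent is zero.  For \<open>p\<close> in \<open>E\<close> the operator
  \<open>B p\<close> applies \<open>A p\<close> to \<open>h\<close>.  These label maps commute except for \<open>V i\<close> with \<open>B i\<close>, which gives all the
  commutation relations.
  
  The boundedness of \<open>B p\<close> is the point where the extra operator enters the hypotheses: the Gram matrix
  minus its image under \<open>B p\<close> is the kernel of the form \<open>\<langle>x, y\<rangle> - \<langle>A p x, A p y\<rangle>\<close>, and this form is
  again positive in the sense of \<^const>\<open>brehmer_form\<close>.
\<close>

lemma brehmer_coextension: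
  fixes A :: "nat \<Rightarrow> 'a::chilbert_space \<Rightarrow> 'a" and E :: "nat set"
  assumes "distinct is" and disj: "set is \<inter> E = {}"
    and lin: "\<And>i. i \<in> set is \<union> E \<Longrightarrow> clinear (A i)"
    and comm: "\<And>i j x. i \<in> set is \<union> E \<Longrightarrow> j \<in> set is \<union> E \<Longrightarrow> A i (A j x) = A j (A i x)"
    and bf: "brehmer_form A is cinner" and bfE: "\<And>p. p \<in> E \<Longrightarrow> brehmer_form A (p # is) cinner"
  obtains J :: "'a \<Rightarrow> 'a dilation_space" and B V :: "nat \<Rightarrow> 'a dilation_space \<Rightarrow> 'a dilation_space"
  where "isometry J"
    "\<And>i. i \<in> set is \<union> E \<Longrightarrow> contraction (B i)"
    "\<And>i h. i \<in> set is \<union> E \<Longrightarrow> B i (J h) = J (A i h)"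
    "\<And>i j x. i \<in> set is \<union> E \<Longrightarrow> j \<in> set is \<union> E \<Longrightarrow> B i (B j x) = B j (B i x)"
    "\<And>i. i \<in> set is \<Longrightarrow> isometry (V i)"
    "\<And>i. i \<in> set is \<Longrightarrow> adj (V i) (B i)"
    "\<And>i j x. i \<in> set is \<Longrightarrow> j \<in> set is \<union> E \<Longrightarrow> i \<noteq> j \<Longrightarrow> V i (B j x) = B j (V i x)"
proof -
  define K where "K = brehmer_kernel cinner A is"
  have "positive_kernel K"
    unfolding positive_kernel_def K_def
  proof (intro conjI allI)
    show "brehmer_kernel cinner A is y x = cnj (brehmer_kernel cinner A is x y)" for x y
      unfolding brehmer_kernel_def by (rule cinner_commute)
    show "0 \<le> kform (brehmer_kernel cinner A is) xs xs" for xs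
      by (rule brehmer_kernel_nonneg[OF bf])
        (use lin comm in \<open>auto simp: cinner_add_left cinner_add_right cinner_scaleC_left cinner_scaleC_right\<close>)
  qed
  then obtain v :: "(nat \<Rightarrow> nat) \<times> 'a \<Rightarrow> 'a dilation_space" where v: "\<And>x y. cinner (v x) (v y) = K x y"
    by (rule positive_kernel_factorization) blast
  define \<tau> where "\<tau> = (\<lambda>i (k :: nat \<Rightarrow> nat, h :: 'a). (k(i := Suc (k i)), h))"
  define \<sigma> where "\<sigma> = (\<lambda>i (k :: nat \<Rightarrow> nat, h :: 'a). if k i = 0 then (k, A i h) else (k(i := k i - 1), h))"
  define \<rho> where "\<rho> = (\<lambda>i (k :: nat \<Rightarrow> nat, h :: 'a). (k, A i h))"
  have K_\<tau>\<tau>: "K (\<tau> i x) (\<tau> i y) = K x y" for i x y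
    by (cases x; cases y) (auto simp: K_def brehmer_kernel_def \<tau>_def intro!: arg_cong2[of _ _ _ _ cinner] arg_cong[of _ _ "\<lambda>k. op_power A is k _"])
  have K_\<sigma>: "K (\<sigma> i x) y = K x (\<tau> i y)" if i: "i \<in> set is" for i x y
  proof -
    obtain k h l g where xy: "x = (k, h)" "y = (l, g)" by (cases x; cases y) auto
    show ?thesis
    proof (cases "k i = 0")
      case True
      define e where "e = (\<lambda>j. l j - k j)"
      have "(\<lambda>j. (l(i := Suc (l i))) j - k j) = e(i := Suc (e i))"
        using True by (auto simp: e_def fun_eq_iff)
      moreover have "(\<lambda>j. k j - (l(i := Suc (l i))) j) = (\<lambda>j. k j - l j)"
        using True by (auto simp: fun_eq_iff)
      moreover have "op_power A is (e(i := Suc (e i))) h = op_power A is e (A i h)"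
        using assms(1) i comm by (intro op_power_Suc) auto
      ultimately show ?thesis
        using True by (simp add: xy K_def brehmer_kernel_def \<sigma>_def \<tau>_def e_def)
    next
      case False
      then have "(\<lambda>j. l j - (k(i := k i - 1)) j) = (\<lambda>j. (l(i := Suc (l i))) j - k j)"
        "(\<lambda>j. (k(i := k i - 1)) j - l j) = (\<lambda>j. k j - (l(i := Suc (l i))) j)"
        by (auto simp: fun_eq_iff)
      then show ?thesis using False by (simp add: xy K_def brehmer_kernel_def \<sigma>_def \<tau>_def)
    qed
  qed
  have "\<exists>C. induces v (\<tau> i) C" for i
  proof -
    have "norm (comb (\<lambda>x. v (\<tau> i x)) xs) \<le> norm (comb v xs)" for xs
      by (rule norm_comb_le) (simp add: v K_\<tau>\<tau> kform_def case_prod_unfold)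
    then show ?thesis using induces_exists by blast
  qed
  then obtain V where V: "\<And>i. induces v (\<tau> i) (V i)" by metis
  have "\<exists>C. induces v (\<rho> p) C" if p: "p \<in> E" for p
  proof -
    have pc: "A p (op_power A is k h) = op_power A is k (A p h)" for k h
      by (intro op_power_commute commute_funpow) (use comm p in auto)
    have "norm (comb (\<lambda>x. v (\<rho> p x)) xs) \<le> norm (comb v xs)" for xs
    proof (rule norm_comb_le)
      have "0 \<le> kform (brehmer_kernel (\<lambda>x y. cinner x y - cinner (A p x) (A p y)) A is) xs xs"
        by (rule brehmer_kernel_nonneg)
          (use lin comm p bfE[OF p] in \<open>auto simp: cinner_add_left cinner_add_right cinner_scaleC_left
            cinner_scaleC_right clinear_add clinear_scaleC right_diff_distrib\<close>)
      also have "brehmer_kernel (\<lambda>x y. cinner x y - cinner (A p x) (A p y)) A is =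
          (\<lambda>x y. cinner (v x) (v y) - cinner (v (\<rho> p x)) (v (\<rho> p y)))"
        by (auto simp: fun_eq_iff v K_def brehmer_kernel_def \<rho>_def pc)
      finally show "0 \<le> kform (\<lambda>x y. cinner (v x) (v y) - cinner (v (\<rho> p x)) (v (\<rho> p y))) xs xs" .
    qed
    then show ?thesis using induces_exists by blast
  qed
  then obtain R where R: "\<And>p. p \<in> E \<Longrightarrow> induces v (\<rho> p) (R p)" by metis
  define \<beta> where "\<beta> i = (if i \<in> set is then \<sigma> i else \<rho> i)" for i
  define B where "B i = (if i \<in> set is then cadjoint (V i) else R i)" for i
  have B: "induces v (\<beta> i) (B i)" if "i \<in> set is \<union> E" for i
  proof (cases "i \<in> set is")
    case True
    have "induces v (\<sigma> i) (cadjoint (V i))"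
      using V
    proof (rule induces_adjoint)
      show "cinner (v (\<tau> i x)) (v y) = cinner (v x) (v (\<sigma> i y))" for x y
        using K_\<sigma>[OF True, of y x] by (metis v cinner_commute)
    qed
    then show ?thesis using True by (simp add: \<beta>_def B_def)
  qed (use R that in \<open>auto simp: \<beta>_def B_def\<close>)
  have \<beta>\<beta>: "\<beta> i (\<beta> j x) = \<beta> j (\<beta> i x)" if "i \<in> set is \<union> E" "j \<in> set is \<union> E" for i j x
    using comm[OF that] by (cases "i = j") (auto simp: \<beta>_def \<sigma>_def \<rho>_def fun_upd_twist split: prod.splits)
  have \<tau>\<beta>: "\<tau> i (\<beta> j x) = \<beta> j (\<tau> i x)" if "i \<noteq> j" for i j x
    using that by (auto simp: \<beta>_def \<sigma>_def \<rho>_def \<tau>_def fun_upd_twist split: prod.splits)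
  define J where "J h = v (\<lambda>_. 0, h)" for h
  have JJ: "cinner (J h) (J g) = cinner h g" for h g
    by (simp add: J_def v K_def brehmer_kernel_def op_power_zero)
  have "isometry J"
    unfolding isometry_def
  proof (intro conjI allI clinearI)
    fix h g :: 'a and c
    have "cinner (J (h + g) - (J h + J g)) (J (h + g) - (J h + J g)) = 0"
      by (simp add: cinner_add_left cinner_add_right cinner_diff_left cinner_diff_right JJ)
    then show "J (h + g) = J h + J g" by (simp add: cinner_self)
    have "cinner (J (c *\<^sub>C h) - c *\<^sub>C J h) (J (c *\<^sub>C h) - c *\<^sub>C J h) = 0"
      by (simp add: cinner_scaleC_left cinner_scaleC_right cinner_diff_left cinner_diff_right JJ)
    then show "J (c *\<^sub>C h) = c *\<^sub>C J h" by (simp add: cinner_self)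
    show "norm (J h) = norm h" using JJ[of h h] by (simp add: cinner_self flip: of_real_power)
  qed
  moreover have "contraction (B i)" if "i \<in> set is \<union> E" for i
    using B[OF that] by (simp add: induces_def)
  moreover have "B i (J h) = J (A i h)" if "i \<in> set is \<union> E" for i h
    using B[OF that] by (auto simp: induces_def J_def \<beta>_def \<sigma>_def \<rho>_def)
  moreover have "B i (B j x) = B j (B i x)" if "i \<in> set is \<union> E" "j \<in> set is \<union> E" for i j x
    using \<beta>\<beta>[OF that] by (intro induces_commute[OF B[OF that(1)] B[OF that(2)]]) simp
  moreover have "isometry (V i)" if "i \<in> set is" for i
  proof (rule isometry_of_left_inverse)
    show "contraction (V i)" "contraction (B i)"
      using V[of i] B[of i] that by (auto simp: induces_def)
    have "\<beta> i (\<tau> i x) = x" for x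
      using that by (cases x) (auto simp: \<beta>_def \<sigma>_def \<tau>_def)
    then have "B i \<circ> V i = id"
      using that by (intro induces_unique[OF induces_compose[OF B V] induces_id]) auto
    then show "B i (V i x) = x" for x by (simp add: fun_eq_iff)
  qed
  moreover have "adj (V i) (B i)" if "i \<in> set is" for i
    using that V[of i] contraction_adj_exists[of "V i"] by (simp add: B_def induces_def)
  moreover have "V i (B j x) = B j (V i x)" if "i \<in> set is" "j \<in> set is \<union> E" "i \<noteq> j" for i j x
    using \<tau>\<beta>[OF that(3)] by (intro induces_commute[OF V B[OF that(2)]]) simp
  ultimately show ?thesis by (rule that)
qed

section \<open>Defect operators\<close>

text \<open>
  The Taylor coefficients of \<open>sqrt (1 - x)\<close> at \<open>0\<close>.
\<close>

definition sqrt_coeff :: "nat \<Rightarrow> real" where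
  "sqrt_coeff k = (1/2 gchoose k) * (-1) ^ k"

lemma sqrt_coeff_0: "sqrt_coeff 0 = 1"
  by (simp add: sqrt_coeff_def)

lemma gbinomial_Suc_ratio: "(a gchoose Suc k) = (a gchoose k) * (a - real k) / real (Suc k)"
  by (simp add: gbinomial_prod_rev)

lemma sqrt_coeff_Suc_neg: "sqrt_coeff (Suc k) < 0"
proof (induction k)
  case 0
  then show ?case by (simp add: sqrt_coeff_def)
next
  case (Suc k)
  have "sqrt_coeff (Suc (Suc k)) = sqrt_coeff (Suc k) * ((real (Suc k) - 1/2) / real (Suc (Suc k)))"
    unfolding sqrt_coeff_def gbinomial_Suc_ratio[of _ "Suc k"] by (simp add: field_simps)
  also have "\<dots> < 0" by (rule mult_neg_pos[OF Suc]) simp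
  finally show ?case .
qed

text \<open>
  All coefficients but the first are negative, and the partial sums have the closed form
  \<open>(-1)\<^sup>m (-1/2 gchoose m) \<ge> 0\<close>; hence the absolute values sum to at most \<open>2\<close>.
\<close>

lemma summable_sqrt_coeff: "summable (\<lambda>k. \<bar>sqrt_coeff k\<bar>)"
proof (rule bounded_imp_summable)
  fix n
  have pos: "0 \<le> (-1) ^ m * (- (1/2) gchoose m :: real)" for m
  proof (induction m)
    case (Suc m)
    have "(-1) ^ Suc m * (- (1/2) gchoose Suc m :: real) = ((-1) ^ m * (- (1/2) gchoose m)) * ((1/2 + real m) / real (Suc m))"
      unfolding gbinomial_Suc_ratio by (simp add: field_simps)
    then show ?case using Suc by (metis (no_types) add_nonneg_nonneg divide_nonneg_nonneg half_gt_zero_iff less_eq_real_def mult_nonneg_nonneg of_nat_0_le_iff zero_less_one)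
  qed simp
  have "(\<Sum>k\<le>n. \<bar>sqrt_coeff k\<bar>) = (\<Sum>k\<le>n. (if k = 0 then 2 else 0) - sqrt_coeff k)"
  proof (rule sum.cong)
    fix k
    show "\<bar>sqrt_coeff k\<bar> = (if k = 0 then 2 else 0) - sqrt_coeff k"
      using sqrt_coeff_0 sqrt_coeff_Suc_neg by (cases k) (simp_all add: abs_of_neg)
  qed simp
  also have "\<dots> = 2 - (\<Sum>k\<le>n. sqrt_coeff k)"
    by (simp add: sum_subtractf)
  also have "(\<Sum>k\<le>n. sqrt_coeff k) = (-1) ^ n * (1/2 - 1 gchoose n)"
    unfolding sqrt_coeff_def by (rule gbinomial_sum_lower_neg)
  also have "2 - \<dots> \<le> 2" using pos[of n] by simp
  finally show "(\<Sum>k\<le>n. \<bar>sqrt_coeff k\<bar>) \<le> 2" .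
qed simp

lemma sqrt_coeff_convolution:
  "(\<Sum>k\<le>n. sqrt_coeff k * sqrt_coeff (n - k)) = (if n = 0 then 1 else if n = 1 then -1 else 0)"
proof -
  have "(\<Sum>k\<le>n. sqrt_coeff k * sqrt_coeff (n - k)) = (\<Sum>k\<le>n. (-1) ^ n * ((1/2 gchoose k) * (1/2 gchoose (n - k))))"
    by (rule sum.cong) (auto simp: sqrt_coeff_def simp flip: power_add)
  also have "\<dots> = (-1) ^ n * (1 gchoose n)"
    using gbinomial_Vandermonde[of "1/2::real" "1/2" n] by (simp flip: sum_distrib_left add: atLeast0AtMost)
  also have "\<dots> = (if n = 0 then 1 else if n = 1 then -1 else 0)"
  proof (cases n)
    case (Suc m)
    have "(1::real) gchoose n = of_nat (1 choose n)" by (simp add: binomial_gbinomial)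
    then show ?thesis using Suc by (cases m) auto
  qed simp
  finally show ?thesis .
qed

text \<open>
  Squaring the series in a scalar form that applies to the moments \<open>c n = \<langle>A\<^sup>n x, x\<rangle>\<close> of an operator:
  the double series is absolutely summable, and it is regrouped along \<open>j + k = n\<close>.
\<close>

lemma sqrt_series_square:
  fixes c :: "nat \<Rightarrow> real"
  assumes c: "\<And>n. \<bar>c n\<bar> \<le> M"
  shows "(\<Sum>j. sqrt_coeff j * (\<Sum>k. sqrt_coeff k * c (j + k))) = c 0 - c 1"
proof -
  let ?a = sqrt_coeff
  have M: "M \<ge> 0" using c[of 0] by linarith
  let ?S = "\<Sum>k. \<bar>?a k\<bar>"
  have "(\<lambda>p. \<bar>?a (fst p)\<bar> * \<bar>?a (snd p)\<bar>) summable_on UNIV \<times> UNIV"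
  proof (rule summable_on_SigmaI)
    have "((\<lambda>k. \<bar>?a k\<bar>) has_sum ?S) UNIV"
      by (rule norm_summable_imp_has_sum) (use summable_sqrt_coeff in \<open>auto simp: summable_sums\<close>)
    then show "((\<lambda>k. \<bar>?a (fst (j, k))\<bar> * \<bar>?a (snd (j, k))\<bar>) has_sum \<bar>?a j\<bar> * ?S) UNIV" for j
      by (simp add: has_sum_cmult_right)
    show "(\<lambda>j. \<bar>?a j\<bar> * ?S) summable_on UNIV"
      using summable_sqrt_coeff by (intro summable_on_cmult_left) (simp add: summable_on_UNIV_nonneg_real_iff)
  qed simp
  then have "(\<lambda>p. M * (\<bar>?a (fst p)\<bar> * \<bar>?a (snd p)\<bar>)) summable_on UNIV \<times> UNIV"
    by (rule summable_on_cmult_right)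
  then have "(\<lambda>p. norm (case p of (j, k) \<Rightarrow> ?a j * ?a k * c (j + k))) summable_on UNIV \<times> UNIV"
    by (rule summable_on_comparison_test)
      (use c in \<open>auto simp: abs_mult mult.commute[of M] intro!: mult_left_mono\<close>)
  then have sm: "(\<lambda>(j, k). ?a j * ?a k * c (j + k)) summable_on UNIV \<times> UNIV"
    by (rule abs_summable_summable)
  have inner: "(\<lambda>k. ?a k * c (j + k)) summable_on UNIV" "summable (\<lambda>k. norm (?a k * c (j + k)))" for j
  proof -
    show 1: "summable (\<lambda>k. norm (?a k * c (j + k)))"
      by (rule summable_comparison_test[OF _ summable_mult[OF summable_sqrt_coeff, of M]])
        (use c M in \<open>auto simp: abs_mult mult.commute[of M] intro!: exI[of _ 0] mult_left_mono\<close>)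
    show "(\<lambda>k. ?a k * c (j + k)) summable_on UNIV" by (rule norm_summable_imp_summable_on[OF 1])
  qed
  have suminf_eq: "(\<Sum>k. f k) = (\<Sum>\<^sub>\<infinity>k. f k)" if "summable (\<lambda>k. norm (f k))" for f :: "nat \<Rightarrow> real"
    using norm_summable_imp_has_sum[OF that summable_sums[OF summable_norm_cancel[OF that]]]
    by (simp add: infsumI)
  have bnd: "\<bar>\<Sum>k. ?a k * c (j + k)\<bar> \<le> M * (\<Sum>k. \<bar>?a k\<bar>)" for j
  proof -
    have "\<bar>\<Sum>k. ?a k * c (j + k)\<bar> \<le> (\<Sum>k. norm (?a k * c (j + k)))"
      using summable_norm[OF inner(2)] by simp
    also have "\<dots> \<le> (\<Sum>k. M * \<bar>?a k\<bar>)"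
      by (rule suminf_le[OF _ inner(2) summable_mult[OF summable_sqrt_coeff]])
        (use c M in \<open>auto simp: abs_mult mult.commute[of M] intro!: mult_left_mono\<close>)
    finally show ?thesis by (simp add: suminf_mult[OF summable_sqrt_coeff])
  qed
  have outer: "summable (\<lambda>j. norm (?a j * (\<Sum>k. ?a k * c (j + k))))"
    by (rule summable_comparison_test[OF _ summable_mult[OF summable_sqrt_coeff, of "M * (\<Sum>k. \<bar>?a k\<bar>)"]])
      (use bnd in \<open>auto simp: abs_mult mult.commute[of "M * _"] intro!: exI[of _ 0] mult_left_mono\<close>)
  have "(\<Sum>j. ?a j * (\<Sum>k. ?a k * c (j + k))) = (\<Sum>\<^sub>\<infinity>j. ?a j * (\<Sum>\<^sub>\<infinity>k. ?a k * c (j + k)))"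
    unfolding suminf_eq[OF outer] by (simp add: suminf_eq[OF inner(2)])
  also have "\<dots> = (\<Sum>\<^sub>\<infinity>j. \<Sum>\<^sub>\<infinity>k. ?a j * ?a k * c (j + k))"
    by (simp add: infsum_cmult_right' mult.assoc)
  also have "\<dots> = (\<Sum>\<^sub>\<infinity>(j, k)\<in>UNIV \<times> UNIV. ?a j * ?a k * c (j + k))"
    by (rule infsum_Sigma'_banach[OF sm])
  also have "\<dots> = (\<Sum>\<^sub>\<infinity>(n, j)\<in>(SIGMA n:UNIV. {..n}). ?a j * ?a (n - j) * c n)"
    by (rule infsum_reindex_bij_witness[where j="\<lambda>(j, k). (j + k, j)" and i="\<lambda>(n, j). (j, n - j)"]) auto
  also have "\<dots> = (\<Sum>\<^sub>\<infinity>n. \<Sum>\<^sub>\<infinity>j\<in>{..n}. ?a j * ?a (n - j) * c n)"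
  proof (rule infsum_Sigma'_banach[symmetric])
    show "(\<lambda>(n, j). ?a j * ?a (n - j) * c n) summable_on (SIGMA n:UNIV. {..n})"
      using sm by (subst summable_on_reindex_bij_witness[where i="\<lambda>(j, k). (j + k, j)" and j="\<lambda>(n, j). (j, n - j)"
          and h="\<lambda>(j, k). ?a j * ?a k * c (j + k)" and T="UNIV \<times> UNIV"]) auto
  qed
  also have "\<dots> = (\<Sum>\<^sub>\<infinity>n. (if n = 0 then 1 else if n = 1 then -1 else 0) * c n)"
    by (simp add: sqrt_coeff_convolution flip: sum_distrib_right)
  also have "\<dots> = (\<Sum>\<^sub>\<infinity>n\<in>{0, 1}. (if n = 0 then 1 else if n = 1 then -1 else 0) * c n)"
    by (rule infsum_cong_neutral) auto
  finally show ?thesis by simp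
qed

text \<open>
  The defect operator \<open>D = (1 - S\<^sup>* S)\<^bsup>1/2\<^esup>\<close>.  Being a series in powers of \<open>S\<^sup>* S\<close>, it commutes with
  every operator that commutes with \<open>S\<close> and \<open>S\<^sup>*\<close>.
\<close>

lemma defect_operator:
  fixes S :: "'h::chilbert_space \<Rightarrow> 'h"
  assumes S: "contraction S"
  obtains D where "contraction D" "\<And>x. (norm (D x))\<^sup>2 = (norm x)\<^sup>2 - (norm (S x))\<^sup>2"
    "\<And>X x. contraction X \<Longrightarrow> (\<And>x. X (S x) = S (X x)) \<Longrightarrow> (\<And>x. X (cadjoint S x) = cadjoint S (X x)) \<Longrightarrow> X (D x) = D (X x)"
proof -
  let ?a = sqrt_coeff
  define A where "A = cadjoint S \<circ> S"
  have adjS: "adj S (cadjoint S)" by (rule contraction_adj_exists[OF S])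
  have A: "contraction A" unfolding A_def by (intro contraction_compose contraction_cadjoint S)
  have Ak: "contraction (A ^^ k)" for k
    by (induction k) (auto simp: contraction_id[unfolded id_def] contraction_compose[OF A, unfolded comp_def] id_def comp_def)
  note Ak_lin = contraction_clinear[OF Ak]
  have adjA: "adj A A" unfolding A_def by (intro adj_compose adjS adj_sym[OF adjS])
  have A_sym: "(A ^^ k) x \<bullet> y = x \<bullet> (A ^^ k) y" for k x y
  proof -
    have "A x \<bullet> y = x \<bullet> A y" for x y
      using adjD[OF adjA, of x y] by (simp flip: Re_cinner)
    then show ?thesis by (induction k arbitrary: x y) (simp_all add: funpow_swap1)
  qed
  have sm: "summable (\<lambda>k. norm (?a k *\<^sub>R (A ^^ k) x))" for x
    by (rule summable_comparison_test[OF _ summable_mult[OF summable_sqrt_coeff, of "norm x"]])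
      (use contraction_norm[OF Ak] in \<open>auto simp: mult.commute[of "norm x"] intro!: exI[of _ 0] mult_left_mono\<close>)
  define D where "D x = (\<Sum>k. ?a k *\<^sub>R (A ^^ k) x)" for x
  have sums: "(\<lambda>k. ?a k *\<^sub>R (A ^^ k) x) sums D x" for x
    unfolding D_def by (rule summable_sums[OF summable_norm_cancel[OF sm]])
  have inner_D: "D x \<bullet> y = (\<Sum>k. ?a k * ((A ^^ k) x \<bullet> y))" for x y
    using bounded_linear.sums[OF bounded_linear_inner_left[of y] sums[of x]] by (simp add: sums_iff)
  have norm_D: "(norm (D x))\<^sup>2 = (norm x)\<^sup>2 - (norm (S x))\<^sup>2" for x
  proof -
    define c where "c n = (A ^^ n) x \<bullet> x" for n
    have c: "\<bar>c n\<bar> \<le> (norm x)\<^sup>2" for n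
    proof -
      have "\<bar>c n\<bar> \<le> norm ((A ^^ n) x) * norm x" unfolding c_def by (rule Cauchy_Schwarz_ineq2)
      also have "\<dots> \<le> norm x * norm x" by (intro mult_right_mono contraction_norm Ak) simp
      finally show ?thesis by (simp add: power2_eq_square)
    qed
    have "D x \<bullet> D x = (\<Sum>j. ?a j * (D x \<bullet> (A ^^ j) x))"
      by (subst inner_D) (simp add: inner_commute)
    also have "\<dots> = (\<Sum>j. ?a j * (\<Sum>k. ?a k * c (j + k)))"
    proof -
      have "(A ^^ k) x \<bullet> (A ^^ j) x = c (j + k)" for j k
        by (simp add: c_def funpow_add A_sym[of j])
      then show ?thesis by (simp add: inner_D)
    qed
    also have "\<dots> = c 0 - c 1" by (rule sqrt_series_square[OF c])
    also have "\<dots> = x \<bullet> x - S x \<bullet> S x"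
    proof -
      have "A x \<bullet> x = S x \<bullet> S x"
        using adjD[OF adj_sym[OF adjS], of "S x" x] by (simp add: A_def flip: Re_cinner)
      then show ?thesis by (simp add: c_def)
    qed
    finally show ?thesis by (simp add: power2_norm_eq_inner)
  qed
  have "clinear D"
  proof (rule clinearI)
    fix x y :: 'h and c
    show "D (x + y) = D x + D y"
      using sums_add[OF sums[of x] sums[of y]]
      by (intro sums_unique2[OF sums]) (simp add: clinear_add[OF Ak_lin] scaleR_add_right)
    show "D (c *\<^sub>C x) = c *\<^sub>C D x"
      using bounded_linear.sums[OF bounded_linear_scaleC[of c] sums[of x]]
      by (intro sums_unique2[OF sums]) (simp add: clinear_scaleC[OF Ak_lin] scaleC_scaleR)
  qed
  moreover have "norm (D x) \<le> norm x" for x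
    by (rule power2_le_imp_le) (simp_all add: norm_D)
  ultimately have "contraction D" by (simp add: contraction_def)
  moreover have "X (D x) = D (X x)"
    if X: "contraction X" and "\<And>x. X (S x) = S (X x)" "\<And>x. X (cadjoint S x) = cadjoint S (X x)" for X x
  proof -
    have "X (A x) = A (X x)" for x using that by (simp add: A_def)
    then have XA: "X ((A ^^ k) x) = (A ^^ k) (X x)" for k x by (rule commute_funpow)
    show ?thesis
      using bounded_linear.sums[OF contraction_bounded_linear[OF X] sums[of x]]
      by (intro sums_unique2[OF _ sums]) (simp add: clinear_scaleR[OF contraction_clinear[OF X]] XA)
  qed
  ultimately show ?thesis using that[OF _ norm_D] by blast
qed

section \<open>Products and sequences of vectors\<close>

instantiation prod :: (chilbert_space, chilbert_space) chilbert_space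
begin

definition scaleC_prod :: "complex \<Rightarrow> 'a \<times> 'b \<Rightarrow> 'a \<times> 'b" where
  "scaleC_prod a z = (a *\<^sub>C fst z, a *\<^sub>C snd z)"
definition cinner_prod :: "'a \<times> 'b \<Rightarrow> 'a \<times> 'b \<Rightarrow> complex" where
  "cinner_prod z w = cinner (fst z) (fst w) + cinner (snd z) (snd w)"

instance
proof
  fix a b :: complex and r :: real and x y z :: "'a \<times> 'b"
  show "a *\<^sub>C (x + y) = a *\<^sub>C x + a *\<^sub>C y"
    by (simp add: scaleC_prod_def scaleC_add_right)
  show "(a + b) *\<^sub>C x = a *\<^sub>C x + b *\<^sub>C x"
    by (simp add: scaleC_prod_def scaleC_add_left)
  show "a *\<^sub>C b *\<^sub>C x = (a * b) *\<^sub>C x"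
    by (simp add: scaleC_prod_def scaleC_scaleC)
  show "complex_of_real r *\<^sub>C x = r *\<^sub>R x"
    by (simp add: scaleC_prod_def scaleC_of_real scaleR_prod_def)
  show "cinner (x + y) z = cinner x z + cinner y z"
    by (simp add: cinner_prod_def cinner_add_left)
  show "cinner (a *\<^sub>C x) y = a * cinner x y"
    by (simp add: cinner_prod_def scaleC_prod_def cinner_scaleC_left distrib_left)
  show "cinner x y = cnj (cinner y x)"
    unfolding cinner_prod_def complex_cnj_add by (intro arg_cong2[of _ _ _ _ "(+)"] cinner_commute)
  show "Re (cinner x y) = x \<bullet> y"
    by (simp add: cinner_prod_def inner_prod_def Re_cinner)
qed

end

lemma scaleC_Pair [simp]: "a *\<^sub>C (x, y) = (a *\<^sub>C x, a *\<^sub>C y)"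
  by (simp add: scaleC_prod_def)

lemma cinner_Pair [simp]: "cinner (x, y) (x', y') = cinner x x' + cinner y y'"
  by (simp add: cinner_prod_def)

lemma norm_Pair_sq: "(norm (x, y))\<^sup>2 = (norm x)\<^sup>2 + (norm y)\<^sup>2"
  by (simp add: norm_Pair)

text \<open>
  The space \<open>'k\<close> plays the role of the direct sum of \<open>'h\<close> and of the square-summable sequences in \<open>'e\<close>:
  \<open>base\<close> and \<open>blk\<close> are the coordinates, and \<open>mk\<close> builds a vector with given coordinates.  For infinite
  \<open>'i\<close> the type \<^typ>\<open>'i ell2\<close> is such a direct sum with \<open>'h\<close> and the factors of \<open>'e\<close> equal to
  \<^typ>\<open>'i ell2\<close> itself, so that dilating does not lead to a new type.
\<close>

locale sequence_model =
  fixes base :: "'k::chilbert_space \<Rightarrow> 'h::chilbert_space"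
    and blk :: "'k \<Rightarrow> nat \<Rightarrow> 'e::chilbert_space"
    and mk :: "'h \<Rightarrow> (nat \<Rightarrow> 'e) \<Rightarrow> 'k"
  assumes clinear_base: "clinear base" and clinear_blk: "clinear (\<lambda>y. blk y j)"
    and norm_sums: "(\<lambda>j. (norm (blk y j))\<^sup>2) sums ((norm y)\<^sup>2 - (norm (base y))\<^sup>2)"
    and base_mk: "summable (\<lambda>j. (norm (x j))\<^sup>2) \<Longrightarrow> base (mk h x) = h"
    and blk_mk: "summable (\<lambda>j. (norm (x j))\<^sup>2) \<Longrightarrow> blk (mk h x) = x"
begin

lemma vec_eqI:
  assumes "base y = base z" "\<And>j. blk y j = blk z j"
  shows "y = z"
proof -
  have "base (y - z) = 0" "\<And>j. blk (y - z) j = 0"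
    using assms clinear_diff[OF clinear_base] clinear_diff[OF clinear_blk] by auto
  then have "(norm (y - z))\<^sup>2 = 0"
    using norm_sums[of "y - z"] by (simp add: sums_iff)
  then show ?thesis by simp
qed

lemma summable_blk: "summable (\<lambda>j. (norm (blk y j))\<^sup>2)"
  using norm_sums by (simp add: sums_iff)

lemma inner_sums: "(\<lambda>j. blk y j \<bullet> blk z j) sums (y \<bullet> z - base y \<bullet> base z)"
proof -
  have "(\<lambda>j. (norm (blk y j + blk z j))\<^sup>2 - (norm (blk y j - blk z j))\<^sup>2) sums
      (((norm (y + z))\<^sup>2 - (norm (base y + base z))\<^sup>2) - ((norm (y - z))\<^sup>2 - (norm (base y - base z))\<^sup>2))"
    using sums_diff[OF norm_sums[of "y + z"] norm_sums[of "y - z"]]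
    by (simp only: clinear_add[OF clinear_blk] clinear_add[OF clinear_base]
        clinear_diff[OF clinear_blk] clinear_diff[OF clinear_base])
  also have "((norm (y + z))\<^sup>2 - (norm (base y + base z))\<^sup>2) - ((norm (y - z))\<^sup>2 - (norm (base y - base z))\<^sup>2)
      = 4 * (y \<bullet> z - base y \<bullet> base z)"
    using inner_polarization[of y z] inner_polarization[of "base y" "base z"] by argo
  finally have "(\<lambda>j. 4 * (blk y j \<bullet> blk z j)) sums (4 * (y \<bullet> z - base y \<bullet> base z))"
    by (simp only: inner_polarization)
  from sums_mult[OF this, of "1/4"] show ?thesis by (simp add: right_diff_distrib diff_divide_distrib)
qed

definition embed :: "'h \<Rightarrow> 'k" where "embed h = mk h (\<lambda>_. 0)"

lemma base_embed [simp]: "base (embed h) = h" and blk_embed [simp]: "blk (embed h) j = 0"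
  by (simp_all add: embed_def base_mk blk_mk)

lemma isometry_embed: "isometry embed"
  unfolding isometry_def
proof (intro conjI allI clinearI)
  show "embed (x + y) = embed x + embed y" for x y
    by (rule vec_eqI) (simp_all add: clinear_add[OF clinear_base] clinear_add[OF clinear_blk])
  show "embed (c *\<^sub>C x) = c *\<^sub>C embed x" for x c
    by (rule vec_eqI) (simp_all add: clinear_scaleC[OF clinear_base] clinear_scaleC[OF clinear_blk])
  show "norm (embed h) = norm h" for h
    using norm_sums[of "embed h"] by (simp add: sums_iff)
qed

lemma cinner_embed: "cinner y (embed h) = cinner (base y) h"
proof (rule cinner_eq_from_inner)
  show "(a *\<^sub>C y) \<bullet> embed h = (a *\<^sub>C base y) \<bullet> h" for a
    using inner_sums[of "a *\<^sub>C y" "embed h"] by (simp add: sums_iff clinear_scaleC[OF clinear_base])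
qed

definition lift :: "('h \<Rightarrow> 'h) \<Rightarrow> ('e \<Rightarrow> 'e) \<Rightarrow> 'k \<Rightarrow> 'k" where
  "lift X Y y = mk (X (base y)) (\<lambda>j. Y (blk y j))"

context
  fixes X :: "'h \<Rightarrow> 'h" and Y :: "'e \<Rightarrow> 'e"
  assumes X: "contraction X" and Y: "contraction Y"
begin

lemma lift_summable: "summable (\<lambda>j. (norm (Y (blk y j)))\<^sup>2)"
  by (rule summable_comparison_test[OF _ summable_blk[of y]])
    (use contraction_norm[OF Y] in \<open>auto intro!: exI[of _ 0] power_mono\<close>)

lemma base_lift: "base (lift X Y y) = X (base y)" and blk_lift: "blk (lift X Y y) j = Y (blk y j)"
  using lift_summable by (simp_all add: lift_def base_mk blk_mk)

lemma clinear_lift: "clinear (lift X Y)"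
proof (rule clinearI)
  note lin = contraction_clinear[OF X] contraction_clinear[OF Y] clinear_base clinear_blk
  show "lift X Y (y + z) = lift X Y y + lift X Y z" for y z
    by (rule vec_eqI) (simp_all add: base_lift blk_lift lin[THEN clinear_add])
  show "lift X Y (c *\<^sub>C y) = c *\<^sub>C lift X Y y" for c y
    by (rule vec_eqI) (simp_all add: base_lift blk_lift lin[THEN clinear_scaleC])
qed

lemma lift_embed: "lift X Y (embed h) = embed (X h)"
  by (rule vec_eqI) (simp_all add: base_lift blk_lift clinear_0[OF contraction_clinear[OF Y]])

end

lemma isometry_lift:
  assumes "isometry X" "isometry Y"
  shows "isometry (lift X Y)"
proof -
  note c = assms[THEN isometry_contraction]
  have "norm (lift X Y y) = norm y" for y
  proof -
    have "(\<lambda>j. (norm (blk y j))\<^sup>2) sums ((norm (lift X Y y))\<^sup>2 - (norm (base y))\<^sup>2)"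
      using norm_sums[of "lift X Y y"] assms by (simp add: base_lift[OF c] blk_lift[OF c] isometry_def)
    from sums_unique2[OF this norm_sums[of y]] show ?thesis by simp
  qed
  then show ?thesis using clinear_lift[OF c] by (simp add: isometry_def)
qed

lemma lift_commute:
  assumes "contraction X" "contraction Q" "contraction X'" "contraction Q'"
    and "\<And>h. X (X' h) = X' (X h)" "\<And>v. Q (Q' v) = Q' (Q v)"
  shows "lift X Q (lift X' Q' y) = lift X' Q' (lift X Q y)"
  by (rule vec_eqI) (simp_all add: base_lift blk_lift assms)

lemma adj_lift:
  assumes "contraction X" "contraction Y" "contraction X'" "contraction Y'" "adj X X'" "adj Y Y'"
  shows "adj (lift X Y) (lift X' Y')"
  unfolding adj_def
proof (intro allI cinner_eq_from_inner)
  fix y z a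
  note l = base_lift[OF assms(1,2)] blk_lift[OF assms(1,2)] base_lift[OF assms(3,4)] blk_lift[OF assms(3,4)]
  have "X h \<bullet> g = h \<bullet> X' g" for h g using adjD[OF assms(5)] by (simp flip: Re_cinner)
  moreover have "Y h \<bullet> g = h \<bullet> Y' g" for h g using adjD[OF assms(6)] by (simp flip: Re_cinner)
  ultimately have "(\<lambda>j. Y (blk y j) \<bullet> blk z j) sums (lift X Y y \<bullet> z - X (base y) \<bullet> base z)"
    "(\<lambda>j. Y (blk y j) \<bullet> blk z j) sums (y \<bullet> lift X' Y' z - X (base y) \<bullet> base z)" for y z
    using inner_sums[of "lift X Y y" z] inner_sums[of y "lift X' Y' z"] unfolding l by (simp_all only:)
  from sums_unique2[OF this] have "lift X Y y \<bullet> z = y \<bullet> lift X' Y' z" for y z by simp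
  then show "(a *\<^sub>C lift X Y y) \<bullet> z = (a *\<^sub>C y) \<bullet> lift X' Y' z"
    by (simp flip: clinear_scaleC[OF clinear_lift[OF assms(1,2)]])
qed

end

section \<open>Square-summable families of blocks inside an infinite-dimensional space\<close>

lemma countable_times_infinite_bij:
  assumes "infinite (UNIV :: 'i set)"
  obtains \<beta> :: "'s::countable \<times> 'i \<Rightarrow> 'i" where "bij \<beta>"
proof -
  obtain f :: "nat \<Rightarrow> 'i" where f: "inj f"
    using infinite_countable_subset[OF assms] by blast
  have "inj_on (f \<circ> to_nat :: 's \<Rightarrow> 'i) UNIV"
    using f inj_to_nat by (blast intro: inj_compose)
  then have inj: "\<exists>g :: 's \<Rightarrow> 'i. inj_on g UNIV \<and> range g \<subseteq> UNIV" by blast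
  have "\<exists>\<beta>. bij_betw \<beta> (UNIV \<times> UNIV :: ('s \<times> 'i) set) (UNIV :: 'i set)"
    by (rule iffD2[OF card_of_ordIso, OF conjunct2[OF card_of_Times_infinite[OF assms UNIV_not_empty
          iffD1[OF card_of_ordLeq inj]]]])
  then show ?thesis using that by auto
qed

text \<open>
  A bijection between \<open>'s \<times> 'i\<close> and \<open>'i\<close> cuts the coordinates of a vector into \<open>'s\<close> many vectors of the
  same space.
\<close>

lemma ell2_split:
  fixes \<beta> :: "'s \<times> 'i \<Rightarrow> 'i"
  assumes "bij \<beta>"
  obtains part :: "'s \<Rightarrow> 'i ell2 \<Rightarrow> 'i ell2" and join
  where "\<And>s. clinear (part s)"
    "\<And>y. ((\<lambda>s. (norm (part s y))\<^sup>2) has_sum (norm y)\<^sup>2) UNIV"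
    "\<And>z s. (\<lambda>s. (norm (z s))\<^sup>2) summable_on UNIV \<Longrightarrow> part s (join z) = z s"
proof -
  have Rep: "(\<lambda>i. (cmod (Rep_ell2 y i))\<^sup>2) summable_on UNIV" for y :: "'i ell2"
    using Rep_ell2[of y] by simp
  have Rep_sum: "((\<lambda>i. (cmod (Rep_ell2 y i))\<^sup>2) has_sum (norm y)\<^sup>2) UNIV" for y :: "'i ell2"
    unfolding norm_ell2_sq by (rule has_sum_infsum[OF Rep])
  define part where "part s y = Abs_ell2 (\<lambda>i. Rep_ell2 y (\<beta> (s, i)))" for s y
  define join where "join z = Abs_ell2 (\<lambda>i. case inv \<beta> i of (s, j) \<Rightarrow> Rep_ell2 (z s) j)" for z :: "'s \<Rightarrow> 'i ell2"
  have inj: "inj (\<lambda>i. \<beta> (s, i))" for s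
    using assms by (auto simp: inj_on_def bij_def)
  have Rep_part: "Rep_ell2 (part s y) = (\<lambda>i. Rep_ell2 y (\<beta> (s, i)))" for s y
  proof -
    have "(\<lambda>i. (cmod (Rep_ell2 y (\<beta> (s, i))))\<^sup>2) summable_on UNIV"
      using summable_on_subset_banach[OF Rep[of y], of "range (\<lambda>i. \<beta> (s, i))"]
      by (simp add: summable_on_reindex[OF inj] o_def)
    then show ?thesis unfolding part_def by (intro Abs_ell2_inverse) simp
  qed
  have "clinear (part s)" for s
    by (rule clinearI)
      (auto simp: Rep_part plus_ell2.rep_eq scaleC_ell2.rep_eq fun_eq_iff simp flip: Rep_ell2_inject)
  moreover have "((\<lambda>s. (norm (part s y))\<^sup>2) has_sum (norm y)\<^sup>2) UNIV" for y
  proof (rule has_sum_SigmaD)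
    show "((\<lambda>p. (cmod (Rep_ell2 y (\<beta> p)))\<^sup>2) has_sum (norm y)\<^sup>2) (UNIV \<times> UNIV)"
      using has_sum_reindex_bij_betw[of \<beta> UNIV UNIV "\<lambda>i. (cmod (Rep_ell2 y i))\<^sup>2"] assms Rep_sum[of y] by simp
    show "((\<lambda>i. (cmod (Rep_ell2 y (\<beta> (s, i))))\<^sup>2) has_sum (norm (part s y))\<^sup>2) UNIV" for s
      using Rep_sum[of "part s y"] by (simp add: Rep_part)
  qed
  moreover have "part s (join z) = z s" if z: "(\<lambda>s. (norm (z s))\<^sup>2) summable_on UNIV" for z s
  proof -
    have "(\<lambda>p. (cmod (Rep_ell2 (z (fst p)) (snd p)))\<^sup>2) summable_on UNIV \<times> UNIV"
      by (rule summable_on_SigmaI[OF _ z]) (use Rep_sum in auto)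
    then have "(\<lambda>i. (cmod (case inv \<beta> i of (s, j) \<Rightarrow> Rep_ell2 (z s) j))\<^sup>2) summable_on UNIV"
      using summable_on_reindex_bij_betw[OF bij_imp_bij_inv[OF assms], of "\<lambda>p. (cmod (Rep_ell2 (z (fst p)) (snd p)))\<^sup>2"]
      by (simp add: case_prod_unfold)
    then have "Rep_ell2 (join z) = (\<lambda>i. case inv \<beta> i of (s, j) \<Rightarrow> Rep_ell2 (z s) j)"
      unfolding join_def by (intro Abs_ell2_inverse) simp
    then have "Rep_ell2 (part s (join z)) = Rep_ell2 (z s)"
      using assms by (simp add: Rep_part inv_f_f bij_is_inj)
    then show ?thesis by (simp add: Rep_ell2_inject)
  qed
  ultimately show ?thesis by (rule that)
qed

lemma ell2_pair_iso:
  assumes "infinite (UNIV :: 'i set)"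
  obtains q :: "'i ell2 \<Rightarrow> 'i ell2 \<times> 'i ell2" and r
  where "isometry q" "\<And>z. q (r z) = z"
proof -
  obtain \<beta> :: "bool \<times> 'i \<Rightarrow> 'i" where \<beta>: "bij \<beta>" by (rule countable_times_infinite_bij[OF assms])
  obtain part :: "bool \<Rightarrow> 'i ell2 \<Rightarrow> 'i ell2" and join
    where p: "\<And>s. clinear (part s)" "\<And>y. ((\<lambda>s. (norm (part s y))\<^sup>2) has_sum (norm y)\<^sup>2) UNIV"
    "\<And>z s. (\<lambda>s. (norm (z s))\<^sup>2) summable_on UNIV \<Longrightarrow> part s (join z) = z s"
    by (rule ell2_split[OF \<beta>]) blast
  show ?thesis
  proof (rule that)
    have norm: "(norm y)\<^sup>2 = (norm (part False y))\<^sup>2 + (norm (part True y))\<^sup>2" for y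
      using has_sum_unique[OF p(2)[of y] has_sum_finite] by (simp add: UNIV_bool)
    then show "isometry (\<lambda>y. (part False y, part True y))"
      by (simp add: isometry_def clinear_def clinear_add[OF p(1)] clinear_scaleC[OF p(1)] norm_Pair flip: norm)
    show "(part False (join (\<lambda>s. if s then snd z else fst z)), part True (join (\<lambda>s. if s then snd z else fst z))) = z" for z
      by (simp add: p(3))
  qed
qed

lemma ell2_sequence_model:
  assumes "infinite (UNIV :: 'i set)"
  obtains base :: "'i ell2 \<Rightarrow> 'i ell2" and blk :: "'i ell2 \<Rightarrow> nat \<Rightarrow> ('i ell2 \<times> 'i ell2) \<times> ('i ell2 \<times> 'i ell2)" and mk
  where "sequence_model base blk mk"
proof -
  obtain \<beta> :: "nat \<times> 'i \<Rightarrow> 'i" where \<beta>: "bij \<beta>" by (rule countable_times_infinite_bij[OF assms])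
  obtain part :: "nat \<Rightarrow> 'i ell2 \<Rightarrow> 'i ell2" and join
    where p: "\<And>s. clinear (part s)" "\<And>y. ((\<lambda>s. (norm (part s y))\<^sup>2) has_sum (norm y)\<^sup>2) UNIV"
    "\<And>z s. (\<lambda>s. (norm (z s))\<^sup>2) summable_on UNIV \<Longrightarrow> part s (join z) = z s"
    by (rule ell2_split[OF \<beta>]) blast
  obtain q :: "'i ell2 \<Rightarrow> 'i ell2 \<times> 'i ell2" and r where q: "isometry q" "\<And>z. q (r z) = z"
    by (rule ell2_pair_iso[OF assms]) blast
  define Q where "Q y = map_prod q q (q y)" for y
  define R where "R z = r (map_prod r r z)" for z
  have QR: "Q (R z) = z" for z
    by (cases z) (simp add: Q_def R_def q(2))
  have qn: "norm (q y) = norm y" and ql: "clinear q" for y using q(1) by (auto simp: isometry_def)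
  have Qn: "norm (Q y) = norm y" for y
  proof -
    have "norm (map_prod q q z) = norm z" for z by (cases z) (simp add: norm_Pair qn)
    then show ?thesis by (simp add: Q_def qn)
  qed
  have Rn: "norm (R z) = norm z" for z using Qn[of "R z"] QR by simp
  have Ql: "clinear Q"
  proof (rule clinearI)
    have "map_prod q q (z + w) = map_prod q q z + map_prod q q w" for z w
      by (cases z; cases w) (simp add: clinear_add[OF ql])
    then show "Q (x + y) = Q x + Q y" for x y by (simp add: Q_def clinear_add[OF ql])
    have "map_prod q q (c *\<^sub>C z) = c *\<^sub>C map_prod q q z" for z c
      by (cases z) (simp add: clinear_scaleC[OF ql])
    then show "Q (c *\<^sub>C x) = c *\<^sub>C Q x" for c x by (simp add: Q_def clinear_scaleC[OF ql])
  qed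
  have summ: "(\<lambda>s. (norm (case_nat h (\<lambda>j. R (x j)) s))\<^sup>2) summable_on UNIV"
    if "summable (\<lambda>j. (norm (x j))\<^sup>2)" for h x
    using that by (simp add: summable_on_UNIV_nonneg_real_iff Rn flip: summable_Suc_iff[of "\<lambda>s. (norm (case_nat h (\<lambda>j. R (x j)) s))\<^sup>2"])
  have "sequence_model (part 0) (\<lambda>y j. Q (part (Suc j) y)) (\<lambda>h x. join (case_nat h (\<lambda>j. R (x j))))"
  proof
    show "clinear (part 0)" by (rule p(1))
    show "clinear (\<lambda>y. Q (part (Suc j) y))" for j
      using clinear_compose[OF Ql p(1)] by (simp add: comp_def)
    show "(\<lambda>j. (norm (Q (part (Suc j) y)))\<^sup>2) sums ((norm y)\<^sup>2 - (norm (part 0 y))\<^sup>2)" for y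
      using has_sum_imp_sums[OF p(2)[of y]] by (simp add: Qn sums_Suc_iff[of "\<lambda>s. (norm (part s y))\<^sup>2"])
    show "part 0 (join (case_nat h (\<lambda>j. R (x j)))) = h" if "summable (\<lambda>j. (norm (x j))\<^sup>2)" for h x
      using p(3)[OF summ[OF that]] by simp
    show "(\<lambda>j. Q (part (Suc j) (join (case_nat h (\<lambda>j. R (x j)))))) = x" if "summable (\<lambda>j. (norm (x j))\<^sup>2)" for h x
      using p(3)[OF summ[OF that]] by (simp add: QR)
  qed
  then show ?thesis by (rule that)
qed

section \<open>Block shifts\<close>

text \<open>
  Operators of the form \<open>y \<mapsto> C y\<^sub>0 \<oplus> Z (P + P' s) Y y\<close>, where \<open>s\<close> is the unilateral shift of the blocks
  with \<open>d y\<^sub>0\<close> entering in position \<open>0\<close>.  When \<open>P\<close> and \<open>P'\<close> are complementary projections, half of every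
  block is shifted.  Both factors of Ando's dilation are of this kind.
\<close>

locale block_shift = sequence_model base blk mk
  for base :: "'k::chilbert_space \<Rightarrow> 'h::chilbert_space"
    and blk :: "'k \<Rightarrow> nat \<Rightarrow> 'e::chilbert_space" and mk +
  fixes C :: "'h \<Rightarrow> 'h" and d :: "'h \<Rightarrow> 'e" and Y Z P P' :: "'e \<Rightarrow> 'e"
  assumes C: "clinear C" and d: "clinear d" and Y: "isometry Y" and Z: "isometry Z"
    and P: "clinear P" "clinear P'"
    and orth: "\<And>v w. (norm (P v + P' w))\<^sup>2 = (norm (P v))\<^sup>2 + (norm (P' w))\<^sup>2"
    and split: "\<And>v. (norm (P v))\<^sup>2 + (norm (P' v))\<^sup>2 = (norm v)\<^sup>2"
    and defect: "\<And>h. (norm (C h))\<^sup>2 + (norm (P' (d h)))\<^sup>2 = (norm h)\<^sup>2"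
begin

definition shift :: "'k \<Rightarrow> 'k" where
  "shift y = mk (C (base y))
     (\<lambda>j. Z (P (Y (blk y j)) + P' (case j of 0 \<Rightarrow> d (base y) | Suc i \<Rightarrow> Y (blk y i))))"

lemma shift_sums:
  "(\<lambda>j. (norm (Z (P (Y (blk y j)) + P' (case j of 0 \<Rightarrow> d (base y) | Suc i \<Rightarrow> Y (blk y i)))))\<^sup>2)
     sums ((norm y)\<^sup>2 - (norm (base y))\<^sup>2 + (norm (P' (d (base y))))\<^sup>2)"
proof -
  let ?s = "\<lambda>j. case j of 0 \<Rightarrow> d (base y) | Suc i \<Rightarrow> Y (blk y i)"
  have nY: "norm (Y v) = norm v" and nZ: "norm (Z v) = norm v" for v
    using Y Z by (auto simp: isometry_def)
  have le: "(norm (P v))\<^sup>2 \<le> (norm v)\<^sup>2" "(norm (P' v))\<^sup>2 \<le> (norm v)\<^sup>2" for v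
    using split[of v] zero_le_power2[of "norm (P v)"] zero_le_power2[of "norm (P' v)"] by linarith+
  have sm: "summable (\<lambda>j. (norm (P (Y (blk y j))))\<^sup>2)" "summable (\<lambda>j. (norm (P' (Y (blk y j))))\<^sup>2)"
    by (rule summable_comparison_test[OF _ summable_blk[of y]];
        use le[of "Y _"] in \<open>auto simp: nY intro!: exI[of _ 0]\<close>)+
  have "(\<lambda>j. (norm (P' (?s (Suc j))))\<^sup>2) sums (\<Sum>j. (norm (P' (Y (blk y j))))\<^sup>2)"
    using sm(2) by (simp add: summable_sums)
  then have 1: "(\<lambda>j. (norm (P' (?s j)))\<^sup>2) sums ((\<Sum>j. (norm (P' (Y (blk y j))))\<^sup>2) + (norm (P' (d (base y))))\<^sup>2)"
    unfolding sums_Suc_iff[of "\<lambda>j. (norm (P' (?s j)))\<^sup>2"] by simp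
  have "(\<lambda>j. (norm (P (Y (blk y j))))\<^sup>2 + (norm (P' (Y (blk y j))))\<^sup>2) sums
      ((\<Sum>j. (norm (P (Y (blk y j))))\<^sup>2) + (\<Sum>j. (norm (P' (Y (blk y j))))\<^sup>2))"
    by (intro sums_add summable_sums sm)
  then have 2: "(\<Sum>j. (norm (P (Y (blk y j))))\<^sup>2) + (\<Sum>j. (norm (P' (Y (blk y j))))\<^sup>2) = (norm y)\<^sup>2 - (norm (base y))\<^sup>2"
    using sums_unique2[OF norm_sums[of y]] by (simp add: split nY)
  have "(\<lambda>j. (norm (P (Y (blk y j))))\<^sup>2 + (norm (P' (?s j)))\<^sup>2) sums
      ((\<Sum>j. (norm (P (Y (blk y j))))\<^sup>2) + ((\<Sum>j. (norm (P' (Y (blk y j))))\<^sup>2) + (norm (P' (d (base y))))\<^sup>2))"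
    by (intro sums_add summable_sums sm 1)
  then show ?thesis by (simp only: nZ orth flip: 2 add.assoc)
qed

lemma base_shift: "base (shift y) = C (base y)"
  and blk_shift: "blk (shift y) j = Z (P (Y (blk y j)) + P' (case j of 0 \<Rightarrow> d (base y) | Suc i \<Rightarrow> Y (blk y i)))"
  using shift_sums[of y] by (simp_all add: shift_def base_mk blk_mk sums_iff)

lemma isometry_shift: "isometry shift"
  unfolding isometry_def
proof (intro conjI allI clinearI)
  have Yl: "clinear Y" and Zl: "clinear Z" using Y Z by (auto simp: isometry_def)
  note lin = C d Yl Zl P clinear_base clinear_blk
  show "shift (x + y) = shift x + shift y" for x y
    by (rule vec_eqI) (simp_all add: base_shift blk_shift lin[THEN clinear_add] algebra_simps split: nat.split)
  show "shift (c *\<^sub>C y) = c *\<^sub>C shift y" for c y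
    by (rule vec_eqI)
      (simp_all add: base_shift blk_shift lin[THEN clinear_scaleC] lin[THEN clinear_add]
        scaleC_add_right split: nat.split)
  fix y
  have "(norm (shift y))\<^sup>2 - (norm (C (base y)))\<^sup>2 = (norm y)\<^sup>2 - (norm (base y))\<^sup>2 + (norm (P' (d (base y))))\<^sup>2"
    using sums_unique2[OF norm_sums[of "shift y", unfolded base_shift blk_shift] shift_sums[of y]] .
  then have "(norm (shift y))\<^sup>2 = (norm y)\<^sup>2" using defect[of "base y"] by linarith
  then show "norm (shift y) = norm y" by simp
qed

lemma cadjoint_shift_embed:
  assumes "adj C C'"
  shows "cadjoint shift (embed h) = embed (C' h)"
proof (rule cinner_eqI)
  fix z
  have "cinner z (cadjoint shift (embed h)) = cinner (shift z) (embed h)"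
    using adjD[OF contraction_adj_exists[OF isometry_contraction[OF isometry_shift]]] by simp
  then show "cinner z (cadjoint shift (embed h)) = cinner z (embed (C' h))"
    by (simp add: cinner_embed base_shift adjD[OF assms])
qed

lemma lift_shift_commute:
  assumes "contraction X" "contraction Q"
    and "\<And>h. X (C h) = C (X h)" "\<And>h. Q (d h) = d (X h)"
    and "\<And>v. Q (Y v) = Y (Q v)" "\<And>v. Q (Z v) = Z (Q v)" "\<And>v. Q (P v) = P (Q v)" "\<And>v. Q (P' v) = P' (Q v)"
  shows "lift X Q (shift y) = shift (lift X Q y)"
  by (rule vec_eqI)
    (simp_all add: base_lift[OF assms(1,2)] blk_lift[OF assms(1,2)] base_shift blk_shift assms(3-)
      clinear_add[OF contraction_clinear[OF assms(2)]] split: nat.split)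

end

section \<open>A functorial form of Ando's dilation\<close>

abbreviation amplify :: "('a \<Rightarrow> 'b) \<Rightarrow> 'a \<times> 'a \<Rightarrow> 'b \<times> 'b" where
  "amplify X \<equiv> map_prod X X"

lemma clinear_amplify: "clinear X \<Longrightarrow> clinear (amplify X)"
  by (auto simp: clinear_def)

lemma contraction_amplify: "contraction X \<Longrightarrow> contraction (amplify X)"
  by (auto simp: contraction_def clinear_amplify norm_Pair intro!: real_sqrt_le_mono add_mono power_mono)

lemma isometry_amplify: "isometry X \<Longrightarrow> isometry (amplify X)"
  by (auto simp: isometry_def clinear_amplify norm_Pair)

lemma adj_amplify: "adj X X' \<Longrightarrow> adj (amplify X) (amplify X')"
  by (auto simp: adj_def)

text \<open>
  Two linear images \<open>a h\<close> and \<open>b h\<close> of equal norm define a partial isometry \<open>u\<close> with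
  \<open>u (a h) = b h\<close>.  It need not extend to a unitary of \<open>'b\<close>, but its Halmos block matrix
  \<open>(u, 1 - u u\<^sup>*; 1 - u\<^sup>* u, u\<^sup>*)\<close> is a unitary of \<open>'b \<times> 'b\<close> that extends \<open>u\<close> on the vectors \<open>(a h, 0)\<close>.
  All entries are built from \<open>u\<close>, so an operator that respects \<open>a\<close> and \<open>b\<close> together with its adjoint
  passes through the construction.
\<close>

lemma julia_unitary:
  fixes a b :: "'h::chilbert_space \<Rightarrow> 'b::chilbert_space"
  assumes a: "clinear a" and b: "clinear b" and eq: "\<And>h. norm (a h) = norm (b h)"
  obtains U U' :: "'b \<times> 'b \<Rightarrow> 'b \<times> 'b" where
    "isometry U" "isometry U'" "\<And>z. U (U' z) = z" "\<And>z. U' (U z) = z" "\<And>h. U (a h, 0) = (b h, 0)"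
    "\<And>Q Q' X X' z. contraction Q \<Longrightarrow> contraction Q' \<Longrightarrow> adj Q Q' \<Longrightarrow>
       (\<And>h. Q (a h) = a (X h)) \<Longrightarrow> (\<And>h. Q (b h) = b (X h)) \<Longrightarrow>
       (\<And>h. Q' (a h) = a (X' h)) \<Longrightarrow> (\<And>h. Q' (b h) = b (X' h)) \<Longrightarrow>
       amplify Q (U z) = U (amplify Q z) \<and> amplify Q (U' z) = U' (amplify Q z)"
proof -
  have span: "\<exists>z. a z = a x + a y \<and> b z = b x + b y" "\<exists>z. a z = c *\<^sub>C a x \<and> b z = c *\<^sub>C b x" for x y c
    by (metis clinear_add[OF a] clinear_add[OF b]) (metis clinear_scaleC[OF a] clinear_scaleC[OF b])
  have span_a: "\<exists>z. a z = a x + a y" "\<exists>z. a z = c *\<^sub>C a x" for x y c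
    using span by metis+
  obtain u where u: "contraction u" "\<And>h. u (a h) = b h" "\<And>m. (\<And>h. cinner (a h) m = 0) \<Longrightarrow> u m = 0"
    by (rule contraction_extension[OF span]) (auto simp: eq)
  define us where "us = cadjoint u"
  have adj_u: "adj u us" and us: "contraction us"
    unfolding us_def by (rule contraction_adj_exists[OF u(1)] contraction_cadjoint[OF u(1)])+
  have us_b: "us (b h) = a h" for h
  proof -
    have "us (b h) \<bullet> a h = (norm (a h))\<^sup>2"
      using adjD[OF adj_sym[OF adj_u], of "b h" "a h"]
      by (simp add: u(2) eq power2_norm_eq_inner flip: Re_cinner)
    moreover have "(norm (us (b h)))\<^sup>2 \<le> (norm (a h))\<^sup>2"
      using contraction_norm[OF us, of "b h"] by (simp add: eq power_mono)
    ultimately have "(norm (us (b h) - a h))\<^sup>2 \<le> 0"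
      by (simp add: power2_norm_eq_inner inner_diff inner_commute)
    then show ?thesis by simp
  qed
  note lin = contraction_clinear[OF u(1)] contraction_clinear[OF us]
  have "u \<circ> us \<circ> u = u"
  proof (rule contractions_eqI[of a, OF span_a])
    show "(u \<circ> us \<circ> u) m = u m" if "\<And>h. cinner (a h) m = 0" for m
      using u(3)[OF that] by (simp add: lin[THEN clinear_0])
  qed (auto simp: u(2) us_b intro!: contraction_bounded_linear contraction_compose u(1) us)
  then have uuu: "u (us (u x)) = u x" for x by (simp add: fun_eq_iff)
  have uuu': "us (u (us y)) = us y" for y
    by (rule cinner_eqI) (simp add: uuu flip: adjD[OF adj_u] adjD[OF adj_sym[OF adj_u]])
  define U where "U = (\<lambda>(x, y). (u x + (y - u (us y)), (x - us (u x)) + us y))"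
  define U' where "U' = (\<lambda>(x, y). (us x + (y - us (u y)), (x - u (us x)) + u y))"
  note alg = lin[THEN clinear_add] lin[THEN clinear_diff] uuu uuu'
  have UU': "U (U' z) = z" and U'U: "U' (U z) = z" for z
    by (cases z; simp add: U_def U'_def alg)+
  have Ul: "clinear U" and U'l: "clinear U'"
    by (auto simp: clinear_def U_def U'_def lin[THEN clinear_add] lin[THEN clinear_scaleC]
        scaleC_add_right scaleC_diff_right)
  have "adj U U'"
    by (auto simp: adj_def U_def U'_def cinner_add_left cinner_add_right cinner_diff_left cinner_diff_right
        adjD[OF adj_u] adjD[OF adj_sym[OF adj_u]])
  then have "cinner (U z) (U z) = cinner z z" "cinner (U' z) (U' z) = cinner z z" for z
    using adjD[of U U'] adjD[OF adj_sym, of U U'] by (simp_all add: UU' U'U)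
  then have n: "norm (U z) = norm z" "norm (U' z) = norm z" for z
    by (simp_all add: cinner_self flip: of_real_power)
  have comm: "amplify Q (U z) = U (amplify Q z) \<and> amplify Q (U' z) = U' (amplify Q z)"
    if Q: "contraction Q" "contraction Q'" "adj Q Q'"
      and "\<And>h. Q (a h) = a (X h)" "\<And>h. Q (b h) = b (X h)" "\<And>h. Q' (a h) = a (X' h)" "\<And>h. Q' (b h) = b (X' h)"
    for Q Q' X X' z
  proof -
    have "u (Q x) = Q (u x)"
      if Q: "contraction Q" "adj Q Q'" and "\<And>h. Q (a h) = a (X h)" "\<And>h. Q (b h) = b (X h)" "\<And>h. Q' (a h) = a (X' h)"
      for Q Q' X X' x
    proof -
      have "u \<circ> Q = Q \<circ> u"
      proof (rule contractions_eqI[of a, OF span_a])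
        show "(u \<circ> Q) m = (Q \<circ> u) m" if m: "\<And>h. cinner (a h) m = 0" for m
        proof -
          have "cinner (a h) (Q m) = 0" for h
            using adjD[OF adj_sym[OF Q(2)], of "a h" m] \<open>\<And>h. Q' (a h) = a (X' h)\<close> m by simp
          then show ?thesis
            using u(3)[OF m] u(3)[of "Q m"] by (simp add: clinear_0[OF contraction_clinear[OF Q(1)]])
        qed
      qed (use that in \<open>auto simp: u(2) intro!: contraction_bounded_linear contraction_compose u(1)\<close>)
      then show ?thesis by (simp add: fun_eq_iff)
    qed
    then have uQ: "u (Q x) = Q (u x)" and uQ': "u (Q' x) = Q' (u x)" for x
      using that adj_sym[OF Q(3)] by blast+
    have usQ: "us (Q x) = Q (us x)" for x
      by (rule adj_commute[OF adj_u adj_sym[OF Q(3)] uQ'])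
    show ?thesis
      using contraction_clinear[OF Q(1)]
      by (cases z) (simp add: U_def U'_def uQ usQ clinear_add clinear_diff)
  qed
  show ?thesis
  proof (rule that[OF _ _ UU' U'U _ comm])
    show "isometry U" "isometry U'" using Ul U'l n by (auto simp: isometry_def)
    show "U (a h, 0) = (b h, 0)" for h
      by (simp add: U_def u(2) us_b lin[THEN clinear_0])
  qed
qed

text \<open>
  Let \<open>DS\<close> and \<open>DR\<close> be the defect operators.  The vectors \<open>a h = (DS h, DR (S h))\<close> and
  \<open>b h = (DS (R h), DR h)\<close> have the same norm, since both squared norms are \<open>\<parallel>h\<parallel>\<^sup>2 - \<parallel>S R h\<parallel>\<^sup>2\<close>; let \<open>U\<close> be a
  unitary taking \<open>(a h, 0)\<close> to \<open>(b h, 0)\<close>.  With \<open>s\<close> the shift of the blocks, \<open>W1\<close> acts on blocks as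
  \<open>(P2 + P1 s) U\<^sup>*\<close> and \<open>W2\<close> as \<open>U (P1 + P2 s)\<close>, the symbols of Berger, Coburn and Lebow for a
  factorization of \<open>s\<close>: in both orders the product is \<open>s\<close>.  The vector entering the blocks is
  \<open>(b h, 0)\<close> for \<open>W1 W2\<close> and \<open>U (a h, 0)\<close> for \<open>W2 W1\<close>.
  
  Nothing is chosen beyond \<open>S\<close> and \<open>R\<close>, so operators that, along with their adjoints, commute with \<open>S\<close> and
  \<open>R\<close> lift diagonally to operators commuting with \<open>W1\<close> and \<open>W2\<close>.
\<close>

lemma functorial_ando:
  fixes base :: "'k::chilbert_space \<Rightarrow> 'h::chilbert_space"
    and blk :: "'k \<Rightarrow> nat \<Rightarrow> ('h \<times> 'h) \<times> ('h \<times> 'h)"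
  assumes model: "sequence_model base blk mk"
    and S: "contraction S" and R: "contraction R" and SR: "\<And>h. S (R h) = R (S h)"
  obtains W1 W2 where "isometry W1" "isometry W2" "\<And>y. W1 (W2 y) = W2 (W1 y)"
    "\<And>h. cadjoint W1 (sequence_model.embed mk h) = sequence_model.embed mk (cadjoint S h)"
    "\<And>h. cadjoint W2 (sequence_model.embed mk h) = sequence_model.embed mk (cadjoint R h)"
    "\<And>X X' y. contraction X \<Longrightarrow> contraction X' \<Longrightarrow> adj X X' \<Longrightarrow>
       (\<And>h. X (S h) = S (X h)) \<Longrightarrow> (\<And>h. X (R h) = R (X h)) \<Longrightarrow>
       (\<And>h. X' (S h) = S (X' h)) \<Longrightarrow> (\<And>h. X' (R h) = R (X' h)) \<Longrightarrow>
       sequence_model.lift base blk mk X (amplify (amplify X)) (W1 y) =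
         W1 (sequence_model.lift base blk mk X (amplify (amplify X)) y) \<and>
       sequence_model.lift base blk mk X (amplify (amplify X)) (W2 y) =
         W2 (sequence_model.lift base blk mk X (amplify (amplify X)) y)"
proof -
  interpret m: sequence_model base blk mk by (rule model)
  obtain DS where DS: "contraction DS" "\<And>x. (norm (DS x))\<^sup>2 = (norm x)\<^sup>2 - (norm (S x))\<^sup>2"
    "\<And>X x. contraction X \<Longrightarrow> (\<And>x. X (S x) = S (X x)) \<Longrightarrow> (\<And>x. X (cadjoint S x) = cadjoint S (X x)) \<Longrightarrow> X (DS x) = DS (X x)"
    by (rule defect_operator[OF S]) blast
  obtain DR where DR: "contraction DR" "\<And>x. (norm (DR x))\<^sup>2 = (norm x)\<^sup>2 - (norm (R x))\<^sup>2"
    "\<And>X x. contraction X \<Longrightarrow> (\<And>x. X (R x) = R (X x)) \<Longrightarrow> (\<And>x. X (cadjoint R x) = cadjoint R (X x)) \<Longrightarrow> X (DR x) = DR (X x)"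
    by (rule defect_operator[OF R]) blast
  note lin = contraction_clinear[OF S] contraction_clinear[OF R] contraction_clinear[OF DS(1)] contraction_clinear[OF DR(1)]
  note lin0 = lin[THEN clinear_0]
  define a where "a h = (DS h, DR (S h))" for h
  define b where "b h = (DS (R h), DR h)" for h
  have ab: "clinear a" "clinear b"
    by (auto simp: a_def b_def clinear_def lin[THEN clinear_add] lin[THEN clinear_scaleC])
  have "norm (a h) = norm (b h)" for h
    by (simp add: a_def b_def norm_Pair DS(2) DR(2) SR)
  then obtain U U' :: "('h \<times> 'h) \<times> ('h \<times> 'h) \<Rightarrow> ('h \<times> 'h) \<times> ('h \<times> 'h)" where
    U: "isometry U" "isometry U'" "\<And>z. U (U' z) = z" "\<And>z. U' (U z) = z" "\<And>h. U (a h, 0) = (b h, 0)"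
    and Uc: "\<And>Q Q' X X' z. contraction Q \<Longrightarrow> contraction Q' \<Longrightarrow> adj Q Q' \<Longrightarrow>
       (\<And>h. Q (a h) = a (X h)) \<Longrightarrow> (\<And>h. Q (b h) = b (X h)) \<Longrightarrow>
       (\<And>h. Q' (a h) = a (X' h)) \<Longrightarrow> (\<And>h. Q' (b h) = b (X' h)) \<Longrightarrow>
       amplify Q (U z) = U (amplify Q z) \<and> amplify Q (U' z) = U' (amplify Q z)"
    by (rule julia_unitary[OF ab]) blast
  define P1 where "P1 = amplify (\<lambda>(x :: 'h, y :: 'h). (x, 0 :: 'h))"
  define P2 where "P2 = amplify (\<lambda>(x :: 'h, y :: 'h). (0 :: 'h, y))"
  define d1 where "d1 h = ((DS h, 0 :: 'h), (0 :: 'h, 0 :: 'h))" for h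
  define d2 where "d2 h = ((0 :: 'h, DR h), (0 :: 'h, 0 :: 'h))" for h
  have Pl: "clinear P1" "clinear P2"
    unfolding P1_def P2_def by (auto simp: clinear_def)
  have dl: "clinear d1" "clinear d2"
    by (auto simp: d1_def d2_def clinear_def lin[THEN clinear_add] lin[THEN clinear_scaleC])
  have orth: "(norm (P1 v + P2 w))\<^sup>2 = (norm (P1 v))\<^sup>2 + (norm (P2 w))\<^sup>2" for v w
    by (cases v; cases w) (auto simp: P1_def P2_def norm_Pair_sq)
  have split: "(norm (P1 v))\<^sup>2 + (norm (P2 v))\<^sup>2 = (norm v)\<^sup>2" for v
    by (cases v) (auto simp: P1_def P2_def norm_Pair_sq)
  have PP: "P1 (P1 v) = P1 v" "P2 (P2 v) = P2 v" "P1 (P2 v) = 0" "P2 (P1 v) = 0" "P1 v + P2 v = v" "P2 v + P1 v = v" for v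
    by (cases v; auto simp: P1_def P2_def zero_prod_def)+
  have iso_id: "isometry id" by (simp add: isometry_def clinear_id)
  interpret s1: block_shift base blk mk S d1 U' id P2 P1
  proof
    show "(norm (P2 v + P1 w))\<^sup>2 = (norm (P2 v))\<^sup>2 + (norm (P1 w))\<^sup>2" for v w
      using orth[of w v] by (simp add: add.commute)
    show "(norm (P2 v))\<^sup>2 + (norm (P1 v))\<^sup>2 = (norm v)\<^sup>2" for v
      using split[of v] by (simp add: add.commute)
    show "(norm (S h))\<^sup>2 + (norm (P1 (d1 h)))\<^sup>2 = (norm h)\<^sup>2" for h
      by (simp add: P1_def d1_def norm_Pair_sq DS(2))
  qed (rule lin dl U iso_id Pl)+
  interpret s2: block_shift base blk mk R d2 id U P1 P2
  proof
    show "(norm (R h))\<^sup>2 + (norm (P2 (d2 h)))\<^sup>2 = (norm h)\<^sup>2" for h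
      by (simp add: P2_def d2_def norm_Pair_sq DR(2))
  qed (rule lin dl U iso_id Pl orth split)+
  have U'l: "clinear U'" using U(2) by (simp add: isometry_def)
  note Padd = Pl[THEN clinear_add]
  have "s1.shift (s2.shift y) = s2.shift (s1.shift y)" for y
  proof (rule m.vec_eqI)
    show "base (s1.shift (s2.shift y)) = base (s2.shift (s1.shift y))"
      by (simp add: s1.base_shift s2.base_shift SR)
    show "blk (s1.shift (s2.shift y)) j = blk (s2.shift (s1.shift y)) j" for j
    proof (cases j)
      case 0
      have "P2 (d2 (base y)) + P1 (d1 (R (base y))) = (b (base y), 0)"
        by (simp add: P1_def P2_def d1_def d2_def b_def zero_prod_def)
      moreover have "P1 (d1 (base y)) + P2 (d2 (S (base y))) = (a (base y), 0)"
        by (simp add: P1_def P2_def d1_def d2_def a_def zero_prod_def)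
      ultimately show ?thesis
        using 0 by (simp add: s1.base_shift s2.base_shift s1.blk_shift s2.blk_shift U Padd PP)
    next
      case (Suc i)
      then show ?thesis
        by (cases i) (simp_all add: s1.base_shift s2.base_shift s1.blk_shift s2.blk_shift U Padd PP)
    qed
  qed
  moreover have "m.lift X (amplify (amplify X)) (s1.shift y) = s1.shift (m.lift X (amplify (amplify X)) y) \<and>
      m.lift X (amplify (amplify X)) (s2.shift y) = s2.shift (m.lift X (amplify (amplify X)) y)"
    if X: "contraction X" "contraction X'" "adj X X'"
      and c: "\<And>h. X (S h) = S (X h)" "\<And>h. X (R h) = R (X h)" "\<And>h. X' (S h) = S (X' h)" "\<And>h. X' (R h) = R (X' h)"
    for X X' y
  proof -
    note adjS = contraction_adj_exists[OF S] and adjR = contraction_adj_exists[OF R]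
    have XD: "X (DS x) = DS (X x)" "X (DR x) = DR (X x)" "X' (DS x) = DS (X' x)" "X' (DR x) = DR (X' x)" for x
      using adj_commute[OF adj_sym[OF X(3)] adjS c(3)] adj_commute[OF adj_sym[OF X(3)] adjR c(4)]
        adj_commute[OF X(3) adjS c(1)] adj_commute[OF X(3) adjR c(2)]
      by (auto intro!: DS(3) DR(3) X(1,2) c)
    have ab': "amplify X (a h) = a (X h)" "amplify X (b h) = b (X h)" "amplify X' (a h) = a (X' h)" "amplify X' (b h) = b (X' h)" for h
      by (simp_all add: a_def b_def XD c)
    have XU: "amplify (amplify X) (U z) = U (amplify (amplify X) z)" "amplify (amplify X) (U' z) = U' (amplify (amplify X) z)" for z
      using Uc[OF contraction_amplify[OF X(1)] contraction_amplify[OF X(2)] adj_amplify[OF X(3)] ab'] by auto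
    have X0: "X 0 = 0" using X(1) by (simp add: clinear_0 contraction_clinear)
    have XP: "amplify (amplify X) (P1 z) = P1 (amplify (amplify X) z)" "amplify (amplify X) (P2 z) = P2 (amplify (amplify X) z)" for z
      by (cases z; auto simp: P1_def P2_def X0)+
    have Xd: "amplify (amplify X) (d1 h) = d1 (X h)" "amplify (amplify X) (d2 h) = d2 (X h)" for h
      by (simp_all add: d1_def d2_def XD X0)
    note cX = X(1) contraction_amplify[OF contraction_amplify[OF X(1)]]
    show ?thesis
      using s1.lift_shift_commute[OF cX c(1) Xd(1) XU(2) _ XP(2,1)] s2.lift_shift_commute[OF cX c(2) Xd(2) _ XU(1) XP]
      by simp
  qed
  ultimately show ?thesis
    using that[OF s1.isometry_shift s2.isometry_shift _ s1.cadjoint_shift_embed[OF contraction_adj_exists[OF S]]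
      s2.cadjoint_shift_embed[OF contraction_adj_exists[OF R]]] by blast
qed

section \<open>From coextensions to dilations\<close>

lemma isometry_cinner:
  assumes "isometry J"
  shows "cinner (J x) (J y) = cinner x y"
proof (rule cinner_eq_from_inner)
  have J: "clinear J" "\<And>x. norm (J x) = norm x" using assms by (auto simp: isometry_def)
  have "4 * (J u \<bullet> J v) = 4 * (u \<bullet> v)" for u v
    unfolding inner_polarization by (simp add: J(2) flip: clinear_add[OF J(1)] clinear_diff[OF J(1)])
  then show "(a *\<^sub>C J x) \<bullet> J y = (a *\<^sub>C x) \<bullet> y" for a
    by (simp flip: clinear_scaleC[OF J(1)])
qed

lemma isometry_compose: "isometry A \<Longrightarrow> isometry B \<Longrightarrow> isometry (A \<circ> B)"
  by (simp add: isometry_def clinear_compose)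

lemma cadjoint_compose:
  "contraction A \<Longrightarrow> contraction B \<Longrightarrow> cadjoint (A \<circ> B) = cadjoint B \<circ> cadjoint A"
  by (intro adj_cadjoint adj_compose contraction_adj_exists)

lemma contraction_funpow: "contraction (A :: 'a::chilbert_space \<Rightarrow> 'a) \<Longrightarrow> contraction (A ^^ n)"
  by (induction n) (simp_all add: contraction_id contraction_compose)

lemma contraction_op_power:
  "(\<And>i. i \<in> set is \<Longrightarrow> contraction (A i)) \<Longrightarrow> contraction (op_power A is k)"
  by (induction "is") (simp_all add: contraction_id contraction_compose contraction_funpow)

lemma cadjoint_funpow:
  assumes "contraction (A :: 'a::chilbert_space \<Rightarrow> 'a)"
  shows "cadjoint (A ^^ n) = cadjoint A ^^ n"
proof (induction n)
  case 0
  show ?case by (rule adj_cadjoint) (simp add: adj_def)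
next
  case (Suc n)
  have "cadjoint (A ^^ Suc n) = cadjoint A ^^ n \<circ> cadjoint A"
    using cadjoint_compose[OF assms contraction_funpow[OF assms, of n]] Suc by simp
  then show ?case by (simp only: funpow_Suc_right)
qed

lemma cadjoint_id: "cadjoint id = (id :: 'a::chilbert_space \<Rightarrow> 'a)"
  by (rule adj_cadjoint) (simp add: adj_def)

lemma cadjoint_op_power_Cons:
  assumes "\<And>j. j \<in> set (i # is) \<Longrightarrow> contraction (A j)"
  shows "cadjoint (op_power A (i # is) k) = cadjoint (op_power A is k) \<circ> (cadjoint (A i) ^^ k i)"
  using assms by (simp add: cadjoint_compose contraction_funpow contraction_op_power cadjoint_funpow)

lemma tuple_power_op_power: "tuple_power m T k = op_power T [1..<Suc m] k"
  by (simp only: tuple_power_def op_power_def)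

lemma coextension_op_power:
  assumes "\<And>i. i \<in> set is \<Longrightarrow> contraction (T i)" "\<And>i. i \<in> set is \<Longrightarrow> contraction (W i)"
    and "\<And>i h. i \<in> set is \<Longrightarrow> cadjoint (W i) (J h) = J (cadjoint (T i) h)"
  shows "cadjoint (op_power W is k) (J h) = J (cadjoint (op_power T is k) h)"
  using assms
proof (induction "is" arbitrary: h)
  case (Cons i "is")
  have "(cadjoint (W i) ^^ n) (J h) = J ((cadjoint (T i) ^^ n) h)" for n h
    by (induction n) (simp_all add: Cons.prems(3))
  moreover have "cadjoint (op_power W is k) (J h) = J (cadjoint (op_power T is k) h)" for h
    using Cons.prems by (intro Cons.IH) auto
  moreover have "cadjoint (op_power W (i # is) k) = cadjoint (op_power W is k) \<circ> (cadjoint (W i) ^^ k i)"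
    "cadjoint (op_power T (i # is) k) = cadjoint (op_power T is k) \<circ> (cadjoint (T i) ^^ k i)"
    by (rule cadjoint_op_power_Cons; use Cons.prems in blast)+
  ultimately show ?case by (simp only: comp_apply)
qed (unfold op_power_simps cadjoint_id, simp)

text \<open>
  The adjoints of the \<open>W i\<close> leave the range of \<open>J\<close> invariant and act there as the \<open>T i\<^sup>*\<close>.  This
  one-step condition implies its own version for powers, and the dilation identity follows by taking
  adjoints.
\<close>

locale tuple_coextension =
  fixes m :: nat and T :: "nat \<Rightarrow> 'a::chilbert_space \<Rightarrow> 'a"
    and J :: "'a \<Rightarrow> 'k::chilbert_space" and W :: "nat \<Rightarrow> 'k \<Rightarrow> 'k"
  assumes T: "T \<in> commuting_contractions m" and J: "isometry J"
    and W: "\<And>i. i \<in> {1..m} \<Longrightarrow> isometry (W i)"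
    and comm: "\<And>i j x. i \<in> {1..m} \<Longrightarrow> j \<in> {1..m} \<Longrightarrow> W i (W j x) = W j (W i x)"
    and coext: "\<And>i h. i \<in> {1..m} \<Longrightarrow> cadjoint (W i) (J h) = J (cadjoint (T i) h)"
begin

lemma contractions: "i \<in> {1..m} \<Longrightarrow> contraction (T i)" "i \<in> {1..m} \<Longrightarrow> contraction (W i)"
  using commuting_contractionsD(1)[OF T] isometry_contraction[OF W] by auto

lemma contraction_tuple_power: "contraction (tuple_power m T k)" "contraction (tuple_power m W k)"
  unfolding tuple_power_op_power by (rule contraction_op_power, rule contractions, force)+

lemma coext_power: "cadjoint (tuple_power m W k) (J h) = J (cadjoint (tuple_power m T k) h)"
  unfolding tuple_power_op_power by (intro coextension_op_power contractions coext) auto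

lemma compress: "cadjoint J (tuple_power m W k (J h)) = tuple_power m T k h"
proof (rule cinner_eqI')
  fix g
  note adj = adjD[OF contraction_adj_exists[OF contraction_tuple_power(1)]]
    adjD[OF contraction_adj_exists[OF contraction_tuple_power(2)]]
    adjD[OF adj_sym[OF contraction_adj_exists[OF isometry_contraction[OF J]]]]
  show "cinner (cadjoint J (tuple_power m W k (J h))) g = cinner (tuple_power m T k h) g"
    by (simp add: adj coext_power isometry_cinner[OF J])
qed

lemma isometric_dilation: "isometric_dilation m T J W"
  unfolding isometric_dilation_def
  using J W contractions comm by (auto simp: commuting_contractions_def fun_eq_iff compress)

text \<open>
  The supports of \<open>\<alpha>\<^sub>+\<close> and \<open>\<alpha>\<^sub>-\<close> are disjoint, so by double commutativity \<open>W\<^bsup>*\<alpha>-\<^esup> W\<^bsup>\<alpha>+\<^esup> J\<close> equals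
  \<open>W\<^bsup>\<alpha>+\<^esup> W\<^bsup>*\<alpha>-\<^esup> J = W\<^bsup>\<alpha>+\<^esup> J T\<^bsup>*\<alpha>-\<^esup>\<close>, whose compression is \<open>T\<^bsup>\<alpha>+\<^esup> T\<^bsup>*\<alpha>-\<^esup>\<close>.
\<close>

lemma star_regular_dilation:
  assumes dc: "\<And>i j x. i \<in> {1..m} \<Longrightarrow> j \<in> {1..m} \<Longrightarrow> i \<noteq> j \<Longrightarrow> cadjoint (W i) (W j x) = W j (cadjoint (W i) x)"
  shows "star_regular_dilation m T J W"
  unfolding star_regular_dilation_def
proof (intro conjI allI isometric_dilation)
  fix \<alpha> :: "nat \<Rightarrow> int"
  have single: "cadjoint (op_power W is (neg_index \<alpha>)) (W j x) = W j (cadjoint (op_power W is (neg_index \<alpha>)) x)"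
    if "neg_index \<alpha> j = 0" "j \<in> {1..m}" "set is \<subseteq> {1..m}" for j x "is"
    using that(3)
  proof (induction "is" arbitrary: x)
    case Nil
    show ?case by (unfold op_power_simps cadjoint_id, simp)
  next
    case (Cons i "is")
    have "(cadjoint (W i) ^^ neg_index \<alpha> i) (W j x) = W j ((cadjoint (W i) ^^ neg_index \<alpha> i) x)" for x
    proof (cases "i = j")
      case False
      then show ?thesis using Cons.prems that(2) by (intro commute_funpow[symmetric] dc[symmetric]) auto
    qed (simp add: that(1))
    moreover have "cadjoint (op_power W (i # is) (neg_index \<alpha>))
        = cadjoint (op_power W is (neg_index \<alpha>)) \<circ> (cadjoint (W i) ^^ neg_index \<alpha> i)"
      by (rule cadjoint_op_power_Cons) (use Cons.prems contractions(2) in blast)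
    moreover have "cadjoint (op_power W is (neg_index \<alpha>)) (W j x) = W j (cadjoint (op_power W is (neg_index \<alpha>)) x)" for x
      using Cons by auto
    ultimately show ?case by (simp only: comp_apply)
  qed
  have "cadjoint (tuple_power m W (neg_index \<alpha>)) (tuple_power m W (pos_index \<alpha>) x)
      = tuple_power m W (pos_index \<alpha>) (cadjoint (tuple_power m W (neg_index \<alpha>)) x)" for x
    unfolding tuple_power_op_power
  proof (rule op_power_commute)
    fix j x assume "j \<in> set [1..<Suc m]"
    then have j: "j \<in> {1..m}" by auto
    show "cadjoint (op_power W [1..<Suc m] (neg_index \<alpha>)) ((W j ^^ pos_index \<alpha> j) x)
      = (W j ^^ pos_index \<alpha> j) (cadjoint (op_power W [1..<Suc m] (neg_index \<alpha>)) x)"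
    proof (cases "pos_index \<alpha> j = 0")
      case False
      then have "neg_index \<alpha> j = 0" by (simp add: pos_index_def neg_index_def)
      then show ?thesis using j by (intro commute_funpow single) auto
    qed simp
  qed
  then show "cadjoint J \<circ> cadjoint (tuple_power m W (neg_index \<alpha>)) \<circ> tuple_power m W (pos_index \<alpha>) \<circ> J
      = tuple_power m T (pos_index \<alpha>) \<circ> cadjoint (tuple_power m T (neg_index \<alpha>))"
    by (simp add: fun_eq_iff coext_power compress)
qed

end

section \<open>Tuples with two Brehmer positive subtuples\<close>

lemma infinite_dilation_index: "infinite (UNIV :: ((nat \<Rightarrow> nat) \<times> 'a) set)"
proof
  assume "finite (UNIV :: ((nat \<Rightarrow> nat) \<times> 'a) set)"
  then have "finite (range (\<lambda>p :: (nat \<Rightarrow> nat) \<times> 'a. fst p 0))" by (rule finite_imageI)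
  moreover have "range (\<lambda>p :: (nat \<Rightarrow> nat) \<times> 'a. fst p 0) = UNIV"
    by (rule surjI[of _ "\<lambda>n. (\<lambda>_. n, undefined)"]) simp
  ultimately show False by simp
qed

theorem theorem3p9:
  fixes T :: "nat \<Rightarrow> 'a::chilbert_space \<Rightarrow> 'a" and n :: nat
  assumes "n \<ge> 3" and "T \<in> brehmer_pq n 1 n"
  shows "\<exists>(J :: 'a \<Rightarrow> 'a dilation_space) (W :: nat \<Rightarrow> 'a dilation_space \<Rightarrow> 'a dilation_space).
           isometric_dilation n T J W \<and>
           star_regular_dilation (n - 1) (delete_entry 1 T) J (delete_entry 1 W) \<and>
           star_regular_dilation (n - 1) (delete_entry n T) J (delete_entry n W)"
proof -
  have T: "T \<in> commuting_contractions n"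
    and T1: "delete_entry 1 T \<in> brehmer (n - 1)" and Tn: "delete_entry n T \<in> brehmer (n - 1)"
    using assms(2) by (auto simp: brehmer_pq_def)
  define A where "A i = cadjoint (T i)" for i
  define I where "I = [2..<n]"
  have ind: "{2..<n} \<union> {1, n} = {1..n}" and setI: "set I = {2..<n}"
    using assms(1) by (auto simp: I_def)
  have cT: "contraction (T i)" if "i \<in> {1..n}" for i
    using commuting_contractionsD(1)[OF T that] .
  \<comment> \<open>Listing the outer index first turns Brehmer positivity of \<open>(T 1, \<dots>, T (n - 1))\<close> into positivity of \<open>\<langle>x, y\<rangle> - \<langle>A 1 x, A 1 y\<rangle>\<close> for the middle indices.\<close>
  have form1: "brehmer_form A (1 # I) cinner"
  proof -
    have "brehmer_form (\<lambda>i. cadjoint (delete_entry n T i)) (1 # I) cinner"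
      by (rule brehmer_imp_brehmer_form[OF Tn]) (use assms(1) in \<open>auto simp: I_def\<close>)
    then show ?thesis
      using assms(1) by (subst (asm) brehmer_form_cong[where B=A]) (auto simp: A_def delete_entry_def I_def)
  qed
  have formn: "brehmer_form A (n # I) cinner"
  proof -
    have "n # I = map Suc ((n - 1) # [1..<n - 1])"
      using assms(1) by (simp add: I_def map_Suc_upt numeral_2_eq_2)
    moreover have "brehmer_form (\<lambda>i. cadjoint (delete_entry 1 T i)) ((n - 1) # [1..<n - 1]) cinner"
      by (rule brehmer_imp_brehmer_form[OF T1]) (use assms(1) in auto)
    then have "brehmer_form (\<lambda>i. A (Suc i)) ((n - 1) # [1..<n - 1]) cinner"
      using assms(1) by (subst (asm) brehmer_form_cong[where B="\<lambda>i. A (Suc i)"]) (auto simp: A_def delete_entry_def)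
    ultimately show ?thesis by (simp only: brehmer_form_map)
  qed
  have linA: "clinear (A i)" if "i \<in> {1..n}" for i
    using contraction_clinear[OF contraction_cadjoint[OF cT]] that unfolding A_def .
  have commA: "A i (A j x) = A j (A i x)" if ij: "i \<in> {1..n}" "j \<in> {1..n}" for i j x
    unfolding A_def
    by (rule adj_commute[OF contraction_adj_exists[OF cT[OF ij(1)]] contraction_adj_exists[OF cT[OF ij(2)]]])
      (rule commuting_contractionsD(2)[OF T ij])
  obtain J0 :: "'a \<Rightarrow> 'a dilation_space" and B V :: "nat \<Rightarrow> 'a dilation_space \<Rightarrow> 'a dilation_space"
  where J0: "isometry J0"
    and B: "\<And>i. i \<in> {1..n} \<Longrightarrow> contraction (B i)"
    and BJ: "\<And>i h. i \<in> {1..n} \<Longrightarrow> B i (J0 h) = J0 (A i h)"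
    and BB: "\<And>i j x. i \<in> {1..n} \<Longrightarrow> j \<in> {1..n} \<Longrightarrow> B i (B j x) = B j (B i x)"
    and V: "\<And>i. i \<in> {2..<n} \<Longrightarrow> isometry (V i)"
    and VB: "\<And>i. i \<in> {2..<n} \<Longrightarrow> adj (V i) (B i)"
    and VBc: "\<And>i j x. i \<in> {2..<n} \<Longrightarrow> j \<in> {1..n} \<Longrightarrow> i \<noteq> j \<Longrightarrow> V i (B j x) = B j (V i x)"
  proof (rule brehmer_coextension[of I "{1, n}" A, unfolded setI ind])
    show "distinct I" "{2..<n} \<inter> {1, n} = {}" by (auto simp: I_def)
    show "brehmer_form A (p # I) cinner" if "p \<in> {1, n}" for p
      using that form1 formn by auto
    show "brehmer_form A I cinner" using form1 by simp
    show "clinear (A i)" if "i \<in> {1..n}" for i by (rule linA[OF that])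
    show "A i (A j x) = A j (A i x)" if "i \<in> {1..n}" "j \<in> {1..n}" for i j x by (rule commA[OF that])
  qed (rule that, assumption+)
  \<comment> \<open>\<open>S\<close> and \<open>R\<close> lift \<open>T 1\<close> and \<open>T n\<close>; they doubly commute with the isometries \<open>V i\<close>.\<close>
  define S where "S = cadjoint (B 1)"
  define R where "R = cadjoint (B n)"
  have mem: "1 \<in> {1..n}" "n \<in> {1..n}" using assms(1) by auto
  have SR: "contraction S" "contraction R" "adj (B 1) S" "adj (B n) R"
    unfolding S_def R_def by (intro contraction_cadjoint contraction_adj_exists B mem)+
  have comm_SR: "S (R h) = R (S h)" for h
    by (rule adj_commute[OF SR(3,4)]) (rule BB[OF mem])
  obtain base :: "'a dilation_space \<Rightarrow> 'a dilation_space"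
    and blk :: "'a dilation_space \<Rightarrow> nat \<Rightarrow> ('a dilation_space \<times> 'a dilation_space) \<times> ('a dilation_space \<times> 'a dilation_space)"
    and mk where model: "sequence_model base blk mk"
    by (rule ell2_sequence_model[OF infinite_dilation_index]) blast
  interpret m: sequence_model base blk mk by (rule model)
  define L where "L X = m.lift X (amplify (amplify X))" for X
  obtain W1 Wn where W1: "isometry W1" and Wn: "isometry Wn" and W1n: "\<And>y. W1 (Wn y) = Wn (W1 y)"
    and W1_embed: "\<And>h. cadjoint W1 (m.embed h) = m.embed (cadjoint S h)"
    and Wn_embed: "\<And>h. cadjoint Wn (m.embed h) = m.embed (cadjoint R h)"
    and L_comm: "\<And>X X' y. contraction X \<Longrightarrow> contraction X' \<Longrightarrow> adj X X' \<Longrightarrow>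
       (\<And>h. X (S h) = S (X h)) \<Longrightarrow> (\<And>h. X (R h) = R (X h)) \<Longrightarrow>
       (\<And>h. X' (S h) = S (X' h)) \<Longrightarrow> (\<And>h. X' (R h) = R (X' h)) \<Longrightarrow>
       L X (W1 y) = W1 (L X y) \<and> L X (Wn y) = Wn (L X y)"
    by (rule functorial_ando[OF model SR(1,2) comm_SR]) (unfold L_def, blast)
  define J where "J = m.embed \<circ> J0"
  define W where "W i = (if i = 1 then W1 else if i = n then Wn else L (V i))" for i
  have W_mid: "W i = L (V i)" if "i \<in> {2..<n}" for i using that by (auto simp: W_def)
  have W_ends: "W 1 = W1" "W n = Wn" using assms(1) by (auto simp: W_def)
  have cases_n: "i = 1 \<or> i = n \<or> i \<in> {2..<n}" if "i \<in> {1..n}" for i using that by auto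
  have cV: "contraction (V i)" and cB: "contraction (B i)" if "i \<in> {2..<n}" for i
    using isometry_contraction[OF V[OF that]] B[of i] that by auto
  have adj_L: "adj (L (V i)) (L (B i))" if "i \<in> {2..<n}" for i
    unfolding L_def using cV[OF that] cB[OF that] VB[OF that]
    by (intro m.adj_lift contraction_amplify adj_amplify)
  have VS: "V i (S h) = S (V i h)" "V i (R h) = R (V i h)" "B i (S h) = S (B i h)" "B i (R h) = R (B i h)"
    if i: "i \<in> {2..<n}" for i h
  proof -
    have i': "i \<in> {1..n}" "i \<noteq> 1" "i \<noteq> n" using i by auto
    show "V i (S h) = S (V i h)" "V i (R h) = R (V i h)"
      by (rule adj_commute[OF adj_sym[OF VB[OF i]] SR(3) BB[OF i'(1) mem(1)]]
          adj_commute[OF adj_sym[OF VB[OF i]] SR(4) BB[OF i'(1) mem(2)]])+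
    show "B i (S h) = S (B i h)" "B i (R h) = R (B i h)"
      by (rule adj_commute[OF VB[OF i] SR(3) VBc[OF i mem(1) i'(2)]]
          adj_commute[OF VB[OF i] SR(4) VBc[OF i mem(2) i'(3)]])+
  qed
  have LV_W: "L (V i) (W1 y) = W1 (L (V i) y)" "L (V i) (Wn y) = Wn (L (V i) y)"
    and LB_W: "L (B i) (W1 y) = W1 (L (B i) y)" "L (B i) (Wn y) = Wn (L (B i) y)"
    if i: "i \<in> {2..<n}" for i y
    using L_comm[OF cV[OF i] cB[OF i] VB[OF i] VS[OF i]] L_comm[OF cB[OF i] cV[OF i] adj_sym[OF VB[OF i]] VS(3,4,1,2)[OF i]]
    by blast+
  have LL: "L X (L Y y) = L Y (L X y)" if "contraction X" "contraction Y" "\<And>h. X (Y h) = Y (X h)" for X Y y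
    unfolding L_def using that by (intro m.lift_commute contraction_amplify) (auto split: prod.splits)
  have iso_W: "isometry (W i)" if "i \<in> {1..n}" for i
    using cases_n[OF that] V W1 Wn
    by (auto simp: W_mid W_ends W_ends(1)[unfolded One_nat_def] L_def intro!: m.isometry_lift isometry_amplify)
  have comm_W: "W i (W j x) = W j (W i x)" if "i \<in> {1..n}" "j \<in> {1..n}" for i j x
  proof -
    have "L (V i) (L (V j) x) = L (V j) (L (V i) x)" if "i \<in> {2..<n}" "j \<in> {2..<n}" for i j
      using that adj_commute[OF adj_sym[OF VB[OF that(1)]] adj_sym[OF VB[OF that(2)]] BB[of i j]]
      by (intro LL cV) auto
    then show ?thesis
      using cases_n[OF that(1)] cases_n[OF that(2)] W1n LV_W
      by (elim disjE) (simp_all only: W_mid W_ends)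
  qed
  have coext_W: "cadjoint (W i) (J h) = J (cadjoint (T i) h)" if "i \<in> {1..n}" for i h
    using cases_n[OF that]
  proof (elim disjE)
    assume i: "i \<in> {2..<n}"
    have "cadjoint (W i) = L (B i)" by (simp only: W_mid[OF i] adj_cadjoint[OF adj_L[OF i]])
    moreover have "L (B i) (m.embed g) = m.embed (B i g)" for g
      unfolding L_def by (intro m.lift_embed cB[OF i] contraction_amplify)
    ultimately show ?thesis
      using BJ[OF that] by (simp add: J_def A_def)
  qed (use BJ[OF mem(1)] BJ[OF mem(2)] in \<open>simp_all add: W_ends J_def A_def W1_embed Wn_embed
        adj_cadjoint[OF adj_sym[OF SR(3)]] adj_cadjoint[OF adj_sym[OF SR(4)]] del: One_nat_def\<close>)
  \<comment> \<open>The pair \<open>W 1\<close>, \<open>W n\<close> is the only one that need not doubly commute.\<close>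
  have dc_W: "cadjoint (W i) (W j x) = W j (cadjoint (W i) x)"
    if "i \<in> {1..n}" "j \<in> {1..n}" "i \<noteq> j" "{i, j} \<noteq> {1, n}" for i j x
  proof -
    have mid: ?thesis if i: "i \<in> {2..<n}"
    proof -
      have "L (B i) (L (V j) x) = L (V j) (L (B i) x)" if "j \<in> {2..<n}"
        using VBc[OF that \<open>i \<in> {1..n}\<close>] \<open>i \<noteq> j\<close> by (intro LL cB[OF i] cV[OF that]) auto
      then show ?thesis
        using cases_n[OF \<open>j \<in> {1..n}\<close>] LB_W[OF i]
        by (elim disjE) (simp_all only: W_mid W_ends adj_cadjoint[OF adj_L] i)
    qed
    have ends: ?thesis if j: "j \<in> {2..<n}" and i: "i \<in> {1, n}"
    proof -
      have "W i (L (B j) y) = L (B j) (W i y)" for y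
        using i LB_W[OF j] by (elim insertE emptyE) (simp_all only: W_ends)
      from adj_commute[OF contraction_adj_exists[OF isometry_contraction[OF iso_W[OF \<open>i \<in> {1..n}\<close>]]]
          adj_sym[OF adj_L[OF j]] this]
      show ?thesis by (simp only: W_mid[OF j])
    qed
    from cases_n[OF \<open>i \<in> {1..n}\<close>] cases_n[OF \<open>j \<in> {1..n}\<close>] \<open>i \<noteq> j\<close> \<open>{i, j} \<noteq> {1, n}\<close>
    show ?thesis using mid ends by blast
  qed
  have J_iso: "isometry J"
    unfolding J_def by (rule isometry_compose[OF m.isometry_embed J0])
  interpret whole: tuple_coextension n T J W
    by unfold_locales (fact T J_iso iso_W comm_W coext_W)+
  have del1: "delete_entry 1 X i = X (Suc i)" if "i \<in> {1..n - 1}" for X :: "nat \<Rightarrow> 'x" and i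
    using that by (simp add: delete_entry_def)
  have deln: "delete_entry n X i = X i" if "i \<in> {1..n - 1}" for X :: "nat \<Rightarrow> 'x" and i
    using that by (auto simp: delete_entry_def)
  \<comment> \<open>Each of the two shortened tuples misses one member of the exceptional pair.\<close>
  interpret del1: tuple_coextension "n - 1" "delete_entry 1 T" J "delete_entry 1 W"
  proof
    show "delete_entry 1 T \<in> commuting_contractions (n - 1)" using T1 by (simp add: brehmer_def)
  qed (use iso_W comm_W coext_W in \<open>auto simp: del1 J_iso simp del: One_nat_def\<close>)
  interpret deln: tuple_coextension "n - 1" "delete_entry n T" J "delete_entry n W"
  proof
    show "delete_entry n T \<in> commuting_contractions (n - 1)" using Tn by (simp add: brehmer_def)
  qed (use iso_W comm_W coext_W in \<open>auto simp: deln J_iso\<close>)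
  have "star_regular_dilation (n - 1) (delete_entry 1 T) J (delete_entry 1 W)"
  proof (rule del1.star_regular_dilation)
    fix i j x assume ij: "i \<in> {1..n - 1}" "j \<in> {1..n - 1}" "i \<noteq> j"
    then have "{Suc i, Suc j} \<noteq> {1, n}" by (auto simp: doubleton_eq_iff)
    then show "cadjoint (delete_entry 1 W i) (delete_entry 1 W j x) = delete_entry 1 W j (cadjoint (delete_entry 1 W i) x)"
      unfolding del1[OF ij(1)] del1[OF ij(2)] using ij by (intro dc_W) auto
  qed
  moreover have "star_regular_dilation (n - 1) (delete_entry n T) J (delete_entry n W)"
  proof (rule deln.star_regular_dilation)
    fix i j x assume ij: "i \<in> {1..n - 1}" "j \<in> {1..n - 1}" "i \<noteq> j"
    then have "{i, j} \<noteq> {1, n}" by (auto simp: doubleton_eq_iff)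
    then show "cadjoint (delete_entry n W i) (delete_entry n W j x) = delete_entry n W j (cadjoint (delete_entry n W i) x)"
      unfolding deln[OF ij(1)] deln[OF ij(2)] using ij by (intro dc_W) auto
  qed
  ultimately show ?thesis using whole.isometric_dilation by blast
qed

end
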